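(* Fix an integer $d\ge1$. Given a sequence $(\rho_i)_{i=1}^\infty$ of numbers in $[0,1)$ and a sequence $(n_i)_{i=1}^\infty$ of natural numbers, there is a sequence $(X^{(i)})_{i=1}^\infty$ in the row ball $\mathcal B^d$ such that each $X^{(i)}$ has size $n_i$ (i.e. $X^{(i)}\in\mathcal B^d_{n_i}$) and, for any sequence $(Y^{(i)})_{i=1}^\infty$ of matrices $Y^{(i)}\in M_{n_i}(\mathbb C)$ with $\|Y^{(i)}\|\le\rho_i$ for all $i$, there is a function $f\in H^\infty(\mathcal B^d)$ of norm $1$ such that $f(X^{(i)})=Y^{(i)}$ for all $i$.
   Context: Row ball: $\mathcal B^d=\bigsqcup_{m\ge1}\mathcal B^d_m$, where $\mathcal B^d_m$ is the set of $d$-tuples of complex $m\times m$ matrices $X=(X_1,\dots,X_d)$ with $\|\sum_{i=1}^d X_iX_i^*\|<1$. An nc function $f:\mathcal B^d\to\bigsqcup_m M_m(\mathbb C)$ is a graded function (mapping $\mathcal B^d_m$ into $M_m(\mathbb C)$) with $f(X\oplus Y)=f(X)\oplus f(Y)$ and $f(S^{-1}XS)=S^{-1}f(X)S$ whenever $S$ is invertible and $X,S^{-1}XS\in\mathcal B^d$ (operations on tuples are coordinatewise). $H^\infty(\mathcal B^d)$ is the set of nc functions with $\|f\|_\infty=\sup_{X\in\mathcal B^d}\|f(X)\|<\infty$; the norm of $f$ is $\|f\|_\infty$.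
   Formalization: For d=1 it is additionally assumed that each i has n_i=1 or ρ_i=0; otherwise the claim is false, since for d=1 all values f(X^{(i)}) lie in the commutative algebra generated by X^{(i)}, so not every Y^{(i)} with norm at most ρ_i>0 is attained. *)

theory Defs
  imports
    "HOL-Analysis.L2_Norm"
    "Jordan_Normal_Form.Schur_Decomposition"
begin

text \<open>Matrix sizes vary inside the statement, so matrices are the dimension-carrying ones of
  \<^theory>\<open>Jordan_Normal_Form.Matrix\<close>. A \<open>d\<close>-tuple of matrices is a list of length \<open>d\<close>.\<close>

definition vec_l2 :: "complex vec \<Rightarrow> real" where
  "vec_l2 v = L2_set (\<lambda>i. cmod (v $ i)) {..<dim_vec v}"

definition op_norm :: "complex mat \<Rightarrow> real" where
  "op_norm A = (SUP v \<in> {v \<in> carrier_vec (dim_col A). vec_l2 v \<le> 1}. vec_l2 (A *\<^sub>v v))"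

definition row_square :: "nat \<Rightarrow> complex mat list \<Rightarrow> complex mat" where
  "row_square m X = foldr (\<lambda>A B. A * mat_adjoint A + B) X (0\<^sub>m m m)"

definition row_ball_level :: "nat \<Rightarrow> nat \<Rightarrow> complex mat list set" where
  "row_ball_level d m =
    {X. length X = d \<and> set X \<subseteq> carrier_mat m m \<and> op_norm (row_square m X) < 1}"

definition row_ball :: "nat \<Rightarrow> complex mat list set" where
  "row_ball d = (\<Union>m\<in>{1..}. row_ball_level d m)"

definition mat_dsum :: "complex mat \<Rightarrow> complex mat \<Rightarrow> complex mat" where
  "mat_dsum A B =
    four_block_mat A (0\<^sub>m (dim_row A) (dim_col B)) (0\<^sub>m (dim_row B) (dim_col A)) B"

definition tuple_dsum :: "complex mat list \<Rightarrow> complex mat list \<Rightarrow> complex mat list" where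
  "tuple_dsum X Y = map2 mat_dsum X Y"

text \<open>Functions on the row ball are total functions of which only the values on \<^term>\<open>row_ball d\<close>
  matter. In the third clause \<open>T\<close> is the inverse of \<open>S\<close>.\<close>

definition nc_function :: "nat \<Rightarrow> (complex mat list \<Rightarrow> complex mat) \<Rightarrow> bool" where
  "nc_function d f \<longleftrightarrow>
    (\<forall>m\<ge>1. \<forall>X \<in> row_ball_level d m. f X \<in> carrier_mat m m) \<and>
    (\<forall>X \<in> row_ball d. \<forall>Y \<in> row_ball d.
       f (tuple_dsum X Y) = mat_dsum (f X) (f Y)) \<and>
    (\<forall>m\<ge>1. \<forall>X \<in> row_ball_level d m. \<forall>S \<in> carrier_mat m m. \<forall>T \<in> carrier_mat m m.
       inverts_mat S T \<longrightarrow> inverts_mat T S \<longrightarrow>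
       map (\<lambda>A. T * A * S) X \<in> row_ball_level d m \<longrightarrow>
       f (map (\<lambda>A. T * A * S) X) = T * f X * S)"

definition H_inf :: "nat \<Rightarrow> (complex mat list \<Rightarrow> complex mat) set" where
  "H_inf d = {f. nc_function d f \<and> bdd_above ((\<lambda>X. op_norm (f X)) ` row_ball d)}"

definition H_inf_norm :: "nat \<Rightarrow> (complex mat list \<Rightarrow> complex mat) \<Rightarrow> real" where
  "H_inf_norm d f = (SUP X \<in> row_ball d. op_norm (f X))"

text \<open>A pitfall for \<open>d = 1\<close>: by similarity invariance the value of an nc function at a single
  matrix \<open>A\<close> commutes with everything that commutes with \<open>A\<close>. So no single point of size
  \<open>m \<ge> 2\<close> can be mapped to all matrices in a ball of positive radius, and interpolation of
  arbitrary targets at such points is possible only if \<open>d \<ge> 2\<close>.\<close>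

end

theory Submission
  imports Defs
begin

text \<open>The function is a limit of functions \<open>F\<^sub>k\<close> that interpolate at the first \<open>k\<close> points, with
  \<open>F\<^sub>k\<^sub>+\<^sub>1 = (1 - c) F\<^sub>k (1 - c) + c h c\<close>. Here \<open>h\<close> interpolates at the new point alone and
  \<open>c = (1 - M / \<alpha>) / 2\<close>, where \<open>M\<close> is the Moebius transform \<open>(\<alpha> - \<psi>) (1 - \<alpha> \<psi>)\<^sup>-\<^sup>1\<close> of a contractive
  \<open>\<psi>\<close>. The row and the column with entries \<open>1 - c\<close> and \<open>c\<close> are unitarily equivalent to
  \<open>1 / sqrt 2\<close> times those with entries \<open>1\<close> and \<open>M / \<alpha>\<close>, so for \<open>\<alpha>\<close> close to \<open>1\<close> the step costs a
  factor close to \<open>1\<close> in norm. The function \<open>\<psi>\<close> is a multiple of a Blaschke product in a high power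
  of the first coordinate; it vanishes at the old points, has a prescribed scalar value at the new
  one, and is tiny at any given point of the row ball once \<open>k\<close> is large, which gives convergence.

  The points are \<open>(t D, t sqrt (1 - t\<^sup>2) S, 0, \<dots>, 0)\<close> with the clock and shift matrices \<open>D\<close> and \<open>S\<close>
  and \<open>t\<close> close to \<open>1\<close>. At such a point the discrete Fourier projections of the first
  coordinate and its resolvents, applied to the second one, combine to exact multiples of matrix
  units at a small cost in norm.\<close>

subsection \<open>Operator norm bounds\<close>

text \<open>The order of the quantifiers shapes the construction: the points are fixed before the
  targets are known. So the norm budget \<open>\<mu>\<close>, the constants \<open>\<alpha>\<close>,
  the exponents and the functions \<open>\<psi>\<close> depend only on \<open>\<rho>\<close> and the
  sizes, and the targets enter through the one-point functions \<open>h\<close> alone. Infinitely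
  many gluing steps fit below norm 1 because each \<open>\<rho> k\<close> is less than 1: an
  increasing budget with \<open>\<rho> k < \<mu> k < 1\<close> is fixed, and
  \<open>\<alpha> k\<close> is solved from the ratio of consecutive budgets. The values do not
  commute, so \<open>c\<close> multiplies from both sides; this matches the estimate of a row times
  a block diagonal times a column. A power of the first coordinate enters \<open>\<psi>\<close>
  because an exponent divisible by all sizes met so far makes that power scalar at all these nodes,
  which reduces a matrix problem at several points to interpolation on the unit interval. At a
  single node the first coordinate only separates the eigenvectors, and the second one moves between
  them. For \<open>d = 1\<close> a target is a 1 by 1 matrix or zero, and a constant interpolates
  it.\<close>

definition ip :: "complex vec \<Rightarrow> complex vec \<Rightarrow> complex" where
  "ip v w = (\<Sum>i<dim_vec v. v $ i * cnj (w $ i))"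

text \<open>An upper bound in place of the norm itself: such bounds pass through sums, products,
  adjoints and limits without any supremum. The clause \<open>0 \<le> K\<close> matters for
  \<open>m = 0\<close>, where all vectors have length zero.\<close>

definition bnd :: "nat \<Rightarrow> real \<Rightarrow> complex mat \<Rightarrow> bool" where
  "bnd m K A \<longleftrightarrow> A \<in> carrier_mat m m \<and> 0 \<le> K \<and>
    (\<forall>v\<in>carrier_vec m. vec_l2 (A *\<^sub>v v) \<le> K * vec_l2 v)"

lemma vec_l2_nonneg [simp]: "0 \<le> vec_l2 v"
  by (simp add: vec_l2_def L2_set_nonneg)

lemma vec_l2_sq: "(vec_l2 v)\<^sup>2 = (\<Sum>i<dim_vec v. (cmod (v $ i))\<^sup>2)"
  by (simp add: vec_l2_def L2_set_def sum_nonneg)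

lemma ip_self: "ip v v = of_real ((vec_l2 v)\<^sup>2)"
  by (simp add: ip_def vec_l2_sq complex_norm_square del: of_real_power)

lemma vec_l2_smult: "vec_l2 (z \<cdot>\<^sub>v v) = cmod z * vec_l2 v"
  by (simp add: vec_l2_def L2_set_def norm_mult power_mult_distrib real_sqrt_mult flip: sum_distrib_left)

lemma vec_l2_zero [simp]: "vec_l2 (0\<^sub>v m) = 0"
  by (simp add: vec_l2_def L2_set_def)

lemma vec_l2_eq_0: "v \<in> carrier_vec m \<Longrightarrow> vec_l2 v = 0 \<Longrightarrow> v = 0\<^sub>v m"
  by (intro eq_vecI) (auto simp: vec_l2_def L2_set_eq_0_iff)

lemma vec_l2_add:
  "v \<in> carrier_vec m \<Longrightarrow> w \<in> carrier_vec m \<Longrightarrow> vec_l2 (v + w) \<le> vec_l2 v + vec_l2 w"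
proof -
  assume c: "v \<in> carrier_vec m" "w \<in> carrier_vec m"
  then have "vec_l2 (v + w) = L2_set (\<lambda>i. cmod (v $ i + w $ i)) {..<m}"
    by (auto simp: vec_l2_def intro!: L2_set_cong)
  also have "\<dots> \<le> L2_set (\<lambda>i. cmod (v $ i) + cmod (w $ i)) {..<m}"
    by (intro L2_set_mono) (auto intro: norm_triangle_ineq)
  also have "\<dots> \<le> vec_l2 v + vec_l2 w"
    using c L2_set_triangle_ineq[of "\<lambda>i. cmod (v $ i)" "\<lambda>i. cmod (w $ i)" "{..<m}"]
    by (simp add: vec_l2_def)
  finally show ?thesis .
qed

lemma vec_l2_unit_vec: "i < m \<Longrightarrow> vec_l2 (unit_vec m i) = 1"
proof -
  assume "i < m"
  then have "(\<Sum>k<m. (cmod (unit_vec m i $ k))\<^sup>2) = (\<Sum>k<m. if k = i then 1 else 0)"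
    by (intro sum.cong) auto
  then show ?thesis using \<open>i < m\<close> by (simp add: vec_l2_def L2_set_def)
qed

lemma entry_le_vec_l2: "i < dim_vec v \<Longrightarrow> cmod (v $ i) \<le> vec_l2 v"
  unfolding vec_l2_def by (rule member_le_L2_set) auto

lemma ip_cauchy_schwarz:
  "v \<in> carrier_vec m \<Longrightarrow> w \<in> carrier_vec m \<Longrightarrow> cmod (ip v w) \<le> vec_l2 v * vec_l2 w"
proof -
  assume c: "v \<in> carrier_vec m" "w \<in> carrier_vec m"
  have "cmod (ip v w) \<le> (\<Sum>i<m. cmod (v $ i) * cmod (w $ i))"
    using c unfolding ip_def by (intro order_trans[OF norm_sum]) (auto simp: norm_mult)
  also have "\<dots> \<le> vec_l2 v * vec_l2 w"
    using c L2_set_mult_ineq[of "\<lambda>i. cmod (v $ i)" "\<lambda>i. cmod (w $ i)" "{..<m}"]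
    by (simp add: vec_l2_def)
  finally show ?thesis .
qed

lemma ip_add_left: "v \<in> carrier_vec m \<Longrightarrow> v' \<in> carrier_vec m \<Longrightarrow> ip (v + v') w = ip v w + ip v' w"
  by (simp add: ip_def distrib_right sum.distrib)

lemma adjoint_carrier [simp]: "A \<in> carrier_mat n m \<Longrightarrow> mat_adjoint A \<in> carrier_mat m n"
  by (auto simp: mat_adjoint_def)

lemma adjoint_dim [simp]:
  "dim_row (mat_adjoint A) = dim_col A" "dim_col (mat_adjoint A) = dim_row A"
  by (auto simp: mat_adjoint_def)

lemma index_adjoint [simp]:
  "i < dim_col A \<Longrightarrow> j < dim_row A \<Longrightarrow> mat_adjoint A $$ (i, j) = cnj (A $$ (j, i))"
  by (simp add: mat_adjoint_def mat_of_rows_index)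

lemma index_mult_mat_vec_sum:
  "A \<in> carrier_mat n m \<Longrightarrow> v \<in> carrier_vec m \<Longrightarrow> i < n \<Longrightarrow>
    (A *\<^sub>v v) $ i = (\<Sum>j<m. A $$ (i, j) * v $ j)"
  by (simp add: scalar_prod_def atLeast0LessThan)

lemma ip_adjoint:
  assumes "A \<in> carrier_mat n m" "v \<in> carrier_vec m" "w \<in> carrier_vec n"
  shows "ip (A *\<^sub>v v) w = ip v (mat_adjoint A *\<^sub>v w)"
proof -
  have "ip (A *\<^sub>v v) w = (\<Sum>i<n. \<Sum>j<m. A $$ (i, j) * v $ j * cnj (w $ i))"
    using assms by (simp add: ip_def index_mult_mat_vec_sum sum_distrib_right del: index_mult_mat_vec)
  also have "\<dots> = (\<Sum>j<m. \<Sum>i<n. A $$ (i, j) * v $ j * cnj (w $ i))"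
    by (rule sum.swap)
  also have "\<dots> = ip v (mat_adjoint A *\<^sub>v w)"
    using assms by (simp add: ip_def index_mult_mat_vec_sum[of _ m n] sum_distrib_left
       mult_ac del: index_mult_mat_vec)
  finally show ?thesis .
qed

lemma adjoint_adjoint [simp]: "mat_adjoint (mat_adjoint A) = (A :: complex mat)"
  by (intro eq_matI) auto

lemma bndI:
  "A \<in> carrier_mat m m \<Longrightarrow> 0 \<le> K \<Longrightarrow>
    (\<And>v. v \<in> carrier_vec m \<Longrightarrow> vec_l2 (A *\<^sub>v v) \<le> K * vec_l2 v) \<Longrightarrow> bnd m K A"
  by (simp add: bnd_def)

lemma bndD: "bnd m K A \<Longrightarrow> v \<in> carrier_vec m \<Longrightarrow> vec_l2 (A *\<^sub>v v) \<le> K * vec_l2 v"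
  by (simp add: bnd_def)

lemma bnd_carrier: "bnd m K A \<Longrightarrow> A \<in> carrier_mat m m" 
  by (simp add: bnd_def)

lemma bnd_nonneg: "bnd m K A \<Longrightarrow> 0 \<le> K" 
  by (simp add: bnd_def)

lemma bnd_mono: "bnd m K A \<Longrightarrow> K \<le> L \<Longrightarrow> bnd m L A"
  by (force simp: bnd_def intro: order_trans mult_right_mono)

text \<open>Testing with u = A v gives |A v|^2 \<le> K |v| |A v|. Sesquilinear estimates are what
  row and column arguments produce, so block matrices never have to be formed.\<close>

lemma bnd_ipI:
  assumes A: "A \<in> carrier_mat m m" and K: "0 \<le> K"
    and le: "\<And>u v. u \<in> carrier_vec m \<Longrightarrow> v \<in> carrier_vec m \<Longrightarrow>
      cmod (ip (A *\<^sub>v v) u) \<le> K * vec_l2 v * vec_l2 u"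
  shows "bnd m K A"
proof (rule bndI[OF A K])
  fix v :: "complex vec" assume v: "v \<in> carrier_vec m"
  let ?w = "A *\<^sub>v v"
  have "(vec_l2 ?w)\<^sup>2 \<le> K * vec_l2 v * vec_l2 ?w"
    using le[of ?w v] A v by (simp add: ip_self del: of_real_power)
  then show "vec_l2 ?w \<le> K * vec_l2 v"
    using K by (cases "vec_l2 ?w = 0") (auto simp: power2_eq_square less_le)
qed

lemma bnd_adjoint:
  assumes "bnd m K A"
  shows "bnd m K (mat_adjoint A)"
proof (rule bnd_ipI)
  note A = bnd_carrier[OF assms]
  show "mat_adjoint A \<in> carrier_mat m m" "0 \<le> K" using A bnd_nonneg[OF assms] by auto
  fix u v :: "complex vec" assume uv: "u \<in> carrier_vec m" "v \<in> carrier_vec m"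
  have "ip (mat_adjoint A *\<^sub>v v) u = ip v (A *\<^sub>v u)"
    using ip_adjoint[of "mat_adjoint A" m m v u] A uv by simp
  then have "cmod (ip (mat_adjoint A *\<^sub>v v) u) \<le> vec_l2 v * vec_l2 (A *\<^sub>v u)"
    using ip_cauchy_schwarz[of v m "A *\<^sub>v u"] A uv by simp
  also have "\<dots> \<le> vec_l2 v * (K * vec_l2 u)"
    using bndD[OF assms, of u] uv by (intro mult_left_mono) auto
  finally show "cmod (ip (mat_adjoint A *\<^sub>v v) u) \<le> K * vec_l2 v * vec_l2 u"
    by (simp add: mult_ac)
qed

lemma bnd_mult:
  assumes "bnd m K A" "bnd m L B"
  shows "bnd m (K * L) (A * B)"
proof (rule bndI)
  note c = bnd_carrier[OF assms(1)] bnd_carrier[OF assms(2)] 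
    and k = bnd_nonneg[OF assms(1)] bnd_nonneg[OF assms(2)]
  show "A * B \<in> carrier_mat m m" "0 \<le> K * L" using c k by auto
  fix v :: "complex vec" assume v: "v \<in> carrier_vec m"
  have "vec_l2 (A * B *\<^sub>v v) \<le> K * vec_l2 (B *\<^sub>v v)"
    using bndD[OF assms(1), of "B *\<^sub>v v"] c v by simp
  also have "\<dots> \<le> K * (L * vec_l2 v)"
    using bndD[OF assms(2) v] k by (intro mult_left_mono) auto
  finally show "vec_l2 (A * B *\<^sub>v v) \<le> K * L * vec_l2 v" by (simp add: mult_ac)
qed

lemma bnd_add:
  assumes "bnd m K A" "bnd m L B"
  shows "bnd m (K + L) (A + B)"
proof (rule bndI)
  note c = bnd_carrier[OF assms(1)] bnd_carrier[OF assms(2)] 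
    and k = bnd_nonneg[OF assms(1)] bnd_nonneg[OF assms(2)]
  show "A + B \<in> carrier_mat m m" "0 \<le> K + L" using c k by auto
  fix v :: "complex vec" assume v: "v \<in> carrier_vec m"
  have "(A + B) *\<^sub>v v = A *\<^sub>v v + B *\<^sub>v v" using c v by (simp add: add_mult_distrib_mat_vec)
  then show "vec_l2 ((A + B) *\<^sub>v v) \<le> (K + L) * vec_l2 v"
    using vec_l2_add[of "A *\<^sub>v v" m "B *\<^sub>v v"] c v bndD[OF assms(1) v] bndD[OF assms(2) v]
    by (simp add: distrib_right)
qed

lemma smult_mat_mult_vec:
  "A \<in> carrier_mat n m \<Longrightarrow> v \<in> carrier_vec m \<Longrightarrow> (z \<cdot>\<^sub>m A) *\<^sub>v v = z \<cdot>\<^sub>v (A *\<^sub>v (v :: complex vec))"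
  by (intro eq_vecI) auto

lemma mult_mat_zero_vec: "A \<in> carrier_mat n m \<Longrightarrow> A *\<^sub>v 0\<^sub>v m = (0\<^sub>v n :: complex vec)"
  by (intro eq_vecI) auto

lemma bnd_smult:
  assumes "bnd m K A"
  shows "bnd m (cmod z * K) (z \<cdot>\<^sub>m A)"
proof (rule bndI)
  fix v :: "complex vec" assume v: "v \<in> carrier_vec m"
  have "cmod z * vec_l2 (A *\<^sub>v v) \<le> cmod z * (K * vec_l2 v)"
    using bndD[OF assms v] by (intro mult_left_mono) auto
  then show "vec_l2 ((z \<cdot>\<^sub>m A) *\<^sub>v v) \<le> cmod z * K * vec_l2 v"
    using bnd_carrier[OF assms] v by (simp add: smult_mat_mult_vec vec_l2_smult mult.assoc)
qed (use bnd_carrier[OF assms] bnd_nonneg[OF assms] in auto)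

lemma bnd_one: "bnd m 1 (1\<^sub>m m)"
  by (auto simp: bnd_def)

lemma mult_mat_unit_vec:
  "A \<in> carrier_mat n m \<Longrightarrow> j < m \<Longrightarrow> A *\<^sub>v unit_vec m j = col (A :: complex mat) j"
  by (intro eq_vecI) auto

lemma bnd_entry:
  assumes "bnd m K A" "i < m" "j < m"
  shows "cmod (A $$ (i, j)) \<le> K"
proof -
  note A = bnd_carrier[OF assms(1)]
  have "cmod (A $$ (i, j)) = cmod ((A *\<^sub>v unit_vec m j) $ i)"
    using A assms mult_mat_unit_vec[OF A assms(3)] by simp
  also have "\<dots> \<le> vec_l2 (A *\<^sub>v unit_vec m j)" using A assms by (intro entry_le_vec_l2) auto
  also have "\<dots> \<le> K" using bndD[OF assms(1), of "unit_vec m j"] assms by (simp add: vec_l2_unit_vec)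
  finally show ?thesis .
qed

text \<open>A real supremum carries information only over a bounded set; a crude bound by the sum of
  all entries is enough for that.\<close>

lemma op_norm_set_bdd:
  assumes A: "A \<in> carrier_mat m m"
  shows "bdd_above ((\<lambda>v. vec_l2 (A *\<^sub>v v)) ` {v \<in> carrier_vec (dim_col A). vec_l2 v \<le> 1})"
proof (intro bdd_aboveI2)
  fix v assume "v \<in> {v \<in> carrier_vec (dim_col A). vec_l2 v \<le> 1}"
  then have v: "v \<in> carrier_vec m" "vec_l2 v \<le> 1" using A by auto
  have "vec_l2 (A *\<^sub>v v) \<le> (\<Sum>i<m. cmod ((A *\<^sub>v v) $ i))"
    unfolding vec_l2_def using A by (intro order_trans[OF L2_set_le_sum_abs]) simp
  also have "\<dots> \<le> (\<Sum>i<m. \<Sum>j<m. cmod (A $$ (i, j)))"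
  proof (intro sum_mono)
    fix i assume i: "i \<in> {..<m}"
    have "cmod ((A *\<^sub>v v) $ i) \<le> (\<Sum>j<m. cmod (A $$ (i, j)) * cmod (v $ j))"
      using i A v by (simp add: index_mult_mat_vec_sum norm_sum flip: norm_mult del: index_mult_mat_vec)
    also have "\<dots> \<le> (\<Sum>j<m. cmod (A $$ (i, j)) * 1)"
      using v entry_le_vec_l2[of _ v] by (intro sum_mono mult_left_mono) force+
    finally show "cmod ((A *\<^sub>v v) $ i) \<le> (\<Sum>j<m. cmod (A $$ (i, j)))" by simp
  qed
  finally show "vec_l2 (A *\<^sub>v v) \<le> (\<Sum>i<m. \<Sum>j<m. cmod (A $$ (i, j)))" .
qed

text \<open>The bridge between the norm of the statement and \<open>bnd\<close>: vectors are scaled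
  to length 1, the zero vector being treated apart.\<close>

lemma op_norm_le_iff_bnd:
  assumes A: "A \<in> carrier_mat m m" and K: "0 \<le> K"
  shows "op_norm A \<le> K \<longleftrightarrow> bnd m K A"
proof
  assume le: "op_norm A \<le> K"
  show "bnd m K A"
  proof (rule bndI[OF A K])
    fix v :: "complex vec" assume v: "v \<in> carrier_vec m"
    show "vec_l2 (A *\<^sub>v v) \<le> K * vec_l2 v"
    proof (cases "vec_l2 v = 0")
      case True
      then have "v = 0\<^sub>v m" using v vec_l2_eq_0 by blast
      moreover have "A *\<^sub>v 0\<^sub>v m = 0\<^sub>v m" using A by (intro eq_vecI) auto
      ultimately show ?thesis by simp
    next
      case False
      then have pos: "vec_l2 v > 0" by (simp add: less_le)
      let ?w = "complex_of_real (1 / vec_l2 v) \<cdot>\<^sub>v v"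
      have "vec_l2 (A *\<^sub>v ?w) \<le> op_norm A"
        unfolding op_norm_def using pos A v
        by (intro cSUP_upper op_norm_set_bdd[OF A]) (auto simp: vec_l2_smult norm_divide)
      moreover have "vec_l2 (A *\<^sub>v ?w) = vec_l2 (A *\<^sub>v v) / vec_l2 v"
        using pos A v by (simp add: mult_mat_vec vec_l2_smult norm_divide)
      ultimately have "vec_l2 (A *\<^sub>v v) / vec_l2 v \<le> K" using le by linarith
      then show ?thesis using pos by (simp add: pos_divide_le_eq)
    qed
  qed
next
  assume b: "bnd m K A"
  show "op_norm A \<le> K"
    unfolding op_norm_def
  proof (rule cSUP_least)
    have "0\<^sub>v m \<in> {v \<in> carrier_vec (dim_col A). vec_l2 v \<le> 1}" using A by auto
    then show "{v \<in> carrier_vec (dim_col A). vec_l2 v \<le> 1} \<noteq> {}" by blast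
    fix v assume "v \<in> {v \<in> carrier_vec (dim_col A). vec_l2 v \<le> 1}"
    then have v: "v \<in> carrier_vec m" "vec_l2 v \<le> 1" using A by auto
    show "vec_l2 (A *\<^sub>v v) \<le> K"
      using bndD[OF b v(1)] mult_left_mono[OF v(2) K] by simp
  qed
qed

lemma op_norm_nonneg: 
  assumes A: "A \<in> carrier_mat m m"
  shows "0 \<le> op_norm A"
proof -
  have "vec_l2 (A *\<^sub>v 0\<^sub>v m) \<le> op_norm A"
    unfolding op_norm_def using A by (intro cSUP_upper op_norm_set_bdd[OF A]) auto
  then show ?thesis using vec_l2_nonneg order_trans by blast
qed

lemma bnd_op_norm: "A \<in> carrier_mat m m \<Longrightarrow> bnd m (op_norm A) A"
  using op_norm_le_iff_bnd op_norm_nonneg by blast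

text \<open>The algebra behind the Schwarz-Pick lemma: the cross terms of the two squares agree. It
  shows that Moebius transforms preserve contractions, and it also gives the bound for
  \<open>raise\<close>. Differences appear as sums with negated scalars because
  \<open>aff_mult_vec\<close> delivers them so.\<close>

lemma sq_l2_diff_identity:
  assumes "v \<in> carrier_vec m" "y \<in> carrier_vec m"
  shows "(vec_l2 (v + - z \<cdot>\<^sub>v y))\<^sup>2 - (vec_l2 (cnj z \<cdot>\<^sub>v v + - 1 \<cdot>\<^sub>v y))\<^sup>2 =
    (1 - (cmod z)\<^sup>2) * ((vec_l2 v)\<^sup>2 - (vec_l2 y)\<^sup>2)"
proof -
  have *: "(cmod (a - z * b))\<^sup>2 - (cmod (cnj z * a - b))\<^sup>2 = (1 - (cmod z)\<^sup>2) * ((cmod a)\<^sup>2 - (cmod b)\<^sup>2)" for a b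
    unfolding cmod_power2 by (simp add: algebra_simps power2_eq_square)
  show ?thesis using assms 
    by (simp add: vec_l2_sq * flip: sum_subtractf sum_distrib_left)
qed

section \<open>Affine functions of a matrix and the norm of a glued function\<close>

definition aff :: "complex \<Rightarrow> complex \<Rightarrow> complex mat \<Rightarrow> complex mat" where
  "aff z y A = z \<cdot>\<^sub>m 1\<^sub>m (dim_row A) + y \<cdot>\<^sub>m A"

lemma aff_carrier [simp]: "A \<in> carrier_mat m m \<Longrightarrow> aff z y A \<in> carrier_mat m m"
  by (simp add: aff_def)

lemma aff_mult_vec:
  "A \<in> carrier_mat m m \<Longrightarrow> v \<in> carrier_vec m \<Longrightarrow>
    aff z y A *\<^sub>v v = z \<cdot>\<^sub>v v + y \<cdot>\<^sub>v (A *\<^sub>v v)"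
  unfolding aff_def by (subst add_mult_distrib_mat_vec[of _ m m]) (auto simp: smult_mat_mult_vec)

lemma adjoint_aff:
  "A \<in> carrier_mat m m \<Longrightarrow> mat_adjoint (aff z y A) = aff (cnj z) (cnj y) (mat_adjoint A)"
  unfolding aff_def by (intro eq_matI) auto

lemma aff_one: "aff z y (x \<cdot>\<^sub>m 1\<^sub>m m) = (z + y * x) \<cdot>\<^sub>m 1\<^sub>m m"
  unfolding aff_def by (intro eq_matI) auto

text \<open>A lower bound for the lengths of the image vectors makes 1 - z A injective, hence
  invertible in finite dimension, and the same bound estimates the inverse. No Neumann series is
  summed.\<close>

lemma aff_invertible:
  assumes A: "bnd m r A" and r: "cmod z * r < 1"
  obtains B where "B \<in> carrier_mat m m" "B * aff 1 (- z) A = 1\<^sub>m m" "aff 1 (- z) A * B = 1\<^sub>m m"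
    "bnd m (1 / (1 - cmod z * r)) B"
proof -
  note Ac = bnd_carrier[OF A]
  let ?N = "aff 1 (- z) A"
  have N: "?N \<in> carrier_mat m m" using Ac by auto
  have low: "(1 - cmod z * r) * vec_l2 v \<le> vec_l2 (?N *\<^sub>v v)" if v: "v \<in> carrier_vec m" for v
  proof -
    have "v = ?N *\<^sub>v v + z \<cdot>\<^sub>v (A *\<^sub>v v)"
      unfolding aff_mult_vec[OF Ac v] using Ac v by (intro eq_vecI) auto
    then have "vec_l2 v \<le> vec_l2 (?N *\<^sub>v v) + cmod z * vec_l2 (A *\<^sub>v v)"
      using vec_l2_add[of "?N *\<^sub>v v" m "z \<cdot>\<^sub>v (A *\<^sub>v v)"] Ac N v by (simp add: vec_l2_smult)
    moreover have "cmod z * vec_l2 (A *\<^sub>v v) \<le> cmod z * (r * vec_l2 v)"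
      using bndD[OF A v] by (intro mult_left_mono) auto
    ultimately show ?thesis by (simp add: algebra_simps)
  qed
  have "det ?N \<noteq> 0"
  proof
    assume "det ?N = 0"
    then obtain v where v: "v \<in> carrier_vec m" "v \<noteq> 0\<^sub>v m" "?N *\<^sub>v v = 0\<^sub>v m"
      using det_0_iff_vec_prod_zero_field[OF N] by blast
    have "(1 - cmod z * r) * vec_l2 v \<le> 0" using low[OF v(1)] v(3) by simp
    then have "vec_l2 v = 0" using r vec_l2_nonneg[of v] by (simp add: mult_le_0_iff)
    then show False using v vec_l2_eq_0 by blast
  qed
  from det_non_zero_imp_unit[OF N this, of "()"] obtain B where
    B: "B \<in> carrier_mat m m" "B * ?N = 1\<^sub>m m" "?N * B = 1\<^sub>m m"
    unfolding Units_def by (auto simp: ring_mat_simps)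
  have "bnd m (1 / (1 - cmod z * r)) B"
  proof (rule bndI)
    fix v :: "complex vec" assume v: "v \<in> carrier_vec m"
    have "?N *\<^sub>v (B *\<^sub>v v) = v" using B N v by (simp flip: assoc_mult_mat_vec)
    then have "(1 - cmod z * r) * vec_l2 (B *\<^sub>v v) \<le> vec_l2 v" using low[of "B *\<^sub>v v"] B v by simp
    then show "vec_l2 (B *\<^sub>v v) \<le> 1 / (1 - cmod z * r) * vec_l2 v"
      using r by (simp add: field_simps)
  qed (use r B in auto)
  then show thesis using that B by blast
qed

lemma mult_sum_le_of_squares:
  fixes x y z w :: real
  assumes "x\<^sup>2 + z\<^sup>2 \<le> K * p\<^sup>2" "y\<^sup>2 + w\<^sup>2 \<le> K * q\<^sup>2" "0 \<le> K" "0 \<le> p" "0 \<le> q"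
  shows "x * y + z * w \<le> K * p * q"
proof (rule power2_le_imp_le)
  \<comment> \<open>Lagrange's identity, which is the Cauchy-Schwarz inequality in the
    plane.\<close>
  have "(x * y + z * w)\<^sup>2 + (x * w - z * y)\<^sup>2 = (x\<^sup>2 + z\<^sup>2) * (y\<^sup>2 + w\<^sup>2)"
    by (simp add: algebra_simps power2_eq_square)
  then have "(x * y + z * w)\<^sup>2 \<le> (x\<^sup>2 + z\<^sup>2) * (y\<^sup>2 + w\<^sup>2)"
    by (smt (verit) zero_le_power2)
  also have "\<dots> \<le> (K * p\<^sup>2) * (K * q\<^sup>2)"
    using assms by (intro mult_mono) auto
  finally show "(x * y + z * w)\<^sup>2 \<le> (K * p * q)\<^sup>2"
    by (simp add: power_mult_distrib power2_eq_square mult_ac)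
qed (use assms in auto)

text \<open>By the parallelogram law the column with entries (1 + E)/2 and (1 - E)/2 satisfies |a
  v|^2 + |c v|^2 = (|v|^2 + |E v|^2)/2. The row is handled by the same computation for the adjoint
  of E. Between them stands the block diagonal of F and H, of norm at most \<open>\<mu>\<close>. A
  contraction E would cost nothing; \<open>e\<close> slightly above 1 costs little.\<close>

lemma bnd_glue:
  assumes E: "bnd m e E" and F: "bnd m \<mu> F" and H: "bnd m \<mu> H"
  shows "bnd m (\<mu> * ((1 + e\<^sup>2) / 2))
    (aff (1/2) (1/2) E * F * aff (1/2) (1/2) E + aff (1/2) (-1/2) E * H * aff (1/2) (-1/2) E)"
proof (rule bnd_ipI)
  let ?a = "aff (1/2) (1/2) E" and ?c = "aff (1/2) (-1/2) E"
  let ?a' = "aff (1/2) (1/2) (mat_adjoint E)" and ?c' = "aff (1/2) (-1/2) (mat_adjoint E)"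
  note c = bnd_carrier[OF E] bnd_carrier[OF F] bnd_carrier[OF H]
  have ac: "?a \<in> carrier_mat m m" "?c \<in> carrier_mat m m" using c by auto
  have ac2: "?a * F * ?a \<in> carrier_mat m m" "?c * H * ?c \<in> carrier_mat m m"
    using ac c by (blast intro: mult_carrier_mat)+
  then show "?a * F * ?a + ?c * H * ?c \<in> carrier_mat m m" by simp
  show "0 \<le> \<mu> * ((1 + e\<^sup>2) / 2)" using bnd_nonneg[OF F] by auto
  have sq: "(vec_l2 (aff (1/2) (1/2) D *\<^sub>v v))\<^sup>2 + (vec_l2 (aff (1/2) (-1/2) D *\<^sub>v v))\<^sup>2
      \<le> (1 + e\<^sup>2) / 2 * (vec_l2 v)\<^sup>2" if D: "bnd m e D" and v: "v \<in> carrier_vec m" for D v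
  proof -
    note Dc = bnd_carrier[OF D]
    have *: "(cmod (a / 2 + b / 2))\<^sup>2 + (cmod (a / 2 - b / 2))\<^sup>2 = ((cmod a)\<^sup>2 + (cmod b)\<^sup>2) / 2" for a b
      unfolding cmod_power2 by (simp add: algebra_simps power2_eq_square)
    have "(vec_l2 (aff (1/2) (1/2) D *\<^sub>v v))\<^sup>2 + (vec_l2 (aff (1/2) (-1/2) D *\<^sub>v v))\<^sup>2
      = ((vec_l2 v)\<^sup>2 + (vec_l2 (D *\<^sub>v v))\<^sup>2) / 2"
    proof -
      define w where "w = D *\<^sub>v v"
      have w: "w \<in> carrier_vec m" using Dc v by (simp add: w_def)
      have "(vec_l2 ((1/2) \<cdot>\<^sub>v v + (1/2) \<cdot>\<^sub>v w))\<^sup>2 + (vec_l2 ((1/2) \<cdot>\<^sub>v v + (-1/2) \<cdot>\<^sub>v w))\<^sup>2 =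
          (\<Sum>i<m. (cmod (v $ i / 2 + w $ i / 2))\<^sup>2) + (\<Sum>i<m. (cmod (v $ i / 2 - w $ i / 2))\<^sup>2)"
        using v w by (simp add: vec_l2_sq)
      also have "\<dots> = ((vec_l2 v)\<^sup>2 + (vec_l2 w)\<^sup>2) / 2"
        using v w by (simp only: vec_l2_sq carrier_vecD * sum_divide_distrib flip: sum.distrib)
      finally show ?thesis unfolding aff_mult_vec[OF Dc v] w_def .
    qed
    moreover have "(vec_l2 (D *\<^sub>v v))\<^sup>2 \<le> (e * vec_l2 v)\<^sup>2"
      by (intro power_mono bndD[OF D v]) auto
    ultimately show ?thesis by (simp add: power_mult_distrib algebra_simps)
  qed
  fix u v :: "complex vec" assume u: "u \<in> carrier_vec m" and v: "v \<in> carrier_vec m"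
  have one: "cmod (ip (P * G * P *\<^sub>v v) u) \<le> \<mu> * (vec_l2 (P *\<^sub>v v) * vec_l2 (mat_adjoint P *\<^sub>v u))"
    if P: "P \<in> carrier_mat m m" and G: "bnd m \<mu> G" for P G
  proof -
    note Gc = bnd_carrier[OF G]
    have "ip (P * G * P *\<^sub>v v) u = ip (G *\<^sub>v (P *\<^sub>v v)) (mat_adjoint P *\<^sub>v u)"
      using P Gc u v by (simp add: assoc_mult_mat_vec[of _ m m _ m] ip_adjoint[of _ m m])
    then have "cmod (ip (P * G * P *\<^sub>v v) u) \<le> vec_l2 (G *\<^sub>v (P *\<^sub>v v)) * vec_l2 (mat_adjoint P *\<^sub>v u)"
      using ip_cauchy_schwarz[of "G *\<^sub>v (P *\<^sub>v v)" m "mat_adjoint P *\<^sub>v u"] P Gc u v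
      by (simp add: mult_mat_vec_carrier[OF adjoint_carrier])
    also have "\<dots> \<le> \<mu> * vec_l2 (P *\<^sub>v v) * vec_l2 (mat_adjoint P *\<^sub>v u)"
      using bndD[OF G, of "P *\<^sub>v v"] P v by (intro mult_right_mono) auto
    finally show ?thesis by (simp add: mult.assoc)
  qed
  have "ip ((?a * F * ?a + ?c * H * ?c) *\<^sub>v v) u = ip (?a * F * ?a *\<^sub>v v) u + ip (?c * H * ?c *\<^sub>v v) u"
    using mult_mat_vec_carrier[OF ac2(1) v] mult_mat_vec_carrier[OF ac2(2) v]
    unfolding add_mult_distrib_mat_vec[OF ac2 v] by (rule ip_add_left)
  then have "cmod (ip ((?a * F * ?a + ?c * H * ?c) *\<^sub>v v) u) \<le>
      \<mu> * (vec_l2 (?a *\<^sub>v v) * vec_l2 (?a' *\<^sub>v u)) + \<mu> * (vec_l2 (?c *\<^sub>v v) * vec_l2 (?c' *\<^sub>v u))"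
    using one[OF ac(1) F] one[OF ac(2) H] c(1)
    by (simp add: adjoint_aff[of E m]) (meson add_mono norm_triangle_ineq order_trans)
  also have "\<dots> = \<mu> * (vec_l2 (?a *\<^sub>v v) * vec_l2 (?a' *\<^sub>v u) + vec_l2 (?c *\<^sub>v v) * vec_l2 (?c' *\<^sub>v u))"
    by (simp add: distrib_left)
  also have "\<dots> \<le> \<mu> * ((1 + e\<^sup>2) / 2 * vec_l2 v * vec_l2 u)"
    using sq[OF E v] sq[OF bnd_adjoint[OF E] u] bnd_nonneg[OF F]
    by (intro mult_left_mono mult_sum_le_of_squares) auto
  finally show "cmod (ip ((?a * F * ?a + ?c * H * ?c) *\<^sub>v v) u) \<le> \<mu> * ((1 + e\<^sup>2) / 2) * vec_l2 v * vec_l2 u"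
    by (simp add: mult.assoc)
qed

text \<open>A junk value unless the argument is an invertible square matrix.\<close>

definition minv :: "complex mat \<Rightarrow> complex mat" where
  "minv A = (SOME B. B \<in> carrier_mat (dim_row A) (dim_row A) \<and> A * B = 1\<^sub>m (dim_row A))"

lemma minv_eqI:
  assumes A: "A \<in> carrier_mat m m" and B: "B \<in> carrier_mat m m" and AB: "A * B = 1\<^sub>m m"
  shows "minv A = B"
proof -
  have "minv A \<in> carrier_mat m m \<and> A * minv A = 1\<^sub>m m"
    unfolding minv_def using assms by (rule_tac someI2[of _ B]) auto
  moreover have "B * A = 1\<^sub>m m" using mat_mult_left_right_inverse assms by blast
  ultimately have "minv A = (B * A) * minv A" "(B * A) * minv A = B * (A * minv A)" "B * (A * minv A) = B"
    using A B assoc_mult_mat[of B m m A m "minv A" m] by auto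
  then show ?thesis by simp
qed

section \<open>Moebius transforms of contractions\<close>

definition mob :: "real \<Rightarrow> complex mat \<Rightarrow> complex mat" where
  "mob \<alpha> A = aff (of_real \<alpha>) (- 1) A * minv (aff 1 (- of_real \<alpha>) A)"

text \<open>Writing v = (1 - \<alpha> A) w removes the inverse: v and its image both become
  combinations of w and A w, and norm comparisons turn into algebra.\<close>

lemma mob_factor:
  assumes A: "bnd m r A" and a: "0 \<le> \<alpha>" "\<alpha> * r < 1" and v: "v \<in> carrier_vec m"
  obtains w where "w \<in> carrier_vec m" "v = w + - of_real \<alpha> \<cdot>\<^sub>v (A *\<^sub>v w)"
    "mob \<alpha> A *\<^sub>v v = of_real \<alpha> \<cdot>\<^sub>v w + - 1 \<cdot>\<^sub>v (A *\<^sub>v w)"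
    "vec_l2 w \<le> vec_l2 v / (1 - \<alpha> * r)"
proof -
  note Ac = bnd_carrier[OF A]
  obtain B where B: "B \<in> carrier_mat m m" "aff 1 (- of_real \<alpha>) A * B = 1\<^sub>m m"
    and bB: "bnd m (1 / (1 - \<alpha> * r)) B"
    by (rule aff_invertible[OF A, of "of_real \<alpha>"]) (use a in auto)
  then have inv: "minv (aff 1 (- of_real \<alpha>) A) = B" using Ac by (intro minv_eqI[of _ m]) auto
  have "aff 1 (- of_real \<alpha>) A *\<^sub>v (B *\<^sub>v v) = v"
    using B Ac v by (simp flip: assoc_mult_mat_vec[of _ m m _ m])
  then show thesis
    using that[of "B *\<^sub>v v"] Ac B v bndD[OF bB v] unfolding mob_def inv
    by (simp add: aff_mult_vec[of _ m] assoc_mult_mat_vec[of _ m m _ m])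
qed

lemma mob_carrier:
  assumes A: "bnd m r A" and a: "0 \<le> \<alpha>" "\<alpha> * r < 1"
  shows "mob \<alpha> A \<in> carrier_mat m m"
proof -
  note Ac = bnd_carrier[OF A]
  obtain B where B: "B \<in> carrier_mat m m" "aff 1 (- of_real \<alpha>) A * B = 1\<^sub>m m"
    by (rule aff_invertible[OF A, of "of_real \<alpha>"]) (use a in auto)
  then have "minv (aff 1 (- of_real \<alpha>) A) = B" using Ac by (intro minv_eqI[of _ m]) auto
  then show ?thesis using Ac B by (simp add: mob_def mult_carrier_mat[of _ m m])
qed

lemma bnd_mob:
  assumes A: "bnd m 1 A" and a: "0 \<le> \<alpha>" "\<alpha> < 1"
  shows "bnd m 1 (mob \<alpha> A)"
proof (rule bndI)
  note Ac = bnd_carrier[OF A]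
  have a1: "0 \<le> \<alpha>" and a2: "\<alpha> * 1 < 1" using a by auto
  show "mob \<alpha> A \<in> carrier_mat m m" using mob_carrier[OF A] a by simp
  fix v :: "complex vec" assume v: "v \<in> carrier_vec m"
  obtain w where w: "w \<in> carrier_vec m" "v = w + - of_real \<alpha> \<cdot>\<^sub>v (A *\<^sub>v w)"
    "mob \<alpha> A *\<^sub>v v = of_real \<alpha> \<cdot>\<^sub>v w + - 1 \<cdot>\<^sub>v (A *\<^sub>v w)"
    "vec_l2 w \<le> vec_l2 v / (1 - \<alpha> * 1)"
    by (rule mob_factor[OF A a1 a2 v])
  have "(vec_l2 v)\<^sup>2 - (vec_l2 (mob \<alpha> A *\<^sub>v v))\<^sup>2 =
      (1 - \<alpha>\<^sup>2) * ((vec_l2 w)\<^sup>2 - (vec_l2 (A *\<^sub>v w))\<^sup>2)"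
    using sq_l2_diff_identity[of w m "A *\<^sub>v w" "of_real \<alpha>"] w Ac by simp
  also have "\<dots> \<ge> 0"
    using a bndD[OF A w(1)] by (intro mult_nonneg_nonneg) (auto simp: power_le_one)
  finally have "(vec_l2 (mob \<alpha> A *\<^sub>v v))\<^sup>2 \<le> (vec_l2 v)\<^sup>2" by simp
  then show "vec_l2 (mob \<alpha> A *\<^sub>v v) \<le> 1 * vec_l2 v"
    using power2_le_imp_le[OF _ vec_l2_nonneg] by simp
qed simp

lemma scalar_mat_mult: "B \<in> carrier_mat m m \<Longrightarrow> (z \<cdot>\<^sub>m 1\<^sub>m m) * B = z \<cdot>\<^sub>m (B :: complex mat)"
  by (simp add: mult_smult_assoc_mat[of _ m m _ m])

lemma mob_scalar:
  assumes "cmod z \<le> 1" "0 \<le> \<alpha>" "\<alpha> < 1"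
  shows "mob \<alpha> (z \<cdot>\<^sub>m 1\<^sub>m m) = ((of_real \<alpha> - z) / (1 - of_real \<alpha> * z)) \<cdot>\<^sub>m 1\<^sub>m m"
proof -
  have "cmod (of_real \<alpha> * z) < 1"
    using assms mult_left_mono[of "cmod z" 1 \<alpha>] by (simp add: norm_mult)
  then have ne: "1 - of_real \<alpha> * z \<noteq> 0" by auto
  have "minv (aff 1 (- of_real \<alpha>) (z \<cdot>\<^sub>m 1\<^sub>m m)) = (1 / (1 - of_real \<alpha> * z)) \<cdot>\<^sub>m 1\<^sub>m m"
    using ne by (intro minv_eqI[of _ m]) (auto simp: aff_one scalar_mat_mult intro!: eq_matI)
  then show ?thesis
    by (auto simp: mob_def aff_one scalar_mat_mult intro!: eq_matI)
qed

text \<open>The constant terms cancel: for v = (1 - \<alpha> A) w the peak sends v to (1/\<alpha> -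
  \<alpha>)/2 times A w. So the peak is small where A is small, and the bound is uniform over
  \<open>\<alpha>\<close> in [1/2, 1), as is needed when \<open>\<alpha>\<close> changes from step
  to step.\<close>

lemma bnd_peak:
  assumes A: "bnd m s A" and s: "s < 1" and a: "1 / 2 \<le> \<alpha>" "\<alpha> < 1"
  shows "bnd m (s / (1 - s)) (aff (1/2) (- 1 / (2 * of_real \<alpha>)) (mob \<alpha> A))"
proof (rule bndI)
  note Ac = bnd_carrier[OF A]
  let ?c = "aff (1/2) (- 1 / (2 * of_real \<alpha>)) (mob \<alpha> A)"
  have s0: "0 \<le> s" using bnd_nonneg[OF A] .
  have as: "\<alpha> * s \<le> s" using a s0 by (simp add: mult_left_le_one_le)
  have a1: "0 \<le> \<alpha>" and a2: "\<alpha> * s < 1" using a as s by auto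
  have M: "mob \<alpha> A \<in> carrier_mat m m" using mob_carrier[OF A a1 a2] .
  then show "?c \<in> carrier_mat m m" by simp
  show "0 \<le> s / (1 - s)" using s0 s by simp
  fix v :: "complex vec" assume v: "v \<in> carrier_vec m"
  obtain w where w: "w \<in> carrier_vec m" "v = w + - of_real \<alpha> \<cdot>\<^sub>v (A *\<^sub>v w)"
    "mob \<alpha> A *\<^sub>v v = of_real \<alpha> \<cdot>\<^sub>v w + - 1 \<cdot>\<^sub>v (A *\<^sub>v w)" "vec_l2 w \<le> vec_l2 v / (1 - \<alpha> * s)"
    by (rule mob_factor[OF A a1 a2 v])
  have "?c *\<^sub>v v = of_real ((1 / \<alpha> - \<alpha>) / 2) \<cdot>\<^sub>v (A *\<^sub>v w)"
    unfolding aff_mult_vec[OF M v] w(3) using a w(1) Ac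
    by (subst (1) w(2)) (auto simp: field_simps intro!: eq_vecI)
  then have "vec_l2 (?c *\<^sub>v v) = \<bar>(1 / \<alpha> - \<alpha>) / 2\<bar> * vec_l2 (A *\<^sub>v w)"
    by (simp only: vec_l2_smult norm_of_real)
  also have "\<dots> \<le> 1 * (s * (vec_l2 v / (1 - s)))"
  proof (intro mult_mono)
    have "1 / \<alpha> \<le> 2" "\<alpha> \<le> 1 / \<alpha>" using a by (auto simp: field_simps intro: mult_le_one order_trans[OF mult_left_le])
    then show "\<bar>(1 / \<alpha> - \<alpha>) / 2\<bar> \<le> 1" using a by simp
    have "vec_l2 (A *\<^sub>v w) \<le> s * vec_l2 w" using bndD[OF A w(1)] .
    also have "vec_l2 v / (1 - \<alpha> * s) \<le> vec_l2 v / (1 - s)"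
      using as s by (intro divide_left_mono) (auto intro!: mult_pos_pos)
    with w(4) have "s * vec_l2 w \<le> s * (vec_l2 v / (1 - s))"
      using s0 by (intro mult_left_mono) auto
    finally show "vec_l2 (A *\<^sub>v w) \<le> s * (vec_l2 v / (1 - s))" .
  qed auto
  finally show "vec_l2 (?c *\<^sub>v v) \<le> s / (1 - s) * vec_l2 v" by simp
qed

subsection \<open>The row ball and nc functions\<close>

lemma row_square_Nil [simp]: "row_square m [] = 0\<^sub>m m m"
  by (simp add: row_square_def)

lemma row_square_Cons [simp]: "row_square m (A # X) = A * mat_adjoint A + row_square m X"
  by (simp add: row_square_def)

lemma row_square_carrier: "set X \<subseteq> carrier_mat m m \<Longrightarrow> row_square m X \<in> carrier_mat m m"
  by (induction X) auto

lemma ip_row_square: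
  assumes "set X \<subseteq> carrier_mat m m" "v \<in> carrier_vec m"
  shows "ip (row_square m X *\<^sub>v v) v = of_real (\<Sum>A\<leftarrow>X. (vec_l2 (mat_adjoint A *\<^sub>v v))\<^sup>2)"
  using assms
proof (induction X)
  case Nil
  then show ?case by (auto simp: ip_def)
next
  case (Cons A X)
  then have c: "A \<in> carrier_mat m m" "row_square m X \<in> carrier_mat m m" "v \<in> carrier_vec m"
    by (auto simp: row_square_carrier)
  then have w: "mat_adjoint A *\<^sub>v v \<in> carrier_vec m"
    by (simp add: mult_mat_vec_carrier[OF adjoint_carrier])
  have "ip (row_square m (A # X) *\<^sub>v v) v = ip (A *\<^sub>v (mat_adjoint A *\<^sub>v v)) v + ip (row_square m X *\<^sub>v v) v"
    using c w by (simp add: add_mult_distrib_mat_vec[of _ m m] assoc_mult_mat_vec[of _ m m _ m]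
        mult_carrier_mat[of _ m m] ip_add_left[of _ m])
  also have "ip (A *\<^sub>v (mat_adjoint A *\<^sub>v v)) v = of_real ((vec_l2 (mat_adjoint A *\<^sub>v v))\<^sup>2)"
    using c w by (simp only: ip_adjoint[of A m m] ip_self)
  finally show ?case using Cons by simp
qed

text \<open>The row condition concerns A times its adjoint, so it controls the adjoints of the
  coordinates. Estimates in the row ball are therefore made for adjoints and carried over by
  \<open>bnd_adjoint\<close>.\<close>

lemma row_ball_level_sum:
  assumes "X \<in> row_ball_level d m"
  obtains r where "0 \<le> r" "r < 1" "\<And>v. v \<in> carrier_vec m \<Longrightarrow>
    (\<Sum>A\<leftarrow>X. (vec_l2 (mat_adjoint A *\<^sub>v v))\<^sup>2) \<le> r * (vec_l2 v)\<^sup>2"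
proof (rule that[of "op_norm (row_square m X)"])
  have X: "set X \<subseteq> carrier_mat m m" and lt: "op_norm (row_square m X) < 1"
    using assms by (auto simp: row_ball_level_def)
  note R = row_square_carrier[OF X]
  show "0 \<le> op_norm (row_square m X)" "op_norm (row_square m X) < 1" 
    using op_norm_nonneg[OF R] lt by auto
  fix v :: "complex vec" assume v: "v \<in> carrier_vec m"
  have "(\<Sum>A\<leftarrow>X. (vec_l2 (mat_adjoint A *\<^sub>v v))\<^sup>2) \<le> cmod (ip (row_square m X *\<^sub>v v) v)"
    unfolding ip_row_square[OF X v] by simp
  also have "\<dots> \<le> vec_l2 (row_square m X *\<^sub>v v) * vec_l2 v"
    using R v by (intro ip_cauchy_schwarz[of _ m]) auto
  also have "\<dots> \<le> op_norm (row_square m X) * vec_l2 v * vec_l2 v"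
    using bndD[OF bnd_op_norm[OF R] v] by (intro mult_right_mono) auto
  finally show "(\<Sum>A\<leftarrow>X. (vec_l2 (mat_adjoint A *\<^sub>v v))\<^sup>2) \<le> op_norm (row_square m X) * (vec_l2 v)\<^sup>2"
    by (simp add: power2_eq_square mult.assoc)
qed

lemma row_ball_level_nth: "X \<in> row_ball_level d m \<Longrightarrow> i < d \<Longrightarrow> X ! i \<in> carrier_mat m m"
  by (auto simp: row_ball_level_def)

text \<open>The radius is strictly below 1, but it depends on the point. This strictness later
  yields geometric decay of the increments at each single point.\<close>

lemma row_ball_level_first:
  assumes X: "X \<in> row_ball_level d m" and d: "1 \<le> d"
  obtains r where "r < 1" "bnd m r (X ! 0)"
proof -
  obtain r where r: "0 \<le> r" "r < 1" "\<And>v. v \<in> carrier_vec m \<Longrightarrow>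
    (\<Sum>A\<leftarrow>X. (vec_l2 (mat_adjoint A *\<^sub>v v))\<^sup>2) \<le> r * (vec_l2 v)\<^sup>2"
    using row_ball_level_sum[OF X] by metis
  have c: "X ! 0 \<in> carrier_mat m m" using X d by (simp add: row_ball_level_nth)
  obtain A X' where XA: "X = A # X'" using X d by (cases X) (auto simp: row_ball_level_def)
  have "bnd m (sqrt r) (mat_adjoint (X ! 0))"
  proof (rule bndI)
    fix v :: "complex vec" assume v: "v \<in> carrier_vec m"
    have "0 \<le> (\<Sum>A\<leftarrow>X'. (vec_l2 (mat_adjoint A *\<^sub>v v))\<^sup>2)"
      by (rule sum_list_nonneg) auto
    then have "(vec_l2 (mat_adjoint A *\<^sub>v v))\<^sup>2 \<le> r * (vec_l2 v)\<^sup>2"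
      using r(3)[OF v] by (simp add: XA)
    also have "\<dots> = (sqrt r * vec_l2 v)\<^sup>2" using r by (simp add: power_mult_distrib)
    finally show "vec_l2 (mat_adjoint (X ! 0) *\<^sub>v v) \<le> sqrt r * vec_l2 v"
      using r by (auto simp: XA intro: power2_le_imp_le)
  qed (use r c in auto)
  then have "bnd m (sqrt r) (X ! 0)" using bnd_adjoint by fastforce
  then show thesis using that[of "sqrt r"] r by auto
qed

lemma row_ball_level_first_two:
  assumes X: "X \<in> row_ball_level d m" and d: "2 \<le> d" and v: "v \<in> carrier_vec m"
  shows "(vec_l2 (mat_adjoint (X ! 0) *\<^sub>v v))\<^sup>2 + (vec_l2 (mat_adjoint (X ! 1) *\<^sub>v v))\<^sup>2 \<le> (vec_l2 v)\<^sup>2"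
proof -
  obtain r where r: "0 \<le> r" "r < 1" "\<And>v. v \<in> carrier_vec m \<Longrightarrow>
    (\<Sum>A\<leftarrow>X. (vec_l2 (mat_adjoint A *\<^sub>v v))\<^sup>2) \<le> r * (vec_l2 v)\<^sup>2"
    using row_ball_level_sum[OF X] by metis
  obtain A B X' where XA: "X = A # B # X'"
    using X d by (cases X; cases "tl X") (auto simp: row_ball_level_def)
  have "0 \<le> (\<Sum>A\<leftarrow>X'. (vec_l2 (mat_adjoint A *\<^sub>v v))\<^sup>2)"
    by (rule sum_list_nonneg) auto
  moreover have "r * (vec_l2 v)\<^sup>2 \<le> (vec_l2 v)\<^sup>2" using r by (simp add: mult_left_le_one_le)
  ultimately show ?thesis using r(3)[OF v] by (simp add: XA)
qed

section \<open>Direct sums of matrices\<close>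

lemma mat_dsum_carrier:
  "A \<in> carrier_mat m m \<Longrightarrow> B \<in> carrier_mat n n \<Longrightarrow> mat_dsum A B \<in> carrier_mat (m + n) (m + n)"
  by (simp add: mat_dsum_def)

lemma mat_dsum_add:
  "A \<in> carrier_mat m m \<Longrightarrow> A' \<in> carrier_mat m m \<Longrightarrow> B \<in> carrier_mat n n \<Longrightarrow> B' \<in> carrier_mat n n \<Longrightarrow>
    mat_dsum A B + mat_dsum A' B' = mat_dsum (A + A') (B + B')"
  unfolding mat_dsum_def by (subst add_four_block_mat) auto

lemma mat_dsum_mult:
  "A \<in> carrier_mat m m \<Longrightarrow> A' \<in> carrier_mat m m \<Longrightarrow> B \<in> carrier_mat n n \<Longrightarrow> B' \<in> carrier_mat n n \<Longrightarrow>
    mat_dsum A B * mat_dsum A' B' = mat_dsum (A * A') (B * B')"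
  unfolding mat_dsum_def by (subst mult_four_block_mat) auto

lemma mat_dsum_one: "mat_dsum (1\<^sub>m m) (1\<^sub>m n) = 1\<^sub>m (m + n)"
  by (simp add: mat_dsum_def)

lemma mat_dsum_aff:
  "A \<in> carrier_mat m m \<Longrightarrow> B \<in> carrier_mat n n \<Longrightarrow>
    aff z y (mat_dsum A B) = mat_dsum (aff z y A) (aff z y B)"
  unfolding mat_dsum_def aff_def by (rule eq_matI) auto

lemma mat_dsum_minv:
  assumes "A \<in> carrier_mat m m" "A' \<in> carrier_mat m m" "A * A' = 1\<^sub>m m"
    and "B \<in> carrier_mat n n" "B' \<in> carrier_mat n n" "B * B' = 1\<^sub>m n"
  shows "minv (mat_dsum A B) = mat_dsum (minv A) (minv B)"
proof -
  have "minv A = A'" "minv B = B'" using assms minv_eqI by blast+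
  moreover have "minv (mat_dsum A B) = mat_dsum A' B'"
    using assms by (intro minv_eqI[of _ "m + n"]) (auto simp: mat_dsum_carrier mat_dsum_mult mat_dsum_one)
  ultimately show ?thesis by simp
qed

section \<open>Closure properties of nc functions\<close>

lemma nc_functionI:
  assumes "\<And>m X. 1 \<le> m \<Longrightarrow> X \<in> row_ball_level d m \<Longrightarrow> f X \<in> carrier_mat m m"
    and "\<And>m n X Y. 1 \<le> m \<Longrightarrow> 1 \<le> n \<Longrightarrow> X \<in> row_ball_level d m \<Longrightarrow> Y \<in> row_ball_level d n \<Longrightarrow>
      f (tuple_dsum X Y) = mat_dsum (f X) (f Y)"
    and "\<And>m X S T. 1 \<le> m \<Longrightarrow> X \<in> row_ball_level d m \<Longrightarrow> S \<in> carrier_mat m m \<Longrightarrow> T \<in> carrier_mat m m \<Longrightarrow>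
      S * T = 1\<^sub>m m \<Longrightarrow> T * S = 1\<^sub>m m \<Longrightarrow> map (\<lambda>A. T * A * S) X \<in> row_ball_level d m \<Longrightarrow>
      f (map (\<lambda>A. T * A * S) X) = T * f X * S"
  shows "nc_function d f"
  using assms unfolding nc_function_def row_ball_def inverts_mat_def by fastforce

lemma nc_function_carrier:
  "nc_function d f \<Longrightarrow> 1 \<le> m \<Longrightarrow> X \<in> row_ball_level d m \<Longrightarrow> f X \<in> carrier_mat m m"
  by (simp add: nc_function_def)

lemma nc_function_dsum:
  "nc_function d f \<Longrightarrow> 1 \<le> m \<Longrightarrow> 1 \<le> n \<Longrightarrow> X \<in> row_ball_level d m \<Longrightarrow> Y \<in> row_ball_level d n \<Longrightarrow>
    f (tuple_dsum X Y) = mat_dsum (f X) (f Y)"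
  unfolding nc_function_def row_ball_def by auto

lemma nc_function_similar:
  assumes "nc_function d f" "1 \<le> m" "X \<in> row_ball_level d m" "S \<in> carrier_mat m m" "T \<in> carrier_mat m m"
    "S * T = 1\<^sub>m m" "T * S = 1\<^sub>m m" "map (\<lambda>A. T * A * S) X \<in> row_ball_level d m"
  shows "f (map (\<lambda>A. T * A * S) X) = T * f X * S"
  using assms unfolding nc_function_def inverts_mat_def by auto

lemma nc_function_coordinate:
  assumes "i < d"
  shows "nc_function d (\<lambda>X. X ! i)"
  using assms by (intro nc_functionI) (auto simp: row_ball_level_def tuple_dsum_def)

lemma nc_function_aff:
  assumes f: "nc_function d f"
  shows "nc_function d (\<lambda>X. aff z y (f X))"
proof (rule nc_functionI)
  fix m X S T assume *: "1 \<le> m" "X \<in> row_ball_level d m" "S \<in> carrier_mat m m" "T \<in> carrier_mat m m"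
      "S * T = 1\<^sub>m m" "T * S = 1\<^sub>m m" "map (\<lambda>A. T * A * S) X \<in> row_ball_level d m"
  have c: "f X \<in> carrier_mat m m" using nc_function_carrier[OF f] * by auto
  have "T * aff z y (f X) * S = z \<cdot>\<^sub>m (T * S) + y \<cdot>\<^sub>m (T * f X * S)"
    using * c unfolding aff_def
    by (simp add: mult_add_distrib_mat[of _ m m _ m] add_mult_distrib_mat[of _ m m _ _ m]
        mult_smult_distrib[of _ m m _ m] mult_smult_assoc_mat[of _ m m _ m] mult_carrier_mat[of _ m m])
  then show "aff z y (f (map (\<lambda>A. T * A * S) X)) = T * aff z y (f X) * S"
    using * nc_function_similar[OF f *] by (simp add: aff_def)
next
  fix m n X Y assume *: "1 \<le> m" "1 \<le> n" "X \<in> row_ball_level d m" "Y \<in> row_ball_level d n"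
  then show "aff z y (f (tuple_dsum X Y)) = mat_dsum (aff z y (f X)) (aff z y (f Y))"
    by (simp add: nc_function_dsum[OF f *] mat_dsum_aff[of _ m _ n] nc_function_carrier[OF f])
qed (auto simp: nc_function_carrier[OF f])

lemma nc_function_smult:
  assumes f: "nc_function d f"
  shows "nc_function d (\<lambda>X. z \<cdot>\<^sub>m f X)"
proof (rule nc_functionI)
  fix m X S T assume *: "1 \<le> m" "X \<in> row_ball_level d m" "S \<in> carrier_mat m m" "T \<in> carrier_mat m m"
      "S * T = 1\<^sub>m m" "T * S = 1\<^sub>m m" "map (\<lambda>A. T * A * S) X \<in> row_ball_level d m"
  have c: "f X \<in> carrier_mat m m" using nc_function_carrier[OF f] * by auto
  show "z \<cdot>\<^sub>m f (map (\<lambda>A. T * A * S) X) = T * (z \<cdot>\<^sub>m f X) * S"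
    unfolding nc_function_similar[OF f *] mult_smult_distrib[OF *(4) c]
      mult_smult_assoc_mat[OF mult_carrier_mat[OF *(4) c] *(3)] ..
next
  fix m n X Y assume *: "1 \<le> m" "1 \<le> n" "X \<in> row_ball_level d m" "Y \<in> row_ball_level d n"
  have "f X \<in> carrier_mat m m" "f Y \<in> carrier_mat n n"
    using * by (auto intro: nc_function_carrier[OF f])
  then show "z \<cdot>\<^sub>m f (tuple_dsum X Y) = mat_dsum (z \<cdot>\<^sub>m f X) (z \<cdot>\<^sub>m f Y)"
    unfolding nc_function_dsum[OF f *] mat_dsum_def by (subst smult_four_block_mat) auto
qed (use nc_function_carrier[OF f] in auto)

lemma nc_function_add:
  assumes f: "nc_function d f" and g: "nc_function d g"
  shows "nc_function d (\<lambda>X. f X + g X)"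
proof (rule nc_functionI)
  fix m X S T assume *: "1 \<le> m" "X \<in> row_ball_level d m" "S \<in> carrier_mat m m" "T \<in> carrier_mat m m"
      "S * T = 1\<^sub>m m" "T * S = 1\<^sub>m m" "map (\<lambda>A. T * A * S) X \<in> row_ball_level d m"
  have c: "f X \<in> carrier_mat m m" "g X \<in> carrier_mat m m" 
    using nc_function_carrier[OF f] nc_function_carrier[OF g] * by auto
  then show "f (map (\<lambda>A. T * A * S) X) + g (map (\<lambda>A. T * A * S) X) = T * (f X + g X) * S"
    using * nc_function_similar[OF f *] nc_function_similar[OF g *]
    by (simp add: mult_add_distrib_mat[of _ m m _ m] add_mult_distrib_mat[of _ m m _ _ m] mult_carrier_mat[of _ m m])
next
  fix m n X Y assume *: "1 \<le> m" "1 \<le> n" "X \<in> row_ball_level d m" "Y \<in> row_ball_level d n"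
  show "f (tuple_dsum X Y) + g (tuple_dsum X Y) = mat_dsum (f X + g X) (f Y + g Y)"
    using * by (simp add: nc_function_dsum[OF f *] nc_function_dsum[OF g *] 
      mat_dsum_add[of _ m _ _ n] nc_function_carrier[OF f] nc_function_carrier[OF g])
qed (auto simp: nc_function_carrier[OF f] nc_function_carrier[OF g])

lemma conj_mult:
  fixes A B S T :: "complex mat"
  assumes c: "A \<in> carrier_mat m m" "B \<in> carrier_mat m m" "S \<in> carrier_mat m m" "T \<in> carrier_mat m m"
    and ST: "S * T = 1\<^sub>m m"
  shows "(T * A * S) * (T * B * S) = T * (A * B) * S"
proof -
  have "S * (T * (B * S)) = (S * T) * (B * S)"
    using c by (intro assoc_mult_mat[symmetric]) (auto intro: mult_carrier_mat)
  also have "\<dots> = B * S" using c ST by (simp add: mult_carrier_mat[of _ m m])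
  finally have "S * (T * (B * S)) = B * S" .
  then show ?thesis
    using c by (simp add: assoc_mult_mat[of _ m m _ m _ m] mult_carrier_mat[of _ m m])
qed

lemma nc_function_mult:
  assumes f: "nc_function d f" and g: "nc_function d g"
  shows "nc_function d (\<lambda>X. f X * g X)"
proof (rule nc_functionI)
  fix m X S T assume *: "1 \<le> m" "X \<in> row_ball_level d m" "S \<in> carrier_mat m m" "T \<in> carrier_mat m m"
      "S * T = 1\<^sub>m m" "T * S = 1\<^sub>m m" "map (\<lambda>A. T * A * S) X \<in> row_ball_level d m"
  have c: "f X \<in> carrier_mat m m" "g X \<in> carrier_mat m m" 
    using nc_function_carrier[OF f] nc_function_carrier[OF g] * by auto
  have "(T * f X * S) * (T * g X * S) = T * (f X * g X) * S"
    using * c by (intro conj_mult)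
  then show "f (map (\<lambda>A. T * A * S) X) * g (map (\<lambda>A. T * A * S) X) = T * (f X * g X) * S"
    using * nc_function_similar[OF f *] nc_function_similar[OF g *] by simp
next
  fix m n X Y assume *: "1 \<le> m" "1 \<le> n" "X \<in> row_ball_level d m" "Y \<in> row_ball_level d n"
  show "f (tuple_dsum X Y) * g (tuple_dsum X Y) = mat_dsum (f X * g X) (f Y * g Y)"
    using * by (simp add: nc_function_dsum[OF f *] nc_function_dsum[OF g *] 
      mat_dsum_mult[of _ m _ _ n] nc_function_carrier[OF f] nc_function_carrier[OF g])
next
  fix m X assume *: "1 \<le> m" "X \<in> row_ball_level d m"
  show "f X * g X \<in> carrier_mat m m"
    using nc_function_carrier[OF f *] nc_function_carrier[OF g *] by (rule mult_carrier_mat)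
qed

text \<open>Inverting commutes with direct sums and with conjugation. This admits resolvents and
  Moebius transforms as nc functions without power series.\<close>

lemma nc_function_minv:
  assumes f: "nc_function d f"
    and inv: "\<And>m X. 1 \<le> m \<Longrightarrow> X \<in> row_ball_level d m \<Longrightarrow> \<exists>B\<in>carrier_mat m m. f X * B = 1\<^sub>m m"
  shows "nc_function d (\<lambda>X. minv (f X))"
proof (rule nc_functionI)
  fix m X assume *: "1 \<le> m" "X \<in> row_ball_level d m"
  then obtain B where "B \<in> carrier_mat m m" "f X * B = 1\<^sub>m m" using inv by blast
  then show "minv (f X) \<in> carrier_mat m m"
    using minv_eqI[of "f X" m B] nc_function_carrier[OF f *] by simp
next
  fix m n X Y assume *: "1 \<le> m" "1 \<le> n" "X \<in> row_ball_level d m" "Y \<in> row_ball_level d n"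
  then obtain B C where "B \<in> carrier_mat m m" "f X * B = 1\<^sub>m m" "C \<in> carrier_mat n n" "f Y * C = 1\<^sub>m n"
    using inv by meson
  then show "minv (f (tuple_dsum X Y)) = mat_dsum (minv (f X)) (minv (f Y))"
    using * mat_dsum_minv[of "f X" m B "f Y" n C] 
    by (simp add: nc_function_dsum[OF f *] nc_function_carrier[OF f])
next
  fix m X S T assume *: "1 \<le> m" "X \<in> row_ball_level d m" "S \<in> carrier_mat m m" "T \<in> carrier_mat m m"
      "S * T = 1\<^sub>m m" "T * S = 1\<^sub>m m" "map (\<lambda>A. T * A * S) X \<in> row_ball_level d m"
  then obtain B where B: "B \<in> carrier_mat m m" "f X * B = 1\<^sub>m m" using inv by blast
  have c: "f X \<in> carrier_mat m m" using nc_function_carrier[OF f] * by auto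
  have "(T * f X * S) * (T * B * S) = T * (f X * B) * S"
    using * c B by (intro conj_mult)
  also have "\<dots> = 1\<^sub>m m" using * B by simp
  finally have "minv (T * f X * S) = T * B * S"
    using * c B by (intro minv_eqI[of _ m]) (auto intro: mult_carrier_mat)
  moreover have "minv (f X) = B" using minv_eqI[of "f X" m B] c B by simp
  ultimately show "minv (f (map (\<lambda>A. T * A * S) X)) = T * minv (f X) * S"
    using nc_function_similar[OF f *] by simp
qed

section \<open>Uniformly bounded nc functions\<close>

definition nc_bounded :: "nat \<Rightarrow> real \<Rightarrow> (complex mat list \<Rightarrow> complex mat) \<Rightarrow> bool" where
  "nc_bounded d K f \<longleftrightarrow> nc_function d f \<and> (\<forall>m\<ge>1. \<forall>X\<in>row_ball_level d m. bnd m K (f X))"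

lemma nc_boundedD:
  "nc_bounded d K f \<Longrightarrow> 1 \<le> m \<Longrightarrow> X \<in> row_ball_level d m \<Longrightarrow> bnd m K (f X)"
  by (simp add: nc_bounded_def)

lemma nc_bounded_mono:
  assumes "nc_bounded d K f" "K \<le> L"
  shows "nc_bounded d L f"
  using assms bnd_mono[OF _ assms(2)] by (simp add: nc_bounded_def)

lemma nc_bounded_nc: "nc_bounded d K f \<Longrightarrow> nc_function d f"
  by (simp add: nc_bounded_def)

lemma nc_bounded_mult: "nc_bounded d K f \<Longrightarrow> nc_bounded d L g \<Longrightarrow> nc_bounded d (K * L) (\<lambda>X. f X * g X)"
  by (simp add: nc_bounded_def nc_function_mult bnd_mult)

lemma nc_bounded_smult: "nc_bounded d K f \<Longrightarrow> nc_bounded d (cmod z * K) (\<lambda>X. z \<cdot>\<^sub>m f X)"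
  by (simp add: nc_bounded_def nc_function_smult bnd_smult)

text \<open>A constant function still has to know the size of its argument; the multiple 0 of the
  first coordinate supplies it.\<close>

lemma nc_bounded_const:
  assumes "1 \<le> d"
  shows "nc_bounded d (cmod z) (\<lambda>X. aff z 0 (X ! 0))"
proof -
  have "bnd m (cmod z) (aff z 0 (X ! 0))" if "X \<in> row_ball_level d m" for m X
  proof (rule bndI)
    have c: "X ! 0 \<in> carrier_mat m m" using that assms by (simp add: row_ball_level_nth)
    then show "aff z 0 (X ! 0) \<in> carrier_mat m m" by simp
    fix v :: "complex vec" assume v: "v \<in> carrier_vec m"
    have "z \<cdot>\<^sub>v v + 0 \<cdot>\<^sub>v (X ! 0 *\<^sub>v v) = z \<cdot>\<^sub>v v" using c v by (intro eq_vecI) auto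
    then show "vec_l2 (aff z 0 (X ! 0) *\<^sub>v v) \<le> cmod z * vec_l2 v"
      using aff_mult_vec[OF c v] by (simp add: vec_l2_smult)
  qed simp
  then show ?thesis
    using assms by (simp add: nc_bounded_def nc_function_aff nc_function_coordinate)
qed

lemma nc_bounded_first:
  assumes "1 \<le> d"
  shows "nc_bounded d 1 (\<lambda>X. X ! 0)"
  using assms unfolding nc_bounded_def
  by (auto simp: nc_function_coordinate intro: bnd_mono less_imp_le elim!: row_ball_level_first)

lemma nc_function_mob:
  assumes f: "nc_bounded d 1 f" and a: "0 \<le> \<alpha>" "\<alpha> < 1"
  shows "nc_function d (\<lambda>X. mob \<alpha> (f X))"
  unfolding mob_def
proof (intro nc_function_mult nc_function_minv nc_function_aff nc_bounded_nc[OF f])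
  fix m X assume "1 \<le> m" "X \<in> row_ball_level d m"
  then have "bnd m 1 (f X)" by (rule nc_boundedD[OF f])
  then show "\<exists>B\<in>carrier_mat m m. aff 1 (- complex_of_real \<alpha>) (f X) * B = 1\<^sub>m m"
    using a by (elim aff_invertible[of m 1 "f X" "complex_of_real \<alpha>"]) auto
qed

lemma nc_bounded_mob:
  assumes "nc_bounded d 1 f" "0 \<le> \<alpha>" "\<alpha> < 1"
  shows "nc_bounded d 1 (\<lambda>X. mob \<alpha> (f X))"
  using nc_function_mob[OF assms] bnd_mob nc_boundedD[OF assms(1)] assms
  unfolding nc_bounded_def by blast

text \<open>The constant 1 in the form that the zeroth power of the first coordinate and the empty
  products \<open>climb n t 0\<close> and \<open>descend n t 0\<close> take.\<close>

lemma nc_function_one: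
  assumes "1 \<le> d"
  shows "nc_function d (\<lambda>X. 1\<^sub>m (dim_row (X ! 0)))"
proof (rule nc_functionI)
  fix m n X Y assume *: "X \<in> row_ball_level d m" "Y \<in> row_ball_level d n"
  then have "X ! 0 \<in> carrier_mat m m" "Y ! 0 \<in> carrier_mat n n" using assms by (auto simp: row_ball_level_nth)
  then show "1\<^sub>m (dim_row (tuple_dsum X Y ! 0)) = mat_dsum (1\<^sub>m (dim_row (X ! 0))) (1\<^sub>m (dim_row (Y ! 0)))"
    using assms * by (auto simp: tuple_dsum_def row_ball_level_def mat_dsum_one mat_dsum_def)
next
  fix m X S T assume *: "X \<in> row_ball_level d m" "S \<in> carrier_mat m m" "T \<in> carrier_mat m m"
      "S * T = 1\<^sub>m m" "T * S = 1\<^sub>m m" "map (\<lambda>A. T * A * S) X \<in> row_ball_level d m"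
  then have "X ! 0 \<in> carrier_mat m m" "map (\<lambda>A. T * A * S) X ! 0 \<in> carrier_mat m m"
    using assms by (blast intro: row_ball_level_nth less_le_trans zero_less_one)+
  then show "1\<^sub>m (dim_row (map (\<lambda>A. T * A * S) X ! 0)) = T * 1\<^sub>m (dim_row (X ! 0)) * S"
    using * by simp
qed (use assms in \<open>auto dest: row_ball_level_nth[of _ _ _ 0]\<close>)

lemma nc_bounded_pow:
  assumes d: "1 \<le> d"
  shows "nc_bounded d 1 (\<lambda>X. (X ! 0) ^\<^sub>m k)"
proof (induction k)
  case 0
  have "bnd m 1 (1\<^sub>m (dim_row (X ! 0)))" if "X \<in> row_ball_level d m" for m X
    using row_ball_level_nth[OF that, of 0] d bnd_one[of m] by auto
  then show ?case using nc_function_one[OF d] by (simp add: nc_bounded_def)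
next
  case (Suc k)
  then show ?case using nc_bounded_mult[OF Suc nc_bounded_first[OF d]] by simp
qed

text \<open>The argument \<open>A\<close> only fixes the size of the empty sum.\<close>

primrec msum :: "complex mat \<Rightarrow> (nat \<Rightarrow> complex mat) \<Rightarrow> nat \<Rightarrow> complex mat" where
  "msum A f 0 = aff 0 0 A"
| "msum A f (Suc k) = msum A f k + f k"

lemma msum_carrier:
  "A \<in> carrier_mat m m \<Longrightarrow> (\<And>i. i < k \<Longrightarrow> f i \<in> carrier_mat m m) \<Longrightarrow> msum A f k \<in> carrier_mat m m"
  by (induction k) auto

lemma nc_function_msum:
  assumes "1 \<le> d" "\<And>i. i < k \<Longrightarrow> nc_function d (f i)"
  shows "nc_function d (\<lambda>X. msum (X ! 0) (\<lambda>i. f i X) k)"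
  using assms(2)
proof (induction k)
  case 0
  show ?case using assms(1) by (simp add: nc_function_aff[OF nc_function_coordinate])
qed (auto intro: nc_function_add)

lemma msum_mult_vec_index:
  assumes "A \<in> carrier_mat m m" "v \<in> carrier_vec m" "a < m"
    and "\<And>i. i < k \<Longrightarrow> f i \<in> carrier_mat m m"
  shows "(msum A f k *\<^sub>v v) $ a = (\<Sum>i<k. (f i *\<^sub>v v) $ a)"
  using assms(4)
proof (induction k)
  case 0
  then show ?case using assms by (simp add: aff_mult_vec[of _ m] del: index_mult_mat_vec)
next
  case (Suc k)
  have "msum A f k \<in> carrier_mat m m" "f k \<in> carrier_mat m m" using Suc assms by (auto intro: msum_carrier)
  then have "(msum A f (Suc k) *\<^sub>v v) $ a = (msum A f k *\<^sub>v v) $ a + (f k *\<^sub>v v) $ a"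
    using assms by (simp add: add_mult_distrib_mat_vec[of _ m m] del: index_mult_mat_vec)
  then show ?case using Suc by simp
qed

section \<open>Adjoints, powers and bilinear sums\<close>

lemma adjoint_mult:
  "A \<in> carrier_mat m m \<Longrightarrow> B \<in> carrier_mat m m \<Longrightarrow>
    mat_adjoint (A * B) = mat_adjoint B * mat_adjoint (A :: complex mat)"
  by (intro eq_matI) (auto simp: scalar_prod_def mult.commute intro!: sum.cong)

lemma adjoint_add:
  "A \<in> carrier_mat m m \<Longrightarrow> B \<in> carrier_mat m m \<Longrightarrow>
    mat_adjoint (A + B) = mat_adjoint A + mat_adjoint (B :: complex mat)"
  by (intro eq_matI) auto

lemma adjoint_smult: "mat_adjoint (z \<cdot>\<^sub>m A) = cnj z \<cdot>\<^sub>m mat_adjoint (A :: complex mat)"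
  by (intro eq_matI) auto

lemma adjoint_one: "mat_adjoint (1\<^sub>m m) = (1\<^sub>m m :: complex mat)"
  by (intro eq_matI) auto

lemma pow_mat_Suc_left:
  "A \<in> carrier_mat m m \<Longrightarrow> A ^\<^sub>m Suc k = A * A ^\<^sub>m (k :: nat)"
proof (induction k)
  case (Suc k)
  have "A ^\<^sub>m Suc (Suc k) = A * A ^\<^sub>m k * A" using Suc by simp
  also have "\<dots> = A * (A ^\<^sub>m k * A)" using Suc by (intro assoc_mult_mat) auto
  finally show ?case by simp
qed auto

lemma adjoint_pow: 
  assumes "A \<in> carrier_mat m m"
  shows "mat_adjoint (A ^\<^sub>m k) = mat_adjoint (A :: complex mat) ^\<^sub>m k"
proof (induction k)
  case 0
  then show ?case using assms by (simp add: adjoint_one)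
next
  case (Suc k)
  have "mat_adjoint (A ^\<^sub>m Suc k) = mat_adjoint A * mat_adjoint A ^\<^sub>m k"
    using assms Suc by (simp add: adjoint_mult[of _ m])
  then show ?case using pow_mat_Suc_left[OF adjoint_carrier[OF assms], of k] by simp
qed

lemma adjoint_msum:
  assumes "A \<in> carrier_mat m m" "\<And>i. i < k \<Longrightarrow> f i \<in> carrier_mat m m"
  shows "mat_adjoint (msum A f k) = msum (mat_adjoint A) (\<lambda>i. mat_adjoint (f i)) k"
  using assms
proof (induction k)
  case (Suc k)
  then show ?case by (simp add: adjoint_add[of _ m] msum_carrier)
qed (simp add: adjoint_aff)

lemma bnd_pow: "bnd m r A \<Longrightarrow> bnd m (r ^ k) (A ^\<^sub>m k)"
proof (induction k)
  case 0
  then show ?case using bnd_one[of m] bnd_carrier[OF 0] by simp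
next
  case (Suc k)
  then show ?case using bnd_mult[of m "r ^ k" "A ^\<^sub>m k" r A] by (simp add: mult.commute)
qed

text \<open>The sum is the row of the A i, times Y tensored with an identity, times the column of
  the B j. The hypotheses bound the row by \<open>a\<close> and the column by \<open>b\<close>, so
  the norm is at most the product of the three.\<close>

lemma bnd_bilinear_sum:
  assumes A0: "A0 \<in> carrier_mat m m" and Y: "bnd n K Y"
    and A: "\<And>i. i < n \<Longrightarrow> A i \<in> carrier_mat m m" and B: "\<And>j. j < n \<Longrightarrow> B j \<in> carrier_mat m m"
    and a: "0 \<le> a" "\<And>u. u \<in> carrier_vec m \<Longrightarrow> (\<Sum>i<n. (vec_l2 (mat_adjoint (A i) *\<^sub>v u))\<^sup>2) \<le> (a * vec_l2 u)\<^sup>2"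
    and b: "0 \<le> b" "\<And>v. v \<in> carrier_vec m \<Longrightarrow> (\<Sum>j<n. (vec_l2 (B j *\<^sub>v v))\<^sup>2) \<le> (b * vec_l2 v)\<^sup>2"
  shows "bnd m (a * K * b) (msum A0 (\<lambda>i. msum A0 (\<lambda>j. Y $$ (i, j) \<cdot>\<^sub>m (A i * B j)) n) n)"
    (is "bnd m _ ?H")
proof (rule bnd_ipI)
  note Yc = bnd_carrier[OF Y]
  have AB: "A i * B j \<in> carrier_mat m m" if "i < n" "j < n" for i j
    using A B that by (blast intro: mult_carrier_mat)
  have in1: "msum A0 (\<lambda>j. Y $$ (i, j) \<cdot>\<^sub>m (A i * B j)) n \<in> carrier_mat m m" if "i < n" for i
    using AB that A0 by (intro msum_carrier) auto
  then show H: "?H \<in> carrier_mat m m" by (rule msum_carrier[OF A0])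
  show "0 \<le> a * K * b" using a b bnd_nonneg[OF Y] by simp
  fix u v :: "complex vec" assume u: "u \<in> carrier_vec m" and v: "v \<in> carrier_vec m"
  define x where "x c = vec n (\<lambda>j. (B j *\<^sub>v v) $ c)" for c
  define z where "z c = vec n (\<lambda>i. (mat_adjoint (A i) *\<^sub>v u) $ c)" for c
  have Hc: "(?H *\<^sub>v v) $ c = (\<Sum>i<n. \<Sum>j<n. Y $$ (i, j) * (A i *\<^sub>v (B j *\<^sub>v v)) $ c)" if "c < m" for c
  proof -
    have "(?H *\<^sub>v v) $ c = (\<Sum>i<n. (msum A0 (\<lambda>j. Y $$ (i, j) \<cdot>\<^sub>m (A i * B j)) n *\<^sub>v v) $ c)"
      using A0 v that in1 by (rule msum_mult_vec_index)
    also have "\<dots> = (\<Sum>i<n. \<Sum>j<n. (Y $$ (i, j) \<cdot>\<^sub>m (A i * B j) *\<^sub>v v) $ c)"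
      using A0 v that AB by (intro sum.cong msum_mult_vec_index[of _ m]) auto
    also have "\<dots> = (\<Sum>i<n. \<Sum>j<n. Y $$ (i, j) * (A i *\<^sub>v (B j *\<^sub>v v)) $ c)"
    proof (intro sum.cong refl)
      fix i j assume ij: "i \<in> {..<n}" "j \<in> {..<n}"
      have "Y $$ (i, j) \<cdot>\<^sub>m (A i * B j) *\<^sub>v v = Y $$ (i, j) \<cdot>\<^sub>v (A i *\<^sub>v (B j *\<^sub>v v))"
        using smult_mat_mult_vec[OF AB v] assoc_mult_mat_vec[OF A B v] ij by simp
      moreover have "A i *\<^sub>v (B j *\<^sub>v v) \<in> carrier_vec m"
        using A B v ij by (auto intro: mult_mat_vec_carrier)
      ultimately show "(Y $$ (i, j) \<cdot>\<^sub>m (A i * B j) *\<^sub>v v) $ c = Y $$ (i, j) * (A i *\<^sub>v (B j *\<^sub>v v)) $ c"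
        using that by (simp only: index_smult_vec carrier_vecD)
    qed
    finally show ?thesis .
  qed
  have "ip (?H *\<^sub>v v) u = (\<Sum>c<m. \<Sum>i<n. \<Sum>j<n. Y $$ (i, j) * ((A i *\<^sub>v (B j *\<^sub>v v)) $ c * cnj (u $ c)))"
    using H by (simp add: ip_def Hc sum_distrib_right mult.assoc del: index_mult_mat_vec)
  also have "\<dots> = (\<Sum>i<n. \<Sum>c<m. \<Sum>j<n. Y $$ (i, j) * ((A i *\<^sub>v (B j *\<^sub>v v)) $ c * cnj (u $ c)))"
    by (rule sum.swap)
  also have "\<dots> = (\<Sum>i<n. \<Sum>j<n. \<Sum>c<m. Y $$ (i, j) * ((A i *\<^sub>v (B j *\<^sub>v v)) $ c * cnj (u $ c)))"
    by (intro sum.cong sum.swap refl)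
  also have "\<dots> = (\<Sum>i<n. \<Sum>j<n. Y $$ (i, j) * ip (A i *\<^sub>v (B j *\<^sub>v v)) u)"
    by (intro sum.cong refl) (simp add: carrier_matD[OF A] ip_def sum_distrib_left del: index_mult_mat_vec)
  also have "\<dots> = (\<Sum>i<n. \<Sum>j<n. Y $$ (i, j) * ip (B j *\<^sub>v v) (mat_adjoint (A i) *\<^sub>v u))"
    using A B u v by (intro sum.cong refl) (simp add: ip_adjoint[of _ m m] mult_mat_vec_carrier[of _ m m])
  also have "\<dots> = (\<Sum>i<n. \<Sum>j<n. \<Sum>c<m. Y $$ (i, j) * x c $ j * cnj (z c $ i))"
    by (intro sum.cong refl)
      (simp add: carrier_matD[OF B] ip_def x_def z_def sum_distrib_left mult.assoc del: index_mult_mat_vec)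
  also have "\<dots> = (\<Sum>i<n. \<Sum>c<m. \<Sum>j<n. Y $$ (i, j) * x c $ j * cnj (z c $ i))"
    by (intro sum.cong sum.swap refl)
  also have "\<dots> = (\<Sum>c<m. \<Sum>i<n. \<Sum>j<n. Y $$ (i, j) * x c $ j * cnj (z c $ i))"
    by (rule sum.swap)
  also have "\<dots> = (\<Sum>c<m. ip (Y *\<^sub>v x c) (z c))"
    using Yc by (simp add: ip_def index_mult_mat_vec_sum[OF Yc] x_def sum_distrib_right del: index_mult_mat_vec)
  finally have "cmod (ip (?H *\<^sub>v v) u) \<le> (\<Sum>c<m. cmod (ip (Y *\<^sub>v x c) (z c)))"
    by (simp add: norm_sum)
  also have "\<dots> \<le> (\<Sum>c<m. K * (vec_l2 (x c) * vec_l2 (z c)))"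
  proof (rule sum_mono)
    fix c
    have "cmod (ip (Y *\<^sub>v x c) (z c)) \<le> vec_l2 (Y *\<^sub>v x c) * vec_l2 (z c)"
      using Yc by (intro ip_cauchy_schwarz[of _ n]) (auto simp: x_def z_def)
    also have "\<dots> \<le> K * vec_l2 (x c) * vec_l2 (z c)"
      by (intro mult_right_mono bndD[OF Y]) (auto simp: x_def)
    finally show "cmod (ip (Y *\<^sub>v x c) (z c)) \<le> K * (vec_l2 (x c) * vec_l2 (z c))" by (simp add: mult.assoc)
  qed
  also have "\<dots> = K * (\<Sum>c<m. \<bar>vec_l2 (x c)\<bar> * \<bar>vec_l2 (z c)\<bar>)"
    by (simp add: sum_distrib_left)
  also have "\<dots> \<le> K * (L2_set (\<lambda>c. vec_l2 (x c)) {..<m} * L2_set (\<lambda>c. vec_l2 (z c)) {..<m})"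
    using bnd_nonneg[OF Y] by (intro mult_left_mono L2_set_mult_ineq)
  also have "\<dots> \<le> K * ((b * vec_l2 v) * (a * vec_l2 u))"
  proof (intro mult_left_mono mult_mono)
    have "(\<Sum>c<m. (vec_l2 (x c))\<^sup>2) = (\<Sum>c<m. \<Sum>j<n. (cmod ((B j *\<^sub>v v) $ c))\<^sup>2)"
      by (simp add: vec_l2_sq x_def)
    also have "\<dots> = (\<Sum>j<n. \<Sum>c<m. (cmod ((B j *\<^sub>v v) $ c))\<^sup>2)" by (rule sum.swap)
    also have "\<dots> = (\<Sum>j<n. (vec_l2 (B j *\<^sub>v v))\<^sup>2)"
      by (intro sum.cong refl) (simp add: carrier_matD[OF B] vec_l2_sq del: index_mult_mat_vec)
    finally show "L2_set (\<lambda>c. vec_l2 (x c)) {..<m} \<le> b * vec_l2 v"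
      using b(2)[OF v] b(1) unfolding L2_set_def by (intro real_le_lsqrt) auto
    have "(\<Sum>c<m. (vec_l2 (z c))\<^sup>2) = (\<Sum>c<m. \<Sum>j<n. (cmod ((mat_adjoint (A j) *\<^sub>v u) $ c))\<^sup>2)"
      by (simp add: vec_l2_sq z_def)
    also have "\<dots> = (\<Sum>j<n. \<Sum>c<m. (cmod ((mat_adjoint (A j) *\<^sub>v u) $ c))\<^sup>2)" by (rule sum.swap)
    also have "\<dots> = (\<Sum>j<n. (vec_l2 (mat_adjoint (A j) *\<^sub>v u))\<^sup>2)"
      by (intro sum.cong refl) (simp add: carrier_matD[OF A] vec_l2_sq del: index_mult_mat_vec)
    finally show "L2_set (\<lambda>c. vec_l2 (z c)) {..<m} \<le> a * vec_l2 u"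
      using a(2)[OF u] a(1) unfolding L2_set_def by (intro real_le_lsqrt) auto
  qed (use a b bnd_nonneg[OF Y] in auto)
  finally show "cmod (ip (?H *\<^sub>v v) u) \<le> a * K * b * vec_l2 v * vec_l2 u" by (simp add: mult_ac)
qed

subsection \<open>The discrete Fourier transform\<close>

definition root1 :: "nat \<Rightarrow> complex" where
  "root1 n = cis (2 * pi / real n)"

lemma root1_norm [simp]: "cmod (root1 n) = 1"
  by (simp add: root1_def)

lemma root1_cnj: "root1 n * cnj (root1 n) = 1" "cnj (root1 n) * root1 n = 1"
  by (simp_all add: complex_norm_square[symmetric] mult.commute flip: complex_norm_square)

lemma root1_pow: "1 \<le> n \<Longrightarrow> root1 n ^ n = 1"
  by (simp add: root1_def DeMoivre)

lemma root1_pow_inj: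
  assumes "k < n" "l < n" "root1 n ^ k = root1 n ^ l"
  shows "k = l"
proof -
  have "root1 n ^ i = cis (2 * pi * real i / real n)" for i
    by (simp add: root1_def DeMoivre mult.commute)
  then show ?thesis
    using bij_betw_roots_unity[of n] assms by (auto simp: bij_betw_def inj_on_def)
qed

lemma root1_sum:
  assumes k: "k < n" and l: "l < n"
  shows "(\<Sum>j<n. (root1 n ^ k * cnj (root1 n) ^ l) ^ j) = (if k = l then of_nat n else 0)"
proof (cases "k = l")
  case True
  then have "root1 n ^ k * cnj (root1 n) ^ l = 1"
    by (simp add: root1_cnj flip: power_mult_distrib)
  then show ?thesis using True by simp
next
  case False
  let ?z = "root1 n ^ k * cnj (root1 n) ^ l"
  have n: "1 \<le> n" using k by simp
  have "?z ^ n = (root1 n ^ n) ^ k * cnj (root1 n ^ n) ^ l"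
    by (simp add: power_mult_distrib mult.commute flip: power_mult)
  then have z: "?z ^ n = 1" using root1_pow[OF n] by simp
  have "?z \<noteq> 1"
  proof
    assume "?z = 1"
    then have "root1 n ^ k * (cnj (root1 n) ^ l * root1 n ^ l) = root1 n ^ l"
      by (simp flip: mult.assoc)
    then have "root1 n ^ k = root1 n ^ l" by (simp add: root1_cnj flip: power_mult_distrib)
    then show False using root1_pow_inj[OF k l] False by simp
  qed
  then show ?thesis using False z by (simp add: sum_gp_strict)
qed

lemma dft_parseval:
  assumes n: "1 \<le> n"
  shows "(\<Sum>j<n. (cmod (\<Sum>k<n. (root1 n) ^ (j * k) * x k))\<^sup>2) = real n * (\<Sum>k<n. (cmod (x k))\<^sup>2)"
proof -
  let ?w = "root1 n"
  have "of_real (\<Sum>j<n. (cmod (\<Sum>k<n. ?w ^ (j * k) * x k))\<^sup>2) =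
      (\<Sum>j<n. (\<Sum>k<n. ?w ^ (j * k) * x k) * (\<Sum>l<n. cnj ?w ^ (j * l) * cnj (x l)))"
    by (simp add: complex_norm_square del: of_real_power)
  also have "\<dots> = (\<Sum>j<n. \<Sum>k<n. \<Sum>l<n. x k * cnj (x l) * (?w ^ k * cnj ?w ^ l) ^ j)"
    by (simp add: sum_product power_mult_distrib mult_ac flip: power_mult)
  also have "\<dots> = (\<Sum>k<n. \<Sum>j<n. \<Sum>l<n. x k * cnj (x l) * (?w ^ k * cnj ?w ^ l) ^ j)"
    by (rule sum.swap)
  also have "\<dots> = (\<Sum>k<n. \<Sum>l<n. \<Sum>j<n. x k * cnj (x l) * (?w ^ k * cnj ?w ^ l) ^ j)"
    by (intro sum.cong sum.swap refl)
  also have "\<dots> = (\<Sum>k<n. \<Sum>l<n. x k * cnj (x l) * (if k = l then of_nat n else 0))"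
    by (simp add: root1_sum flip: sum_distrib_left)
  also have "\<dots> = (\<Sum>k<n. of_nat n * (x k * cnj (x k)))"
    by (intro sum.cong) (auto simp: if_distrib sum.delta cong: if_cong)
  also have "\<dots> = of_real (real n * (\<Sum>k<n. (cmod (x k))\<^sup>2))"
    by (simp add: complex_norm_square sum_distrib_left del: of_real_power)
  finally show ?thesis by (simp only: of_real_eq_iff)
qed

text \<open>Both signs of the exponent occur: the projections at the node use the conjugate root,
  their adjoints the root itself.\<close>

lemma dft_parseval_cnj:
  assumes n: "1 \<le> n"
  shows "(\<Sum>j<n. (cmod (\<Sum>k<n. (cnj (root1 n)) ^ (j * k) * x k))\<^sup>2) = real n * (\<Sum>k<n. (cmod (x k))\<^sup>2)"
proof -
  have "cmod (\<Sum>k<n. (cnj (root1 n)) ^ (j * k) * x k) = cmod (\<Sum>k<n. (root1 n) ^ (j * k) * cnj (x k))" for j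
    by (subst complex_mod_cnj[symmetric]) simp
  then show ?thesis using dft_parseval[OF n, of "\<lambda>k. cnj (x k)"] by simp
qed

subsection \<open>Interpolation at a single point\<close>

definition clock :: "nat \<Rightarrow> complex mat" where
  "clock n = mat n n (\<lambda>(i, j). if i = j then root1 n ^ i else 0)"

definition shift :: "nat \<Rightarrow> complex mat" where
  "shift n = mat n n (\<lambda>(i, j). if i = Suc j mod n then 1 else 0)"

lemma clock_carrier: "clock n \<in> carrier_mat n n" and shift_carrier: "shift n \<in> carrier_mat n n"
  by (simp_all add: clock_def shift_def)

lemma clock_unit_vec: "k < n \<Longrightarrow> clock n *\<^sub>v unit_vec n k = root1 n ^ k \<cdot>\<^sub>v unit_vec n k"
  unfolding mult_mat_unit_vec[OF clock_carrier] by (intro eq_vecI) (auto simp: clock_def)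

lemma shift_unit_vec: "k < n \<Longrightarrow> shift n *\<^sub>v unit_vec n k = unit_vec n (Suc k mod n)"
  unfolding mult_mat_unit_vec[OF shift_carrier] by (intro eq_vecI) (auto simp: shift_def)

lemma bnd_clock: "bnd n 1 (clock n)"
proof (rule bndI[OF clock_carrier])
  fix v :: "complex vec" assume v: "v \<in> carrier_vec n"
  have *: "(clock n *\<^sub>v v) $ i = root1 n ^ i * v $ i" if "i < n" for i
  proof -
    have "(clock n *\<^sub>v v) $ i = (\<Sum>j<n. if j = i then root1 n ^ i * v $ i else 0)"
      using that v unfolding index_mult_mat_vec_sum[OF clock_carrier v that]
      by (intro sum.cong) (auto simp: clock_def)
    then show ?thesis using that by simp
  qed
  have "(vec_l2 (clock n *\<^sub>v v))\<^sup>2 = (vec_l2 v)\<^sup>2"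
    using v clock_carrier[of n] by (simp add: vec_l2_sq * norm_mult norm_power del: index_mult_mat_vec)
  then show "vec_l2 (clock n *\<^sub>v v) \<le> 1 * vec_l2 v"
    using power2_eq_iff_nonneg[of "vec_l2 (clock n *\<^sub>v v)" "vec_l2 v"] by simp
qed simp

text \<open>Passing to the adjoint spares the predecessor modulo \<open>n\<close>: coordinate
  \<open>j\<close> of the image is just the entry at \<open>Suc j mod n\<close>.\<close>

lemma bnd_shift: "bnd n 1 (shift n)"
proof -
  have "bnd n 1 (mat_adjoint (shift n))"
  proof (rule bndI)
    show c: "mat_adjoint (shift n) \<in> carrier_mat n n" using shift_carrier by simp
    fix v :: "complex vec" assume v: "v \<in> carrier_vec n"
    have *: "(mat_adjoint (shift n) *\<^sub>v v) $ j = v $ (Suc j mod n)" if "j < n" for j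
    proof -
      have "(mat_adjoint (shift n) *\<^sub>v v) $ j = (\<Sum>i<n. if i = Suc j mod n then v $ i else 0)"
        using that unfolding index_mult_mat_vec_sum[OF c v that]
        by (intro sum.cong) (auto simp: shift_def)
      then show ?thesis using that by simp
    qed
    have "(vec_l2 (mat_adjoint (shift n) *\<^sub>v v))\<^sup>2 = (vec_l2 v)\<^sup>2"
    proof (cases n)
      case (Suc k)
      have "(vec_l2 (mat_adjoint (shift n) *\<^sub>v v))\<^sup>2 = (\<Sum>j<Suc k. (cmod (v $ (Suc j mod Suc k)))\<^sup>2)"
        using c * carrier_matD[OF shift_carrier[of n]]
        by (simp add: vec_l2_sq Suc del: index_mult_mat_vec sum.lessThan_Suc)
      also have "\<dots> = (\<Sum>j<k. (cmod (v $ Suc j))\<^sup>2) + (cmod (v $ 0))\<^sup>2" by simp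
      also have "\<dots> = (\<Sum>j<Suc k. (cmod (v $ j))\<^sup>2)" unfolding sum.lessThan_Suc_shift by simp
      finally show ?thesis using v by (simp add: vec_l2_sq Suc)
    qed (use v in \<open>simp add: vec_l2_sq shift_def\<close>)
    then show "vec_l2 (mat_adjoint (shift n) *\<^sub>v v) \<le> 1 * vec_l2 v"
      using power2_eq_iff_nonneg[of "vec_l2 (mat_adjoint (shift n) *\<^sub>v v)" "vec_l2 v"] by simp
  qed simp
  then show ?thesis using bnd_adjoint by fastforce
qed

text \<open>The factor \<open>sqrt (1 - t\<^sup>2)\<close> makes the norm of the row square at most
  \<open>t\<^sup>2 + t\<^sup>2 (1 - t\<^sup>2) = 1 - (1 - t\<^sup>2)\<^sup>2\<close>.\<close>

definition node :: "nat \<Rightarrow> nat \<Rightarrow> real \<Rightarrow> complex mat list" where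
  "node d n t = of_real t \<cdot>\<^sub>m clock n #
    (if d = 1 then [] else of_real (t * sqrt (1 - t\<^sup>2)) \<cdot>\<^sub>m shift n # replicate (d - 2) (0\<^sub>m n n))"

lemma node_0 [simp]: "node d n t ! 0 = of_real t \<cdot>\<^sub>m clock n"
  by (simp add: node_def)

lemma node_1: "2 \<le> d \<Longrightarrow> node d n t ! 1 = of_real (t * sqrt (1 - t\<^sup>2)) \<cdot>\<^sub>m shift n"
  by (simp add: node_def)

lemma node_in_row_ball:
  assumes d: "1 \<le> d" and t: "0 < t" "t < 1"
  shows "node d n t \<in> row_ball_level d n"
proof -
  let ?s = "t * sqrt (1 - t\<^sup>2)"
  have t2: "t\<^sup>2 \<le> 1" using t by (simp add: power_le_one)
  have s2: "?s * ?s = t\<^sup>2 * (1 - t\<^sup>2)" using t2 by (simp add: power2_eq_square mult_ac)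
  have len: "length (node d n t) = d" "set (node d n t) \<subseteq> carrier_mat n n"
    using d clock_carrier shift_carrier by (auto simp: node_def)
  have zero: "bnd n 0 (row_square n (replicate k (0\<^sub>m n n)))" for k
  proof (induction k)
    case 0
    show ?case by (rule bnd_ipI) (auto simp: ip_def)
  next
    case (Suc k)
    have "mat_adjoint (0\<^sub>m n n) \<in> carrier_mat n n" by simp
    then have "0\<^sub>m n n * mat_adjoint (0\<^sub>m n n) = (0\<^sub>m n n :: complex mat)" by simp
    then show ?case using Suc bnd_carrier[OF Suc] by simp
  qed
  have sq: "bnd n (r * r) (A * mat_adjoint A)" if "bnd n r A" for r A
    using bnd_mult[OF that bnd_adjoint[OF that]] .
  have A: "bnd n t (of_real t \<cdot>\<^sub>m clock n)"
    using bnd_smult[OF bnd_clock, where z = "of_real t"] t by simp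
  have B: "bnd n ?s (of_real ?s \<cdot>\<^sub>m shift n)"
    using bnd_smult[OF bnd_shift, where z = "of_real ?s"] t t2 by (simp del: of_real_mult)
  have "bnd n (t * t + (?s * ?s + 0)) (row_square n (node d n t))"
  proof (cases "d = 1")
    case True
    have "bnd n (t * t + 0) (row_square n (node d n t))"
      using bnd_add[OF sq[OF A] zero[of 0]] True by (simp add: node_def)
    then show ?thesis by (rule bnd_mono) (use t2 in auto)
  next
    case False
    then show ?thesis
      using bnd_add[OF sq[OF A] bnd_add[OF sq[OF B] zero[of "d - 2"]]] by (simp add: node_def)
  qed
  then have "op_norm (row_square n (node d n t)) \<le> t * t + (?s * ?s + 0)"
    using op_norm_le_iff_bnd bnd_carrier bnd_nonneg by blast
  also have "\<dots> < 1"
  proof -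
    have "1 - (t * t + (?s * ?s + 0)) = (1 - t\<^sup>2)\<^sup>2"
      unfolding s2 by (simp add: power2_eq_square algebra_simps)
    moreover have "t\<^sup>2 < 1" using t by (simp add: power_less_one_iff)
    ultimately show ?thesis by (smt (verit) zero_less_power)
  qed
  finally show ?thesis using len by (simp add: row_ball_level_def)
qed

section \<open>Powers and spectral projections of the clock\<close>

lemma scaled_clock_pow_unit_vec:
  assumes "k < n"
  shows "(z \<cdot>\<^sub>m clock n) ^\<^sub>m i *\<^sub>v unit_vec n k = (z * root1 n ^ k) ^ i \<cdot>\<^sub>v unit_vec n k"
proof (induction i)
  case 0
  then show ?case using clock_carrier[of n] by simp
next
  case (Suc i)
  have c: "z \<cdot>\<^sub>m clock n \<in> carrier_mat n n" using clock_carrier by simp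
  have "(z \<cdot>\<^sub>m clock n) ^\<^sub>m Suc i *\<^sub>v unit_vec n k =
      (z \<cdot>\<^sub>m clock n) ^\<^sub>m i *\<^sub>v ((z * root1 n ^ k) \<cdot>\<^sub>v unit_vec n k)"
    using c assms clock_carrier[of n]
    by (simp add: assoc_mult_mat_vec[of _ n n _ n] smult_mat_mult_vec[of _ n n] clock_unit_vec smult_smult_assoc)
  also have "\<dots> = (z * root1 n ^ k) ^ Suc i \<cdot>\<^sub>v unit_vec n k"
    using c by (simp add: mult_mat_vec[of _ n n] Suc smult_smult_assoc)
  finally show ?case .
qed

lemma mat_eq_unit_vecI:
  assumes "A \<in> carrier_mat n n" "B \<in> carrier_mat n n"
    and "\<And>k. k < n \<Longrightarrow> A *\<^sub>v unit_vec n k = B *\<^sub>v (unit_vec n k :: complex vec)"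
  shows "A = B"
proof (rule eq_matI)
  fix i j assume ij: "i < dim_row B" "j < dim_col B"
  then have "col A j = col B j"
    using assms mult_mat_unit_vec[OF assms(1), of j] mult_mat_unit_vec[OF assms(2), of j] by auto
  then have "col A j $ i = col B j $ i" by simp
  then show "A $$ (i, j) = B $$ (i, j)" using ij assms by simp
qed (use assms in auto)

text \<open>The eigenvalues of the clock are \<open>n\<close>-th roots of unity, so an exponent
  divisible by \<open>n\<close> makes them all equal. Functions of such a power take scalar values
  at the node, which lets one scalar Blaschke product deal with nodes of several sizes.\<close>

lemma scaled_clock_pow_scalar:
  assumes "1 \<le> n" "n dvd L"
  shows "(z \<cdot>\<^sub>m clock n) ^\<^sub>m L = z ^ L \<cdot>\<^sub>m 1\<^sub>m n"
proof (rule mat_eq_unit_vecI[of _ n])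
  show "(z \<cdot>\<^sub>m clock n) ^\<^sub>m L \<in> carrier_mat n n" using clock_carrier by simp
  fix k assume k: "k < n"
  obtain q where q: "L = n * q" using assms by blast
  have "(root1 n ^ k) ^ L = ((root1 n ^ n) ^ k) ^ q"
    unfolding q by (simp only: mult.commute mult.left_commute flip: power_mult)
  then have "(z * root1 n ^ k) ^ L = z ^ L"
    using root1_pow[OF assms(1)] by (simp add: power_mult_distrib)
  then show "(z \<cdot>\<^sub>m clock n) ^\<^sub>m L *\<^sub>v unit_vec n k = (z ^ L \<cdot>\<^sub>m 1\<^sub>m n) *\<^sub>v unit_vec n k"
    using k by (simp add: scaled_clock_pow_unit_vec smult_mat_mult_vec[of _ n n])
qed simp

text \<open>The average over k < n of the powers (w^j A / t)^k. For A = \<open>t\<close> times the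
  clock and w the conjugate root this is the projection onto the \<open>j\<close>-th eigenvector;
  for other A it is merely a polynomial in A, whose size has to be estimated.\<close>

definition dft_proj :: "nat \<Rightarrow> real \<Rightarrow> complex \<Rightarrow> complex mat \<Rightarrow> nat \<Rightarrow> complex mat" where
  "dft_proj n t w A j = msum A (\<lambda>k. (w ^ (j * k) / (of_nat n * of_real t ^ k)) \<cdot>\<^sub>m A ^\<^sub>m k) n"

lemma dft_proj_carrier: "A \<in> carrier_mat m m \<Longrightarrow> dft_proj n t w A j \<in> carrier_mat m m"
  unfolding dft_proj_def by (intro msum_carrier) auto

lemma adjoint_dft_proj:
  assumes "A \<in> carrier_mat m m"
  shows "mat_adjoint (dft_proj n t w A j) = dft_proj n t (cnj w) (mat_adjoint A) j"
proof -
  have "mat_adjoint ((w ^ (j * k) / (of_nat n * of_real t ^ k)) \<cdot>\<^sub>m A ^\<^sub>m k) =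
      (cnj w ^ (j * k) / (of_nat n * of_real t ^ k)) \<cdot>\<^sub>m mat_adjoint A ^\<^sub>m k" for k
    using assms by (simp add: adjoint_smult adjoint_pow)
  then show ?thesis
    unfolding dft_proj_def using assms by (subst adjoint_msum) auto
qed

text \<open>By Parseval the sum over j equals the average over k of |A^k v|^2 / t^(2k). Hence the
  whole column of \<open>n\<close> projections costs only t^(-n), with no factor growing with their
  number as a termwise estimate would give.\<close>

lemma dft_proj_column:
  assumes A: "bnd m 1 A" and n: "1 \<le> n" and t: "0 < t" "t < 1" and v: "v \<in> carrier_vec m"
    and w: "w = root1 n \<or> w = cnj (root1 n)"
  shows "(\<Sum>j<n. (vec_l2 (dft_proj n t w A j *\<^sub>v v))\<^sup>2) \<le> (vec_l2 v / t ^ n)\<^sup>2"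
proof -
  note Ac = bnd_carrier[OF A]
  define x where "x a k = (A ^\<^sub>m k *\<^sub>v v) $ a / of_real (t ^ k)" for a k
  have pc: "A ^\<^sub>m k \<in> carrier_mat m m" for k using Ac by simp
  have idx: "(dft_proj n t w A j *\<^sub>v v) $ a = (\<Sum>k<n. w ^ (j * k) * x a k) / of_nat n" if "a < m" for a j
  proof -
    have "(dft_proj n t w A j *\<^sub>v v) $ a =
        (\<Sum>k<n. ((w ^ (j * k) / (of_nat n * of_real t ^ k)) \<cdot>\<^sub>m A ^\<^sub>m k *\<^sub>v v) $ a)"
      unfolding dft_proj_def using pc by (intro msum_mult_vec_index[OF Ac v that]) auto
    also have "\<dots> = (\<Sum>k<n. w ^ (j * k) * x a k / of_nat n)"
      unfolding smult_mat_mult_vec[OF pc v] x_def using that Ac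
      by (intro sum.cong refl) (simp del: index_mult_mat_vec)
    finally show ?thesis by (simp add: sum_divide_distrib)
  qed
  have "(\<Sum>j<n. (vec_l2 (dft_proj n t w A j *\<^sub>v v))\<^sup>2) =
      (\<Sum>j<n. \<Sum>a<m. (cmod ((\<Sum>k<n. w ^ (j * k) * x a k) / of_nat n))\<^sup>2)"
    by (simp add: carrier_matD[OF dft_proj_carrier[OF Ac]] vec_l2_sq idx del: index_mult_mat_vec)
  also have "\<dots> = (\<Sum>a<m. \<Sum>j<n. (cmod ((\<Sum>k<n. w ^ (j * k) * x a k) / of_nat n))\<^sup>2)"
    by (rule sum.swap)
  also have "\<dots> = (\<Sum>a<m. (\<Sum>j<n. (cmod (\<Sum>k<n. w ^ (j * k) * x a k))\<^sup>2) / (real n)\<^sup>2)"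
    by (simp add: norm_divide power_divide flip: sum_divide_distrib)
  also have "\<dots> = (\<Sum>a<m. (\<Sum>k<n. (cmod (x a k))\<^sup>2) / real n)"
    using w n dft_parseval[OF n] dft_parseval_cnj[OF n] by (auto simp: power2_eq_square)
  also have "\<dots> = (\<Sum>k<n. \<Sum>a<m. (cmod (x a k))\<^sup>2) / real n"
    by (subst sum.swap) (simp add: sum_divide_distrib)
  also have "\<dots> \<le> (\<Sum>k<n. (vec_l2 v / t ^ n)\<^sup>2) / real n"
  proof (intro divide_right_mono sum_mono)
    fix k assume k: "k \<in> {..<n}"
    have "(\<Sum>a<m. (cmod (x a k))\<^sup>2) = (vec_l2 (A ^\<^sub>m k *\<^sub>v v) / t ^ k)\<^sup>2"
      using Ac t by (simp add: x_def vec_l2_sq norm_divide power_divide sum_divide_distrib del: index_mult_mat_vec of_real_power)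
    also have "\<dots> \<le> (vec_l2 v / t ^ n)\<^sup>2"
    proof (intro power_mono frac_le)
      show "vec_l2 (A ^\<^sub>m k *\<^sub>v v) \<le> vec_l2 v" using bndD[OF bnd_pow[OF A, of k] v] by simp
      show "t ^ n \<le> t ^ k" using t k by (intro power_decreasing) auto
    qed (use t in auto)
    finally show "(\<Sum>a<m. (cmod (x a k))\<^sup>2) \<le> (vec_l2 v / t ^ n)\<^sup>2" .
  qed simp
  finally show ?thesis using n by simp
qed

lemma dft_proj_clock:
  assumes t: "0 < t" and k: "k < n" and j: "j < n"
  shows "dft_proj n t (cnj (root1 n)) (of_real t \<cdot>\<^sub>m clock n) j *\<^sub>v unit_vec n k =
    (if j = k then unit_vec n k else 0\<^sub>v n)"
proof (rule eq_vecI)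
  let ?A = "of_real t \<cdot>\<^sub>m clock n"
  have c: "?A \<in> carrier_mat n n" using clock_carrier by simp
  fix a assume "a < dim_vec (if j = k then unit_vec n k else 0\<^sub>v n :: complex vec)"
  then have a: "a < n" by (simp split: if_splits)
  have "(dft_proj n t (cnj (root1 n)) ?A j *\<^sub>v unit_vec n k) $ a =
      (\<Sum>i<n. ((cnj (root1 n) ^ (j * i) / (of_nat n * of_real t ^ i)) \<cdot>\<^sub>m ?A ^\<^sub>m i *\<^sub>v unit_vec n k) $ a)"
    unfolding dft_proj_def using c by (intro msum_mult_vec_index[OF c _ a]) auto
  also have "\<dots> = (\<Sum>i<n. (root1 n ^ k * cnj (root1 n) ^ j) ^ i * (unit_vec n k $ a / of_nat n))"
  proof (intro sum.cong refl)
    fix i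
    have "((cnj (root1 n) ^ (j * i) / (of_nat n * of_real t ^ i)) \<cdot>\<^sub>m ?A ^\<^sub>m i *\<^sub>v unit_vec n k) $ a
      = cnj (root1 n) ^ (j * i) / (of_nat n * of_real t ^ i) * ((of_real t * root1 n ^ k) ^ i * unit_vec n k $ a)"
      using a by (simp add: smult_mat_mult_vec[OF pow_carrier_mat[OF c]] scaled_clock_pow_unit_vec[OF k]
          del: index_mult_mat_vec)
    then show "((cnj (root1 n) ^ (j * i) / (of_nat n * of_real t ^ i)) \<cdot>\<^sub>m ?A ^\<^sub>m i *\<^sub>v unit_vec n k) $ a
      = (root1 n ^ k * cnj (root1 n) ^ j) ^ i * (unit_vec n k $ a / of_nat n)"
      using t by (simp add: power_mult_distrib power_mult)
  qed
  also have "\<dots> = (if k = j then of_nat n else 0) * (unit_vec n k $ a / of_nat n)"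
    by (simp only: root1_sum[OF k j] flip: sum_distrib_right)
  finally show "(dft_proj n t (cnj (root1 n)) ?A j *\<^sub>v unit_vec n k) $ a =
      (if j = k then unit_vec n k else 0\<^sub>v n) $ a"
    using a k by (auto simp del: index_mult_mat_vec)
qed (simp add: carrier_matD[OF dft_proj_carrier[OF smult_carrier_mat[OF clock_carrier]]])

text \<open>If \<open>(A, B)\<close> is a row contraction, then \<open>sqrt (1 - t\<^sup>2) (1 - z A)\<^sup>-\<^sup>1 B\<close> with \<open>\<bar>z\<bar> = t\<close> is a
  contraction.\<close>

definition raise :: "nat \<Rightarrow> real \<Rightarrow> nat \<Rightarrow> complex mat list \<Rightarrow> complex mat" where
  "raise n t l X = aff 0 (of_real (sqrt (1 - t\<^sup>2)))
    (minv (aff 1 (- (of_real t * cnj (root1 n) ^ l)) (X ! 0)) * X ! 1)"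

lemma raise_inverse:
  assumes X: "X \<in> row_ball_level d m" and d: "1 \<le> d" and t: "0 < t" "t < 1"
  obtains B where "B \<in> carrier_mat m m"
    "aff 1 (- (of_real t * cnj (root1 n) ^ l)) (X ! 0) * B = 1\<^sub>m m"
    "B * aff 1 (- (of_real t * cnj (root1 n) ^ l)) (X ! 0) = 1\<^sub>m m"
    "minv (aff 1 (- (of_real t * cnj (root1 n) ^ l)) (X ! 0)) = B"
proof -
  let ?z = "of_real t * cnj (root1 n) ^ l"
  obtain r where r: "r < 1" "bnd m r (X ! 0)" using row_ball_level_first[OF X d] .
  have "cmod ?z * r < 1"
    using t r(1) bnd_nonneg[OF r(2)] mult_strict_mono[of t 1 r 1] by (simp add: norm_mult norm_power)
  then obtain B where "B \<in> carrier_mat m m" "B * aff 1 (- ?z) (X ! 0) = 1\<^sub>m m"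
      "aff 1 (- ?z) (X ! 0) * B = 1\<^sub>m m" using aff_invertible[OF r(2)] by blast
  then show thesis
    using that minv_eqI[of "aff 1 (- ?z) (X ! 0)" m B] bnd_carrier[OF r(2)] by simp
qed

lemma nc_bounded_raise:
  assumes d: "2 \<le> d" and t: "0 < t" "t < 1"
  shows "nc_bounded d 1 (raise n t l)"
proof -
  let ?z = "of_real t * cnj (root1 n) ^ l"
  let ?s = "sqrt (1 - t\<^sup>2)"
  have t2: "t\<^sup>2 \<le> 1" using t by (simp add: power_le_one)
  have d1: "1 \<le> d" using d by simp
  have "nc_function d (\<lambda>X. aff 0 (of_real ?s) (minv (aff 1 (- ?z) (X ! 0)) * X ! 1))"
  proof (intro nc_function_aff nc_function_mult nc_function_minv nc_function_coordinate)
    fix m X assume "X \<in> row_ball_level d m"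
    then show "\<exists>B\<in>carrier_mat m m. aff 1 (- ?z) (X ! 0) * B = 1\<^sub>m m"
      using raise_inverse[OF _ d1 t, of X m n l] by metis
  qed (use d in auto)
  moreover have "bnd m 1 (raise n t l X)" if X: "X \<in> row_ball_level d m" for m X
  proof -
    have c: "X ! 0 \<in> carrier_mat m m" "X ! 1 \<in> carrier_mat m m" using X d by (auto simp: row_ball_level_nth)
    obtain B where B: "B \<in> carrier_mat m m" "aff 1 (- ?z) (X ! 0) * B = 1\<^sub>m m"
      "B * aff 1 (- ?z) (X ! 0) = 1\<^sub>m m" "minv (aff 1 (- ?z) (X ! 0)) = B"
      using raise_inverse[OF X d1 t] .
    have BX: "B * X ! 1 \<in> carrier_mat m m" using B(1) c(2) by (rule mult_carrier_mat)
    have adj: "mat_adjoint (raise n t l X) = aff 0 (of_real ?s) (mat_adjoint (X ! 1) * mat_adjoint B)"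
      unfolding raise_def B(4) adjoint_aff[OF BX] adjoint_mult[OF B(1) c(2)] by simp
    have adjB: "aff 1 (- cnj ?z) (mat_adjoint (X ! 0)) * mat_adjoint B = 1\<^sub>m m"
    proof -
      have "mat_adjoint (B * aff 1 (- ?z) (X ! 0)) = 1\<^sub>m m" unfolding B(3) by (rule adjoint_one)
      then show ?thesis using adjoint_mult[OF B(1) aff_carrier[OF c(1)], of 1 "- ?z"] adjoint_aff[OF c(1), of 1 "- ?z"]
        by simp
    qed
    have c': "mat_adjoint (X ! 0) \<in> carrier_mat m m" "mat_adjoint (X ! 1) \<in> carrier_mat m m"
      "mat_adjoint B \<in> carrier_mat m m" using c B by auto
    have "bnd m 1 (mat_adjoint (raise n t l X))"
    proof (rule bndI)
      have XB: "mat_adjoint (X ! 1) * mat_adjoint B \<in> carrier_mat m m" using c'(2,3) by (rule mult_carrier_mat)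
      then show "mat_adjoint (raise n t l X) \<in> carrier_mat m m" unfolding adj by simp
      fix u :: "complex vec" assume u: "u \<in> carrier_vec m"
      define w where "w = mat_adjoint B *\<^sub>v u"
      have w: "w \<in> carrier_vec m" using c'(3) u by (simp add: w_def)
      define y where "y = mat_adjoint (X ! 0) *\<^sub>v w"
      have y: "y \<in> carrier_vec m" using mult_mat_vec_carrier[OF c'(1) w] by (simp add: y_def)
      have "u = aff 1 (- cnj ?z) (mat_adjoint (X ! 0)) *\<^sub>v w"
        unfolding w_def assoc_mult_mat_vec[OF aff_carrier[OF c'(1)] c'(3) u, symmetric] adjB
        using u by simp
      then have uw: "u = w + - cnj ?z \<cdot>\<^sub>v y"
        unfolding aff_mult_vec[OF c'(1) w] y_def[symmetric] by simp
      have "(1 - t\<^sup>2) * (vec_l2 (mat_adjoint (X ! 1) *\<^sub>v w))\<^sup>2 \<le> (1 - t\<^sup>2) * ((vec_l2 w)\<^sup>2 - (vec_l2 y)\<^sup>2)"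
        using row_ball_level_first_two[OF X d w] t2 by (intro mult_left_mono) (auto simp: y_def)
      also have "\<dots> \<le> (vec_l2 u)\<^sup>2"
        using sq_l2_diff_identity[OF w y, of "cnj ?z"] t unfolding uw[symmetric]
        by (simp add: norm_mult norm_power) (smt (verit) zero_le_power2)
      finally have "(?s * vec_l2 (mat_adjoint (X ! 1) *\<^sub>v w))\<^sup>2 \<le> (vec_l2 u)\<^sup>2"
        using t2 by (simp add: power_mult_distrib)
      then have le: "?s * vec_l2 (mat_adjoint (X ! 1) *\<^sub>v w) \<le> vec_l2 u"
        by (rule power2_le_imp_le) simp
      have "mat_adjoint (raise n t l X) *\<^sub>v u = of_real ?s \<cdot>\<^sub>v (mat_adjoint (X ! 1) *\<^sub>v w)"
        unfolding adj aff_mult_vec[OF XB u] w_def using c' u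
        by (intro eq_vecI) (auto simp: assoc_mult_mat_vec[of _ m m _ m] simp del: index_mult_mat_vec)
      then show "vec_l2 (mat_adjoint (raise n t l X) *\<^sub>v u) \<le> 1 * vec_l2 u"
        using le t2 by (simp only: vec_l2_smult norm_of_real) (simp del: adjoint_dim)
    qed simp
    then show ?thesis using bnd_adjoint by fastforce
  qed
  ultimately show ?thesis unfolding nc_bounded_def raise_def by simp
qed

text \<open>The phase is chosen so that the target unit vector is an eigenvector of 1 - z A with
  eigenvalue 1 - t^2. Its inverse is cancelled exactly by the two factors
  \<open>sqrt (1 - t\<^sup>2)\<close>, one from \<open>raise\<close> and one from the node, and only
  the factor \<open>t\<close> remains.\<close>

lemma raise_node:
  assumes d: "2 \<le> d" and n: "1 \<le> n" and t: "0 < t" "t < 1" and l: "l < n"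
  shows "raise n t (Suc l) (node d n t) *\<^sub>v unit_vec n l = of_real t \<cdot>\<^sub>v unit_vec n (Suc l mod n)"
proof -
  let ?l = "Suc l mod n" and ?X = "node d n t" and ?s = "sqrt (1 - t\<^sup>2)"
  let ?z = "of_real t * cnj (root1 n) ^ Suc l"
  have d1: "1 \<le> d" and ln: "?l < n" using d n by auto
  have t2: "t\<^sup>2 < 1" using t by (simp add: power_less_one_iff)
  have X: "?X \<in> row_ball_level d n" using node_in_row_ball[OF d1 t] .
  have c: "?X ! 0 \<in> carrier_mat n n" "?X ! 1 \<in> carrier_mat n n"
    using row_ball_level_nth[OF X, of 0] row_ball_level_nth[OF X, of 1] d by (simp_all del: node_0)
  obtain B where B: "B \<in> carrier_mat n n" "aff 1 (- ?z) (?X ! 0) * B = 1\<^sub>m n"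
    "B * aff 1 (- ?z) (?X ! 0) = 1\<^sub>m n" "minv (aff 1 (- ?z) (?X ! 0)) = B"
    using raise_inverse[OF X d1 t] .
  \<comment> \<open>At the wrap-around the index drops from \<open>n\<close> to 0 while the root of
    unity is unchanged.\<close>
  have root: "root1 n ^ ?l = root1 n ^ Suc l"
  proof (cases "Suc l = n")
    case True
    then show ?thesis using root1_pow[OF n] by (simp del: power_Suc)
  next
    case False
    then show ?thesis using l by (simp del: power_Suc)
  qed
  have "?z * (of_real t * root1 n ^ ?l) = of_real (t\<^sup>2) * (cnj (root1 n) * root1 n) ^ Suc l"
    unfolding root by (simp only: power_mult_distrib power2_eq_square of_real_mult mult_ac)
  then have zt: "?z * (of_real t * root1 n ^ ?l) = of_real (t\<^sup>2)" by (simp only: root1_cnj power_one mult_1_right)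
  have "aff 1 (- ?z) (?X ! 0) *\<^sub>v unit_vec n ?l =
      unit_vec n ?l + - ?z \<cdot>\<^sub>v ((of_real t * root1 n ^ ?l) \<cdot>\<^sub>v unit_vec n ?l)"
    unfolding aff_mult_vec[OF c(1) unit_vec_carrier]
    unfolding node_0 smult_mat_mult_vec[OF clock_carrier unit_vec_carrier] clock_unit_vec[OF ln]
      smult_smult_assoc one_smult_vec ..
  also have "\<dots> = of_real (1 - t\<^sup>2) \<cdot>\<^sub>v unit_vec n ?l"
  proof (rule eq_vecI)
    fix a assume "a < dim_vec (of_real (1 - t\<^sup>2) \<cdot>\<^sub>v unit_vec n ?l)"
    then show "(unit_vec n ?l + - ?z \<cdot>\<^sub>v ((of_real t * root1 n ^ ?l) \<cdot>\<^sub>v unit_vec n ?l)) $ a =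
      (of_real (1 - t\<^sup>2) \<cdot>\<^sub>v unit_vec n ?l) $ a"
      using zt ln by (simp add: algebra_simps)
  qed simp
  finally have e: "aff 1 (- ?z) (?X ! 0) *\<^sub>v unit_vec n ?l = of_real (1 - t\<^sup>2) \<cdot>\<^sub>v unit_vec n ?l" .
  have "of_real (1 - t\<^sup>2) \<cdot>\<^sub>v (B *\<^sub>v unit_vec n ?l) = B *\<^sub>v (aff 1 (- ?z) (?X ! 0) *\<^sub>v unit_vec n ?l)"
    unfolding e by (rule mult_mat_vec[OF B(1) unit_vec_carrier, symmetric])
  also have "\<dots> = (B * aff 1 (- ?z) (?X ! 0)) *\<^sub>v unit_vec n ?l"
    by (rule assoc_mult_mat_vec[OF B(1) aff_carrier[OF c(1)] unit_vec_carrier, symmetric])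
  also have "\<dots> = unit_vec n ?l" unfolding B(3) by simp
  finally have Be: "of_real (1 - t\<^sup>2) \<cdot>\<^sub>v (B *\<^sub>v unit_vec n ?l) = unit_vec n ?l" .
  have Xe: "?X ! 1 *\<^sub>v unit_vec n l = of_real (t * ?s) \<cdot>\<^sub>v unit_vec n ?l"
    unfolding node_1[OF d] smult_mat_mult_vec[OF shift_carrier unit_vec_carrier] shift_unit_vec[OF l] ..
  have BX: "B * ?X ! 1 \<in> carrier_mat n n" using B(1) c(2) by (rule mult_carrier_mat)
  have "raise n t (Suc l) ?X *\<^sub>v unit_vec n l =
      0 \<cdot>\<^sub>v unit_vec n l + of_real ?s \<cdot>\<^sub>v (B *\<^sub>v (of_real (t * ?s) \<cdot>\<^sub>v unit_vec n ?l))"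
    unfolding raise_def B(4) aff_mult_vec[OF BX unit_vec_carrier]
      assoc_mult_mat_vec[OF B(1) c(2) unit_vec_carrier] Xe ..
  also have "\<dots> = of_real t \<cdot>\<^sub>v (of_real (1 - t\<^sup>2) \<cdot>\<^sub>v (B *\<^sub>v unit_vec n ?l))"
    unfolding mult_mat_vec[OF B(1) unit_vec_carrier]
  proof (rule eq_vecI)
    have s: "complex_of_real ?s * (complex_of_real ?s * x) = of_real (1 - t\<^sup>2) * x" for x
      using t2 by (simp add: mult.assoc[symmetric] del: of_real_diff flip: of_real_mult)
    fix a assume "a < dim_vec (of_real t \<cdot>\<^sub>v (of_real (1 - t\<^sup>2) \<cdot>\<^sub>v (B *\<^sub>v unit_vec n ?l)))"
    then have a: "a < n" using B by simp
    define y where "y = B *\<^sub>v unit_vec n ?l"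
    have y: "dim_vec y = n" using B by (simp add: y_def)
    show "(0 \<cdot>\<^sub>v unit_vec n l + of_real ?s \<cdot>\<^sub>v (of_real (t * ?s) \<cdot>\<^sub>v (B *\<^sub>v unit_vec n ?l))) $ a =
      (of_real t \<cdot>\<^sub>v (of_real (1 - t\<^sup>2) \<cdot>\<^sub>v (B *\<^sub>v unit_vec n ?l))) $ a"
      unfolding y_def[symmetric] using a y l s[of "of_real t * y $ a"]
      by (simp add: mult_ac del: of_real_diff of_real_power)
  qed (use B in simp)
  finally show ?thesis unfolding Be .
qed

section \<open>Moving along the cycle of eigenvectors\<close>

primrec climb :: "nat \<Rightarrow> real \<Rightarrow> nat \<Rightarrow> complex mat list \<Rightarrow> complex mat" where
  "climb n t 0 X = 1\<^sub>m (dim_row (X ! 0))"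
| "climb n t (Suc i) X = raise n t (Suc i) X * climb n t i X"

text \<open>The shift moves in one direction only, so a vector returns to the index 0 by going
  upwards around the rest of the cycle. The parameter counts the steps that remain until the
  wrap-around.\<close>

primrec descend :: "nat \<Rightarrow> real \<Rightarrow> nat \<Rightarrow> complex mat list \<Rightarrow> complex mat" where
  "descend n t 0 X = 1\<^sub>m (dim_row (X ! 0))"
| "descend n t (Suc k) X = descend n t k X * raise n t (n - k) X"

lemma nc_bounded_climb:
  assumes "2 \<le> d" "0 < t" "t < 1"
  shows "nc_bounded d 1 (climb n t i)"
proof (induction i)
  case 0
  show ?case using nc_bounded_pow[of d 0] assms by simp
next
  case (Suc i)
  have "nc_bounded d 1 (\<lambda>X. raise n t (Suc i) X * climb n t i X)"
    using nc_bounded_mult[OF nc_bounded_raise[OF assms] Suc] by simp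
  then show ?case by (simp only: climb.simps)
qed

lemma nc_bounded_descend:
  assumes "2 \<le> d" "0 < t" "t < 1"
  shows "nc_bounded d 1 (descend n t k)"
proof (induction k)
  case 0
  show ?case using nc_bounded_pow[of d 0] assms by simp
next
  case (Suc k)
  have "nc_bounded d 1 (\<lambda>X. descend n t k X * raise n t (n - k) X)"
    using nc_bounded_mult[OF Suc nc_bounded_raise[OF assms]] by simp
  then show ?case by (simp only: descend.simps)
qed

lemma climb_node:
  assumes d: "2 \<le> d" and n: "1 \<le> n" and t: "0 < t" "t < 1" and i: "i < n"
  shows "climb n t i (node d n t) *\<^sub>v unit_vec n 0 = of_real t ^ i \<cdot>\<^sub>v unit_vec n i"
  using i
proof (induction i)
  case 0
  then show ?case using clock_carrier[of n] by simp
next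
  case (Suc i)
  have d1: "1 \<le> d" using d by simp
  note X = node_in_row_ball[OF d1 t, of n]
  have c: "raise n t (Suc i) (node d n t) \<in> carrier_mat n n" "climb n t i (node d n t) \<in> carrier_mat n n"
    using bnd_carrier[OF nc_boundedD[OF nc_bounded_raise[OF d t] n X]]
      bnd_carrier[OF nc_boundedD[OF nc_bounded_climb[OF d t] n X]] by auto
  have "climb n t (Suc i) (node d n t) *\<^sub>v unit_vec n 0 =
      raise n t (Suc i) (node d n t) *\<^sub>v (of_real t ^ i \<cdot>\<^sub>v unit_vec n i)"
    using Suc assoc_mult_mat_vec[OF c unit_vec_carrier, of 0] by simp
  also have "\<dots> = of_real t ^ i \<cdot>\<^sub>v (of_real t \<cdot>\<^sub>v unit_vec n (Suc i mod n))"
    using Suc raise_node[OF d n t, of i] mult_mat_vec[OF c(1) unit_vec_carrier] by simp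
  also have "\<dots> = of_real t ^ Suc i \<cdot>\<^sub>v unit_vec n (Suc i)"
    using Suc by (simp add: smult_smult_assoc mult.commute)
  finally show ?case .
qed

text \<open>The reduction modulo \<open>n\<close> concerns \<open>k = 0\<close>, where no step is
  made and the start is the index 0. The case \<open>k = n\<close> also starts there, but makes a
  full turn.\<close>

lemma descend_node:
  assumes d: "2 \<le> d" and n: "1 \<le> n" and t: "0 < t" "t < 1" and k: "k \<le> n"
  shows "descend n t k (node d n t) *\<^sub>v unit_vec n ((n - k) mod n) = of_real t ^ k \<cdot>\<^sub>v unit_vec n 0"
  using k
proof (induction k)
  case 0
  then show ?case using clock_carrier[of n] by simp
next
  case (Suc k)
  have d1: "1 \<le> d" using d by simp
  note X = node_in_row_ball[OF d1 t, of n]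
  have c: "raise n t (n - k) (node d n t) \<in> carrier_mat n n" "descend n t k (node d n t) \<in> carrier_mat n n"
    using bnd_carrier[OF nc_boundedD[OF nc_bounded_raise[OF d t] n X]]
      bnd_carrier[OF nc_boundedD[OF nc_bounded_descend[OF d t] n X]] by auto
  define l where "l = n - Suc k"
  have l: "l < n" "(n - Suc k) mod n = l" "Suc l = n - k" using Suc by (auto simp: l_def)
  have "descend n t (Suc k) (node d n t) *\<^sub>v unit_vec n l =
      descend n t k (node d n t) *\<^sub>v (raise n t (Suc l) (node d n t) *\<^sub>v unit_vec n l)"
    using assoc_mult_mat_vec[OF c(2,1) unit_vec_carrier] l by simp
  also have "\<dots> = of_real t \<cdot>\<^sub>v (descend n t k (node d n t) *\<^sub>v unit_vec n ((n - k) mod n))"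
    unfolding raise_node[OF d n t l(1)] mult_mat_vec[OF c(2) unit_vec_carrier]
    unfolding l(3) ..
  also have "\<dots> = of_real t ^ Suc k \<cdot>\<^sub>v unit_vec n 0"
    using Suc by (simp add: smult_smult_assoc)
  finally show ?case unfolding l(2) .
qed

lemma nc_function_dft_proj:
  assumes "1 \<le> d"
  shows "nc_function d (\<lambda>X. dft_proj n t w (X ! 0) j)"
proof -
  have "nc_function d (\<lambda>X. z \<cdot>\<^sub>m (X ! 0) ^\<^sub>m k)" for z k
    by (rule nc_function_smult[OF nc_bounded_nc[OF nc_bounded_pow[OF assms]]])
  then show ?thesis unfolding dft_proj_def by (intro nc_function_msum assms)
qed

text \<open>Only the dimension \<open>d \<ge> 2\<close> needs work. The functions \<open>A i\<close> send \<open>e\<^sub>0\<close> to \<open>e\<^sub>i\<close> and the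
  functions \<open>B j\<close> have the matrix unit \<open>e\<^sub>0 e\<^sub>j\<^sup>*\<close> as value at the node, so
  \<open>\<Sum> Y\<^sub>i\<^sub>j A i B j\<close> takes exactly the value \<open>Y\<close> there. The discrete Fourier projections make
  \<open>A\<close> a row and \<open>B\<close> a column of norm at most \<open>t\<^sup>-\<^sup>2\<^sup>n\<close>.\<close>

lemma single_node_interpolation:
  assumes d: "1 \<le> d" and n: "1 \<le> n" and t: "0 < t" "t < 1"
    and Y: "bnd n r Y" and triv: "d = 1 \<Longrightarrow> n = 1 \<or> Y = 0\<^sub>m n n"
    and \<mu>: "r / t ^ (4 * n) \<le> \<mu>"
  obtains h where "nc_bounded d \<mu> h" "h (node d n t) = Y"
proof (cases "d = 1")
  case True
  note Yc = bnd_carrier[OF Y]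
  \<comment> \<open>With one coordinate the target is a 1 by 1 matrix or zero, hence a multiple of
    the identity, and a constant function takes it.\<close>
  define y where "y = Y $$ (0, 0)"
  have r0: "0 \<le> r" using bnd_nonneg[OF Y] .
  have "r \<le> r / t ^ (4 * n)" using t r0 by (simp add: pos_le_divide_eq mult_left_le power_le_one)
  moreover have "cmod y \<le> r" unfolding y_def using bnd_entry[OF Y] n by simp
  ultimately have "cmod y \<le> \<mu>" using \<mu> by linarith
  then have "nc_bounded d \<mu> (\<lambda>X. aff y 0 (X ! 0))"
    using nc_bounded_const[OF d, of y] by (auto simp: nc_bounded_def intro: bnd_mono)
  moreover have "aff y 0 (node d n t ! 0) = Y"
  proof -
    have "aff y 0 (node d n t ! 0) = y \<cdot>\<^sub>m 1\<^sub>m n"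
      using clock_carrier[of n] by (intro eq_matI) (auto simp: aff_def)
    also have "\<dots> = Y" using triv[OF True] Yc n by (auto simp: y_def intro!: eq_matI)
    finally show ?thesis .
  qed
  ultimately show thesis using that by blast
next
  case False
  then have d2: "2 \<le> d" using d by simp
  note Yc = bnd_carrier[OF Y]
  let ?w = "cnj (root1 n)"
  \<comment> \<open>The projection is the outer factor in both products, on the left in A and on the
    right in B. The contractions \<open>climb\<close> and \<open>descend\<close> then drop out of
    the row and column estimates. For \<open>j = 0\<close> the function B makes a full turn, so its
    normalising factor is t^(-n), the largest that occurs.\<close>
  define A where "A i X = (1 / of_real t ^ i) \<cdot>\<^sub>m (dft_proj n t ?w (X ! 0) i * climb n t i X)" for i X
  define B where "B j X = (1 / of_real t ^ (n - j)) \<cdot>\<^sub>m (descend n t (n - j) X * dft_proj n t ?w (X ! 0) j)" for j X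
  define h where "h X = msum (X ! 0) (\<lambda>i. msum (X ! 0) (\<lambda>j. Y $$ (i, j) \<cdot>\<^sub>m (A i X * B j X)) n) n" for X
  have ncA: "nc_function d (A i)" and ncB: "nc_function d (B i)" for i
    unfolding A_def[abs_def] B_def[abs_def]
    by (intro nc_function_smult nc_function_mult nc_function_dft_proj d
        nc_bounded_nc[OF nc_bounded_climb[OF d2 t]] nc_bounded_nc[OF nc_bounded_descend[OF d2 t]])+
  have nch: "nc_function d h"
    unfolding h_def[abs_def] by (intro nc_function_msum nc_function_smult nc_function_mult ncA ncB d)
  have bh: "bnd m \<mu> (h X)" if m: "1 \<le> m" and X: "X \<in> row_ball_level d m" for m X
  proof -
    have X0: "bnd m 1 (X ! 0)" using nc_boundedD[OF nc_bounded_first[OF d] m X] .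
    note X0c = bnd_carrier[OF X0]
    have cl: "bnd m 1 (climb n t i X)" and de: "bnd m 1 (descend n t i X)" for i
      using nc_boundedD[OF nc_bounded_climb[OF d2 t] m X] nc_boundedD[OF nc_bounded_descend[OF d2 t] m X] by auto
    note clc = bnd_carrier[OF cl] and dec = bnd_carrier[OF de]
    have Ac: "A i X \<in> carrier_mat m m" and Bc: "B i X \<in> carrier_mat m m" for i
      using nc_function_carrier[OF ncA m X] nc_function_carrier[OF ncB m X] by auto
    \<comment> \<open>The projections cost t^(-n) and the normalisation at most another t^(-n). This
      happens once in the row and once in the column, which explains the exponent
      \<open>4 * n\<close> in the hypothesis on \<open>\<mu>\<close>.\<close>
    have scale: "(\<Sum>i<n. (x i / t ^ e i)\<^sup>2) \<le> (1 / t ^ (2 * n) * y)\<^sup>2"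
      if le: "(\<Sum>i<n. (x i)\<^sup>2) \<le> (y / t ^ n)\<^sup>2" and e: "\<And>i. i < n \<Longrightarrow> e i \<le> n"
      for x :: "nat \<Rightarrow> real" and y :: real and e
    proof -
      have "(\<Sum>i<n. (x i / t ^ e i)\<^sup>2) \<le> (\<Sum>i<n. (x i)\<^sup>2 / (t ^ n)\<^sup>2)"
        unfolding power_divide
      proof (intro sum_mono divide_left_mono power_mono power_decreasing)
        fix i show "0 < (t ^ e i)\<^sup>2 * (t ^ n)\<^sup>2" using t by simp
      qed (use e t in auto)
      also have "\<dots> \<le> (y / t ^ n)\<^sup>2 / (t ^ n)\<^sup>2"
        using le by (simp add: divide_right_mono flip: sum_divide_distrib)
      also have "\<dots> = (1 / t ^ (2 * n) * y)\<^sup>2"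
        by (simp add: power_divide power_mult_distrib power2_eq_square mult_2 power_add)
      finally show ?thesis .
    qed
    have "bnd m (1 / t ^ (2 * n) * r * (1 / t ^ (2 * n))) (h X)"
      unfolding h_def
    proof (rule bnd_bilinear_sum[OF X0c Y Ac Bc])
      fix u :: "complex vec" assume u: "u \<in> carrier_vec m"
      let ?x = "\<lambda>i. vec_l2 (dft_proj n t (root1 n) (mat_adjoint (X ! 0)) i *\<^sub>v u)"
      have "(vec_l2 (mat_adjoint (A i X) *\<^sub>v u))\<^sup>2 \<le> (?x i / t ^ i)\<^sup>2" for i
      proof -
        define P where "P = dft_proj n t ?w (X ! 0) i"
        have Pc: "P \<in> carrier_mat m m" unfolding P_def by (rule dft_proj_carrier[OF X0c])
        have adP: "mat_adjoint P = dft_proj n t (root1 n) (mat_adjoint (X ! 0)) i"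
          unfolding P_def adjoint_dft_proj[OF X0c] by simp
        note c = adjoint_carrier[OF clc[of i]] adjoint_carrier[OF Pc]
        have "mat_adjoint (A i X) *\<^sub>v u =
            cnj (1 / of_real t ^ i) \<cdot>\<^sub>v (mat_adjoint (climb n t i X) *\<^sub>v (mat_adjoint P *\<^sub>v u))"
          unfolding A_def P_def[symmetric] adjoint_smult adjoint_mult[OF Pc clc]
            smult_mat_mult_vec[OF mult_carrier_mat[OF c] u] assoc_mult_mat_vec[OF c u] ..
        then have "vec_l2 (mat_adjoint (A i X) *\<^sub>v u) =
            vec_l2 (mat_adjoint (climb n t i X) *\<^sub>v (mat_adjoint P *\<^sub>v u)) / t ^ i"
          using t by (simp only: vec_l2_smult) (simp add: norm_divide norm_power)
        also have "\<dots> \<le> ?x i / t ^ i"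
          using bndD[OF bnd_adjoint[OF cl] mult_mat_vec_carrier[OF c(2) u], of i] t
          by (intro divide_right_mono) (simp_all add: adP)
        finally show ?thesis by (intro power_mono) auto
      qed
      then have "(\<Sum>i<n. (vec_l2 (mat_adjoint (A i X) *\<^sub>v u))\<^sup>2) \<le> (\<Sum>i<n. (?x i / t ^ i)\<^sup>2)"
        by (intro sum_mono)
      also have "\<dots> \<le> (1 / t ^ (2 * n) * vec_l2 u)\<^sup>2"
        by (intro scale dft_proj_column[OF bnd_adjoint[OF X0] n t u]) auto
      finally show "(\<Sum>i<n. (vec_l2 (mat_adjoint (A i X) *\<^sub>v u))\<^sup>2) \<le> (1 / t ^ (2 * n) * vec_l2 u)\<^sup>2" .
    next
      fix v :: "complex vec" assume v: "v \<in> carrier_vec m"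
      let ?x = "\<lambda>j. vec_l2 (dft_proj n t ?w (X ! 0) j *\<^sub>v v)"
      have "(vec_l2 (B j X *\<^sub>v v))\<^sup>2 \<le> (?x j / t ^ (n - j))\<^sup>2" for j
      proof -
        note Pc = dft_proj_carrier[OF X0c, of n t ?w j]
        have "B j X *\<^sub>v v =
            (1 / of_real t ^ (n - j)) \<cdot>\<^sub>v (descend n t (n - j) X *\<^sub>v (dft_proj n t ?w (X ! 0) j *\<^sub>v v))"
          unfolding B_def smult_mat_mult_vec[OF mult_carrier_mat[OF dec Pc] v] assoc_mult_mat_vec[OF dec Pc v] ..
        then have "vec_l2 (B j X *\<^sub>v v) =
            vec_l2 (descend n t (n - j) X *\<^sub>v (dft_proj n t ?w (X ! 0) j *\<^sub>v v)) / t ^ (n - j)"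
          using t by (simp only: vec_l2_smult) (simp add: norm_divide norm_power)
        also have "\<dots> \<le> ?x j / t ^ (n - j)"
          using bndD[OF de mult_mat_vec_carrier[OF Pc v], of "n - j"] t
          by (intro divide_right_mono) simp_all
        finally show ?thesis by (intro power_mono) auto
      qed
      then have "(\<Sum>j<n. (vec_l2 (B j X *\<^sub>v v))\<^sup>2) \<le> (\<Sum>j<n. (?x j / t ^ (n - j))\<^sup>2)"
        by (intro sum_mono)
      also have "\<dots> \<le> (1 / t ^ (2 * n) * vec_l2 v)\<^sup>2"
        by (intro scale dft_proj_column[OF X0 n t v]) auto
      finally show "(\<Sum>j<n. (vec_l2 (B j X *\<^sub>v v))\<^sup>2) \<le> (1 / t ^ (2 * n) * vec_l2 v)\<^sup>2" .
    qed (use t in auto)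
    moreover have "1 / t ^ (2 * n) * r * (1 / t ^ (2 * n)) \<le> \<mu>"
      using \<mu> by (simp flip: power_add)
    ultimately show ?thesis by (rule bnd_mono)
  qed
  have "h (node d n t) = Y"
  proof (rule mat_eq_unit_vecI[OF _ Yc])
    let ?X = "node d n t"
    note X = node_in_row_ball[OF d t, of n]
    show "h ?X \<in> carrier_mat n n" using nc_function_carrier[OF nch n X] .
    have X0c: "?X ! 0 \<in> carrier_mat n n" using row_ball_level_nth[OF X, of 0] d by (simp del: node_0)
    have Ac: "A i ?X \<in> carrier_mat n n" and Bc: "B i ?X \<in> carrier_mat n n" for i
      using nc_function_carrier[OF ncA n X] nc_function_carrier[OF ncB n X] by auto
    have clc: "climb n t i ?X \<in> carrier_mat n n" and dec: "descend n t i ?X \<in> carrier_mat n n" for i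
      using bnd_carrier[OF nc_boundedD[OF nc_bounded_climb[OF d2 t] n X]]
        bnd_carrier[OF nc_boundedD[OF nc_bounded_descend[OF d2 t] n X]] by auto
    note Pc = dft_proj_carrier[OF X0c]
    have tt: "(1 / of_real t ^ i) * of_real t ^ i = (1 :: complex)" for i using t by simp
    have A0: "A i ?X *\<^sub>v unit_vec n 0 = unit_vec n i" if i: "i < n" for i
    proof -
      have "A i ?X *\<^sub>v unit_vec n 0 = (1 / of_real t ^ i) \<cdot>\<^sub>v (of_real t ^ i \<cdot>\<^sub>v unit_vec n i)"
        unfolding A_def smult_mat_mult_vec[OF mult_carrier_mat[OF Pc clc] unit_vec_carrier]
          assoc_mult_mat_vec[OF Pc clc unit_vec_carrier] climb_node[OF d2 n t i]
          mult_mat_vec[OF Pc unit_vec_carrier]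
        unfolding node_0 dft_proj_clock[OF t(1) i i] if_P[OF refl] ..
      then show ?thesis by (simp only: smult_smult_assoc tt one_smult_vec)
    qed
    fix k assume k: "k < n"
    have Bk: "B j ?X *\<^sub>v unit_vec n k = (if j = k then unit_vec n 0 else 0\<^sub>v n)" if j: "j < n" for j
    proof (cases "j = k")
      case True
      have "descend n t (n - k) ?X *\<^sub>v unit_vec n k = of_real t ^ (n - k) \<cdot>\<^sub>v unit_vec n 0"
        using descend_node[OF d2 n t, of "n - k"] k by simp
      then have "B j ?X *\<^sub>v unit_vec n k = (1 / of_real t ^ (n - k)) \<cdot>\<^sub>v (of_real t ^ (n - k) \<cdot>\<^sub>v unit_vec n 0)"
        unfolding B_def smult_mat_mult_vec[OF mult_carrier_mat[OF dec Pc] unit_vec_carrier]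
          assoc_mult_mat_vec[OF dec Pc unit_vec_carrier] 
        unfolding node_0 dft_proj_clock[OF t(1) k j] using True by simp
      then show ?thesis using True by (simp only: smult_smult_assoc tt one_smult_vec if_True refl)
    next
      case False
      have "descend n t (n - j) ?X *\<^sub>v 0\<^sub>v n = 0\<^sub>v n" by (rule mult_mat_zero_vec[OF dec])
      then have "B j ?X *\<^sub>v unit_vec n k = (1 / of_real t ^ (n - j)) \<cdot>\<^sub>v 0\<^sub>v n"
        unfolding B_def smult_mat_mult_vec[OF mult_carrier_mat[OF dec Pc] unit_vec_carrier]
          assoc_mult_mat_vec[OF dec Pc unit_vec_carrier] 
        unfolding node_0 dft_proj_clock[OF t(1) k j] using False by simp
      then show ?thesis using False by (simp only: if_False) (auto intro!: eq_vecI)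
    qed
    have AB: "A i ?X * B j ?X \<in> carrier_mat n n" for i j using Ac Bc by (rule mult_carrier_mat)
    have sAB: "Y $$ (i, j) \<cdot>\<^sub>m (A i ?X * B j ?X) \<in> carrier_mat n n" for i j
      using AB by (rule smult_carrier_mat)
    show "h ?X *\<^sub>v unit_vec n k = Y *\<^sub>v unit_vec n k"
    proof (rule eq_vecI)
      fix a assume "a < dim_vec (Y *\<^sub>v unit_vec n k)"
      then have a: "a < n" using Yc by simp
      have "(h ?X *\<^sub>v unit_vec n k) $ a =
          (\<Sum>i<n. (msum (?X ! 0) (\<lambda>j. Y $$ (i, j) \<cdot>\<^sub>m (A i ?X * B j ?X)) n *\<^sub>v unit_vec n k) $ a)"
        unfolding h_def by (rule msum_mult_vec_index[OF X0c unit_vec_carrier a msum_carrier[OF X0c sAB]])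
      also have "\<dots> = (\<Sum>i<n. \<Sum>j<n. (Y $$ (i, j) \<cdot>\<^sub>m (A i ?X * B j ?X) *\<^sub>v unit_vec n k) $ a)"
        by (intro sum.cong refl msum_mult_vec_index[OF X0c unit_vec_carrier a sAB])
      also have "\<dots> = (\<Sum>i<n. \<Sum>j<n. if j = k then Y $$ (i, k) * unit_vec n i $ a else 0)"
      proof (intro sum.cong refl)
        fix i j assume ij: "i \<in> {..<n}" "j \<in> {..<n}"
        have z: "A i ?X *\<^sub>v 0\<^sub>v n = 0\<^sub>v n" by (rule mult_mat_zero_vec[OF Ac])
        show "(Y $$ (i, j) \<cdot>\<^sub>m (A i ?X * B j ?X) *\<^sub>v unit_vec n k) $ a =
            (if j = k then Y $$ (i, k) * unit_vec n i $ a else 0)"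
          unfolding smult_mat_mult_vec[OF AB unit_vec_carrier] assoc_mult_mat_vec[OF Ac Bc unit_vec_carrier]
          using ij a by (simp add: Bk A0 z del: index_mult_mat_vec)
      qed
      also have "\<dots> = (\<Sum>i<n. if i = a then Y $$ (a, k) else 0)"
        using k a by (intro sum.cong refl) (auto simp: sum.delta)
      also have "\<dots> = (Y *\<^sub>v unit_vec n k) $ a"
        using a k Yc unfolding mult_mat_unit_vec[OF Yc k] by simp
      finally show "(h ?X *\<^sub>v unit_vec n k) $ a = (Y *\<^sub>v unit_vec n k) $ a" .
    qed (use nc_function_carrier[OF nch n X] Yc in auto)
  qed
  then show thesis using that[of h] nch bh by (simp add: nc_bounded_def)
qed

subsection \<open>Adding a point\<close>

abbreviation peak :: "real \<Rightarrow> complex mat \<Rightarrow> complex mat" where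
  "peak \<alpha> A \<equiv> aff (1/2) (- 1 / (2 * of_real \<alpha>)) (mob \<alpha> A)"

text \<open>This is 1 minus the peak, written as an affine function of the Moebius transform so that
  \<open>bnd_glue\<close> applies with E = M / \<alpha>.\<close>

abbreviation copeak :: "real \<Rightarrow> complex mat \<Rightarrow> complex mat" where
  "copeak \<alpha> A \<equiv> aff (1/2) (1 / (2 * of_real \<alpha>)) (mob \<alpha> A)"

definition glue :: "real \<Rightarrow> complex mat \<Rightarrow> complex mat \<Rightarrow> complex mat \<Rightarrow> complex mat" where
  "glue \<alpha> A F H = copeak \<alpha> A * F * copeak \<alpha> A + peak \<alpha> A * H * peak \<alpha> A"

lemma nc_bounded_glue:
  assumes f: "nc_bounded d 1 \<psi>" and F: "nc_bounded d \<mu> F" and H: "nc_bounded d \<mu> H"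
    and a: "0 < \<alpha>" "\<alpha> < 1" and \<mu>': "\<mu> * ((1 + (1 / \<alpha>)\<^sup>2) / 2) = \<mu>'"
  shows "nc_bounded d \<mu>' (\<lambda>X. glue \<alpha> (\<psi> X) (F X) (H X))"
proof -
  have M: "nc_bounded d 1 (\<lambda>X. mob \<alpha> (\<psi> X))" using nc_bounded_mob[OF f] a by simp
  have "bnd m \<mu>' (glue \<alpha> (\<psi> X) (F X) (H X))" if m: "1 \<le> m" and X: "X \<in> row_ball_level d m" for m X
  proof -
    let ?E = "(1 / of_real \<alpha>) \<cdot>\<^sub>m mob \<alpha> (\<psi> X)"
    have E: "bnd m (1 / \<alpha>) ?E"
      using bnd_smult[OF nc_boundedD[OF M m X], of "1 / of_real \<alpha>"] a by (simp add: norm_divide)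
    have "aff (1/2) (1/2) ?E = copeak \<alpha> (\<psi> X)" "aff (1/2) (-1/2) ?E = peak \<alpha> (\<psi> X)"
      unfolding aff_def by (auto intro!: eq_matI)
    then show ?thesis
      using bnd_glue[OF E nc_boundedD[OF F m X] nc_boundedD[OF H m X]] unfolding glue_def \<mu>' by simp
  qed
  moreover have "nc_function d (\<lambda>X. glue \<alpha> (\<psi> X) (F X) (H X))"
    unfolding glue_def
    by (intro nc_function_add nc_function_mult nc_function_aff nc_bounded_nc[OF M]
        nc_bounded_nc[OF F] nc_bounded_nc[OF H])
  ultimately show ?thesis by (simp add: nc_bounded_def)
qed

lemma mult_scalar_mat: "B \<in> carrier_mat m m \<Longrightarrow> B * (z \<cdot>\<^sub>m 1\<^sub>m m) = z \<cdot>\<^sub>m (B :: complex mat)"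
  by (simp add: mult_smult_distrib[of _ m m _ m])

text \<open>Where \<open>\<psi>\<close> vanishes the Moebius transform equals
  \<open>\<alpha>\<close>, so the peak is 0 and the old value survives.\<close>

lemma glue_zero:
  assumes c: "F \<in> carrier_mat m m" "H \<in> carrier_mat m m" and a: "0 < \<alpha>" "\<alpha> < 1"
  shows "glue \<alpha> (0 \<cdot>\<^sub>m 1\<^sub>m m) F H = F"
proof -
  have M: "mob \<alpha> (0 \<cdot>\<^sub>m 1\<^sub>m m) = of_real \<alpha> \<cdot>\<^sub>m 1\<^sub>m m" using mob_scalar[of 0 \<alpha> m] a by simp
  have "copeak \<alpha> (0 \<cdot>\<^sub>m 1\<^sub>m m) = 1 \<cdot>\<^sub>m 1\<^sub>m m" "peak \<alpha> (0 \<cdot>\<^sub>m 1\<^sub>m m) = 0 \<cdot>\<^sub>m 1\<^sub>m m"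
    unfolding M aff_one using a by simp_all
  then show ?thesis
    unfolding glue_def using c by (auto simp: scalar_mat_mult mult_scalar_mat intro!: eq_matI)
qed

text \<open>The Moebius transform sends \<open>2 \<alpha> / (1 + \<alpha>\<^sup>2)\<close> to \<open>- \<alpha>\<close>, where the peak is \<open>1\<close>.\<close>

lemma glue_one:
  assumes c: "F \<in> carrier_mat m m" "H \<in> carrier_mat m m" and a: "0 < \<alpha>" "\<alpha> < 1"
    and b: "b = 2 * \<alpha> / (1 + \<alpha>\<^sup>2)"
  shows "glue \<alpha> (of_real b \<cdot>\<^sub>m 1\<^sub>m m) F H = H"
proof -
  have p: "1 + \<alpha>\<^sup>2 > 0" by (simp add: add_pos_nonneg)
  have "2 * \<alpha> \<le> 1 + \<alpha>\<^sup>2" using zero_le_power2[of "1 - \<alpha>"] by (simp add: power2_eq_square algebra_simps)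
  then have b1: "0 \<le> b" "b \<le> 1" using a p by (auto simp: b)
  have "1 - \<alpha> * b = (1 - \<alpha>\<^sup>2) / (1 + \<alpha>\<^sup>2)" "\<alpha> - b = - \<alpha> * ((1 - \<alpha>\<^sup>2) / (1 + \<alpha>\<^sup>2))"
    using p unfolding b by (simp_all add: field_simps power2_eq_square)
  moreover have "\<alpha>\<^sup>2 < 1" using a by (simp add: power_less_one_iff)
  ultimately have "(\<alpha> - b) / (1 - \<alpha> * b) = - \<alpha>" using p by simp
  then have "(of_real \<alpha> - of_real b) / (1 - of_real \<alpha> * of_real b) = - complex_of_real \<alpha>"
    by (metis of_real_1 of_real_diff of_real_divide of_real_minus of_real_mult)
  then have M: "mob \<alpha> (of_real b \<cdot>\<^sub>m 1\<^sub>m m) = - of_real \<alpha> \<cdot>\<^sub>m 1\<^sub>m m"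
    using mob_scalar[of "of_real b" \<alpha> m] a b1 by simp
  have "copeak \<alpha> (of_real b \<cdot>\<^sub>m 1\<^sub>m m) = 0 \<cdot>\<^sub>m 1\<^sub>m m" "peak \<alpha> (of_real b \<cdot>\<^sub>m 1\<^sub>m m) = 1 \<cdot>\<^sub>m 1\<^sub>m m"
    unfolding M aff_one using a by simp_all
  then show ?thesis
    unfolding glue_def using c by (auto simp: scalar_mat_mult mult_scalar_mat intro!: eq_matI)
qed

text \<open>With Q the peak, the change is Q F Q + Q H Q - Q F - F Q. Every term contains Q, which
  is small wherever \<open>\<psi>\<close> is small. Entries are compared because the limit is taken
  entrywise.\<close>

lemma glue_close:
  assumes A: "bnd m s A" and s: "s < 1" and F: "bnd m 1 F" and H: "bnd m 1 H"
    and a: "1 / 2 \<le> \<alpha>" "\<alpha> < 1" and ij: "i < m" "j < m"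
  shows "cmod (glue \<alpha> A F H $$ (i, j) - F $$ (i, j)) \<le> 2 * (s / (1 - s)) * (1 + s / (1 - s))"
proof -
  let ?P = "peak \<alpha> A"
  let ?c = "s / (1 - s)"
  have s0: "0 \<le> s" using bnd_nonneg[OF A] .
  have as: "\<alpha> * s < 1" using mult_left_le_one_le[of s \<alpha>] a s s0 by simp
  have M: "mob \<alpha> A \<in> carrier_mat m m" using mob_carrier[OF A] a as by simp
  have P: "bnd m ?c ?P" by (rule bnd_peak[OF A s a])
  define Q where "Q = ?P"
  have Q: "bnd m ?c Q" unfolding Q_def by (rule P)
  note c = bnd_carrier[OF Q] bnd_carrier[OF F] bnd_carrier[OF H]
  have co: "copeak \<alpha> A = aff 1 (- 1) Q"
    unfolding Q_def aff_def using M a by (auto simp: field_simps intro!: eq_matI)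
  have left: "aff 1 (- 1) Q * G = G + - 1 \<cdot>\<^sub>m (Q * G)" if "G \<in> carrier_mat m m" for G
    unfolding aff_def using c(1) that
    by (subst add_mult_distrib_mat[of _ m m]) (auto simp: mult_smult_assoc_mat[of _ m m _ m])
  have right: "G * aff 1 (- 1) Q = G + - 1 \<cdot>\<^sub>m (G * Q)" if "G \<in> carrier_mat m m" for G
    unfolding aff_def using c(1) that
    by (subst mult_add_distrib_mat[of _ m m]) (auto simp: mult_smult_distrib[of _ m m _ m])
  have QF: "bnd m (?c * 1) (Q * F)" and FQ: "bnd m (1 * ?c) (F * Q)"
    and QFQ: "bnd m (?c * 1 * ?c) (Q * F * Q)" and QHQ: "bnd m (?c * 1 * ?c) (Q * H * Q)"
    by (intro bnd_mult Q F H)+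
  note cc = bnd_carrier[OF QF] bnd_carrier[OF FQ] bnd_carrier[OF QFQ] bnd_carrier[OF QHQ]
  have "(F + - 1 \<cdot>\<^sub>m (Q * F)) * Q = F * Q + - 1 \<cdot>\<^sub>m (Q * F * Q)"
    using c cc by (subst add_mult_distrib_mat[of _ m m]) (auto simp: mult_smult_assoc_mat[of _ m m _ m])
  then have "aff 1 (- 1) Q * F * aff 1 (- 1) Q =
      F + - 1 \<cdot>\<^sub>m (Q * F) + - 1 \<cdot>\<^sub>m (F * Q + - 1 \<cdot>\<^sub>m (Q * F * Q))"
    unfolding left[OF c(2)] using c cc by (subst right) auto
  then have "glue \<alpha> A F H = F + - 1 \<cdot>\<^sub>m (Q * F) + - 1 \<cdot>\<^sub>m (F * Q + - 1 \<cdot>\<^sub>m (Q * F * Q)) + Q * H * Q"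
    unfolding glue_def co Q_def[symmetric] by simp
  then have "glue \<alpha> A F H $$ (i, j) - F $$ (i, j) =
      (Q * F * Q) $$ (i, j) + (Q * H * Q) $$ (i, j) - (Q * F) $$ (i, j) - (F * Q) $$ (i, j)"
    using c cc ij by (simp add: carrier_matD[OF cc(1)] carrier_matD[OF cc(2)]
        carrier_matD[OF cc(3)] carrier_matD[OF cc(4)] del: index_mult_mat(1))
  also have "cmod \<dots> \<le> cmod ((Q * F * Q) $$ (i, j)) + cmod ((Q * H * Q) $$ (i, j)) +
      cmod ((Q * F) $$ (i, j)) + cmod ((F * Q) $$ (i, j))"
    by (meson add_mono norm_triangle_ineq norm_triangle_ineq4 order_refl order_trans)
  also have "\<dots> \<le> ?c * 1 * ?c + ?c * 1 * ?c + ?c * 1 + 1 * ?c"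
    using bnd_entry[OF QF ij] bnd_entry[OF FQ ij] bnd_entry[OF QFQ ij] bnd_entry[OF QHQ ij]
    by (intro add_mono)
  also have "\<dots> = 2 * ?c * (1 + ?c)" by (simp add: distrib_left)
  finally show ?thesis .
qed

section \<open>Blaschke products and the choice of parameters\<close>

primrec blaschke :: "real list \<Rightarrow> complex mat \<Rightarrow> complex mat" where
  "blaschke [] A = A"
| "blaschke (\<tau> # ts) A = mob \<tau> A * blaschke ts A"

primrec blaschke_value :: "real list \<Rightarrow> real \<Rightarrow> real" where
  "blaschke_value [] x = x"
| "blaschke_value (\<tau> # ts) x = (\<tau> - x) / (1 - \<tau> * x) * blaschke_value ts x"

lemma nc_bounded_blaschke:
  assumes "nc_bounded d 1 f" "set ts \<subseteq> {0<..<1}"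
  shows "nc_bounded d 1 (\<lambda>X. blaschke ts (f X))"
  using assms(2)
proof (induction ts)
  case (Cons \<tau> ts)
  then show ?case
    using nc_bounded_mult[OF nc_bounded_mob[OF assms(1), of \<tau>]] by fastforce
qed (use assms(1) in simp)

text \<open>The product ends with the factor \<open>A\<close> and not with 1, that is, it has an
  additional zero at 0. As in the Schwarz lemma, it therefore inherits the bound \<open>s\<close> of
  its argument, not merely the bound 1.\<close>

lemma bnd_blaschke:
  assumes "bnd m s A" "s \<le> 1" "set ts \<subseteq> {0<..<1}"
  shows "bnd m s (blaschke ts A)"
  using assms(3)
proof (induction ts)
  case (Cons \<tau> ts)
  have "bnd m 1 (mob \<tau> A)" using Cons.prems bnd_mono[OF assms(1,2)] by (intro bnd_mob) auto
  then show ?case using bnd_mult[of m 1 "mob \<tau> A" s] Cons by simp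
qed (use assms(1) in simp)

lemma blaschke_scalar:
  assumes "0 \<le> x" "x \<le> 1" "set ts \<subseteq> {0<..<1}"
  shows "blaschke ts (of_real x \<cdot>\<^sub>m 1\<^sub>m m) = of_real (blaschke_value ts x) \<cdot>\<^sub>m 1\<^sub>m m"
  using assms(3)
proof (induction ts)
  case (Cons \<tau> ts)
  then show ?case using assms(1,2)
    by (auto simp: mob_scalar scalar_mat_mult intro!: eq_matI)
qed simp

lemma blaschke_value_zero: "x \<in> set ts \<Longrightarrow> blaschke_value ts x = 0"
  by (induction ts) auto

text \<open>Each factor has modulus 1 at the boundary point 1. So however many old zeros there are,
  a new node close enough to the boundary sees a value of modulus almost 1.\<close>

lemma blaschke_value_limit:
  "set ts \<subseteq> {0<..<1} \<Longrightarrow> ((\<lambda>x. \<bar>blaschke_value ts x\<bar>) \<longlongrightarrow> 1) (at_left 1)"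
proof (induction ts)
  case Nil
  have "((\<lambda>x::real. \<bar>x\<bar>) \<longlongrightarrow> \<bar>1\<bar>) (at_left 1)" by (intro tendsto_intros)
  then show ?case by simp
next
  case (Cons \<tau> ts)
  then have \<tau>: "0 < \<tau>" "\<tau> < 1" by auto
  have "((\<lambda>x. \<bar>(\<tau> - x) / (1 - \<tau> * x)\<bar> * \<bar>blaschke_value ts x\<bar>) \<longlongrightarrow> \<bar>(\<tau> - 1) / (1 - \<tau> * 1)\<bar> * 1) (at_left 1)"
    using Cons \<tau> by (intro tendsto_intros) auto
  moreover have "\<bar>(\<tau> - 1) / (1 - \<tau> * 1)\<bar> = 1" using \<tau> by simp
  ultimately show ?case by (simp only: blaschke_value.simps abs_mult mult_1)
qed

text \<open>Both demands are met as \<open>t\<close> increases to 1: the cost of one-point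
  interpolation tends to 1, and so does the modulus of the Blaschke product. The strict inequalities
  \<open>\<rho> < \<mu>\<close> and \<open>b < 1\<close> leave the room.\<close>

lemma exists_node_parameter:
  assumes L: "1 \<le> L" and \<rho>: "0 \<le> \<rho>" "\<rho> < \<mu>" and b: "b < 1" and ts: "set ts \<subseteq> {0<..<1}"
  shows "\<exists>t. 0 < t \<and> t < 1 \<and> \<rho> / t ^ (4 * n) \<le> \<mu> \<and> b \<le> \<bar>blaschke_value ts (t ^ L)\<bar>"
proof -
  have "((\<lambda>t::real. \<rho> / t ^ (4 * n)) \<longlongrightarrow> \<rho> / 1 ^ (4 * n)) (at_left 1)"
    by (intro tendsto_intros) auto
  then have 1: "eventually (\<lambda>t. \<rho> / t ^ (4 * n) < \<mu>) (at_left 1)"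
    using \<rho> by (auto dest: order_tendstoD(2))
  have 0: "eventually (\<lambda>t::real. t \<in> {0<..<1}) (at_left 1)"
    by (rule eventually_at_left_real) simp
  have "filterlim (\<lambda>t::real. t ^ L) (at_left 1) (at_left 1)"
    unfolding filterlim_at
  proof (intro conjI)
    have "((\<lambda>t::real. t ^ L) \<longlongrightarrow> 1 ^ L) (at_left 1)" by (intro tendsto_intros)
    then show "((\<lambda>t::real. t ^ L) \<longlongrightarrow> 1) (at_left 1)" by simp
    show "eventually (\<lambda>t::real. t ^ L \<in> {..<1} \<and> t ^ L \<noteq> 1) (at_left 1)"
      using 0
    proof eventually_elim
      fix t :: real assume "t \<in> {0<..<1}"
      then have "t ^ L < 1" using L power_less_one_iff[of t L] by auto
      then show "t ^ L \<in> {..<1} \<and> t ^ L \<noteq> 1" by auto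
    qed
  qed
  then have "((\<lambda>t. \<bar>blaschke_value ts (t ^ L)\<bar>) \<longlongrightarrow> 1) (at_left 1)"
    using blaschke_value_limit[OF ts] by (rule filterlim_compose[rotated])
  then have "eventually (\<lambda>t. b < \<bar>blaschke_value ts (t ^ L)\<bar>) (at_left 1)"
    using b by (rule order_tendstoD(1))
  with 0 1 have "eventually (\<lambda>t. 0 < t \<and> t < 1 \<and> \<rho> / t ^ (4 * n) \<le> \<mu> \<and> b \<le> \<bar>blaschke_value ts (t ^ L)\<bar>) (at_left 1)"
    by eventually_elim auto
  then show ?thesis by (rule eventually_happens'[OF trivial_limit_at_left_real])
qed

text \<open>The recursion runs on the list of all earlier choices, since the zeros of the next
  Blaschke product are formed from every one of them.\<close>

lemma dependent_list_choice:
  assumes "\<And>ts. set ts \<subseteq> S \<Longrightarrow> \<exists>x. x \<in> S \<and> P ts x"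
  obtains t :: "nat \<Rightarrow> 'a" where "\<And>k. t k \<in> S" "\<And>k. P (map t [0..<k]) (t k)"
proof -
  define next_elem where "next_elem ts = (SOME x. x \<in> S \<and> P ts x)" for ts
  have nx: "next_elem ts \<in> S \<and> P ts (next_elem ts)" if "set ts \<subseteq> S" for ts
    unfolding next_elem_def using assms[OF that] by (rule someI_ex)
  define l where "l = rec_nat [] (\<lambda>_ ts. ts @ [next_elem ts])"
  define t where "t k = next_elem (l k)" for k
  have l: "l 0 = []" "l (Suc k) = l k @ [t k]" for k by (simp_all add: l_def t_def)
  have lm: "l k = map t [0..<k]" for k by (induction k) (auto simp: l)
  have "set (l k) \<subseteq> S" for k
    by (induction k) (use nx in \<open>auto simp: l t_def\<close>)
  then show thesis using that[of t] nx by (metis lm t_def)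
qed

lemma exists_mob_parameter:
  assumes "1 / 2 \<le> \<mu>" "\<mu> < \<mu>'" "\<mu>' < 1"
  shows "\<exists>\<alpha>. 1 / 2 \<le> \<alpha> \<and> \<alpha> < 1 \<and> \<mu> * ((1 + (1 / \<alpha>)\<^sup>2) / 2) = (\<mu>' :: real)"
proof -
  \<comment> \<open>Solving the equation gives \<open>\<alpha> = 1 / sqrt ?y\<close>. As
    \<open>\<mu>\<close> is at least 1/2 and \<open>\<mu>'\<close> is less than 1, the ratio is
    below 2. Hence \<open>?y\<close> is at most 4, and \<open>\<alpha>\<close> is at least 1/2, as
    \<open>bnd_peak\<close> requires.\<close>
  let ?y = "2 * (\<mu>' / \<mu>) - 1"
  have y: "1 < ?y" "?y \<le> 2\<^sup>2" using assms by (auto simp: field_simps)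
  then have s: "1 < sqrt ?y" "sqrt ?y \<le> 2" by (auto intro: real_le_lsqrt)
  have "\<mu> * ((1 + (1 / (1 / sqrt ?y))\<^sup>2) / 2) = \<mu>'" using y assms by (simp add: field_simps)
  then show ?thesis using s by (intro exI[of _ "1 / sqrt ?y"]) (auto simp: field_simps)
qed

subsection \<open>The limit\<close>

text \<open>Entrywise limits suffice: at given arguments the nc identities are finite algebraic
  relations between entries.\<close>

definition mat_tendsto :: "nat \<Rightarrow> (nat \<Rightarrow> complex mat) \<Rightarrow> complex mat \<Rightarrow> bool" where
  "mat_tendsto m F A \<longleftrightarrow> (\<forall>k. F k \<in> carrier_mat m m) \<and> A \<in> carrier_mat m m \<and>
    (\<forall>i<m. \<forall>j<m. (\<lambda>k. F k $$ (i, j)) \<longlonglongrightarrow> A $$ (i, j))"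

lemma mat_tendsto_const: "A \<in> carrier_mat m m \<Longrightarrow> mat_tendsto m (\<lambda>k. A) A"
  by (simp add: mat_tendsto_def)

lemma mat_tendsto_mult:
  assumes "mat_tendsto m F A" "mat_tendsto m G B"
  shows "mat_tendsto m (\<lambda>k. F k * G k) (A * B)"
proof -
  have c: "F k \<in> carrier_mat m m" "G k \<in> carrier_mat m m" "A \<in> carrier_mat m m" "B \<in> carrier_mat m m" for k
    using assms by (auto simp: mat_tendsto_def)
  have e: "(C * D) $$ (i, j) = (\<Sum>a<m. C $$ (i, a) * D $$ (a, j))"
    if "C \<in> carrier_mat m m" "D \<in> carrier_mat m m" "i < m" "j < m" for C D :: "complex mat" and i j
    using that by (simp add: scalar_prod_def atLeast0LessThan)
  show ?thesis
    unfolding mat_tendsto_def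
  proof (intro conjI allI impI)
    fix i j assume ij: "i < m" "j < m"
    have "(\<lambda>k. \<Sum>a<m. F k $$ (i, a) * G k $$ (a, j)) \<longlonglongrightarrow> (\<Sum>a<m. A $$ (i, a) * B $$ (a, j))"
      using assms ij by (intro tendsto_sum tendsto_mult) (auto simp: mat_tendsto_def)
    then show "(\<lambda>k. (F k * G k) $$ (i, j)) \<longlonglongrightarrow> (A * B) $$ (i, j)"
      by (simp only: e[OF c(1,2) ij] e[OF c(3,4) ij])
  qed (use c in \<open>auto intro: mult_carrier_mat\<close>)
qed

lemma mat_tendsto_dsum:
  assumes "mat_tendsto m F A" "mat_tendsto n G B"
  shows "mat_tendsto (m + n) (\<lambda>k. mat_dsum (F k) (G k)) (mat_dsum A B)"
proof -
  have c: "F k \<in> carrier_mat m m" "G k \<in> carrier_mat n n" "A \<in> carrier_mat m m" "B \<in> carrier_mat n n" for k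
    using assms by (auto simp: mat_tendsto_def)
  have e: "mat_dsum C D $$ (i, j) = (if i < m then if j < m then C $$ (i, j) else 0
      else if j < m then 0 else D $$ (i - m, j - m))"
    if "C \<in> carrier_mat m m" "D \<in> carrier_mat n n" "i < m + n" "j < m + n" for C D :: "complex mat" and i j
    using that by (auto simp: mat_dsum_def)
  show ?thesis
    unfolding mat_tendsto_def
  proof (intro conjI allI impI)
    fix i j assume ij: "i < m + n" "j < m + n"
    show "(\<lambda>k. mat_dsum (F k) (G k) $$ (i, j)) \<longlonglongrightarrow> mat_dsum A B $$ (i, j)"
      using assms ij unfolding e[OF c(1,2) ij] e[OF c(3,4) ij] mat_tendsto_def by auto
  qed (use c in \<open>auto intro: mat_dsum_carrier\<close>)
qed

lemma mat_tendsto_unique: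
  assumes "mat_tendsto m F A" "mat_tendsto m F B"
  shows "A = B"
proof (rule eq_matI)
  fix i j assume "i < dim_row B" "j < dim_col B"
  then have "i < m" "j < m" using assms by (auto simp: mat_tendsto_def)
  then have "(\<lambda>k. F k $$ (i, j)) \<longlonglongrightarrow> A $$ (i, j)" "(\<lambda>k. F k $$ (i, j)) \<longlonglongrightarrow> B $$ (i, j)"
    using assms by (simp_all add: mat_tendsto_def)
  then show "A $$ (i, j) = B $$ (i, j)" by (rule LIMSEQ_unique)
qed (use assms in \<open>auto simp: mat_tendsto_def\<close>)

lemma mat_tendsto_bnd:
  assumes F: "mat_tendsto m F A" and b: "\<And>k. bnd m K (F k)"
  shows "bnd m K A"
proof (rule bndI)
  have c: "F k \<in> carrier_mat m m" and Ac: "A \<in> carrier_mat m m" for k using F by (auto simp: mat_tendsto_def)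
  show "A \<in> carrier_mat m m" by (rule Ac)
  show "0 \<le> K" using b bnd_nonneg by blast
  fix v :: "complex vec" assume v: "v \<in> carrier_vec m"
  have e: "vec_l2 (C *\<^sub>v v) = sqrt (\<Sum>i<m. (cmod (\<Sum>j<m. C $$ (i, j) * v $ j))\<^sup>2)"
    if "C \<in> carrier_mat m m" for C
    using that v by (simp add: vec_l2_def L2_set_def index_mult_mat_vec_sum[OF that v] del: index_mult_mat_vec)
  have "(\<lambda>k. sqrt (\<Sum>i<m. (cmod (\<Sum>j<m. F k $$ (i, j) * v $ j))\<^sup>2)) \<longlonglongrightarrow>
      sqrt (\<Sum>i<m. (cmod (\<Sum>j<m. A $$ (i, j) * v $ j))\<^sup>2)"
    using F by (intro tendsto_intros) (auto simp: mat_tendsto_def)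
  then have "(\<lambda>k. vec_l2 (F k *\<^sub>v v)) \<longlonglongrightarrow> vec_l2 (A *\<^sub>v v)"
    by (simp only: e[OF c] e[OF Ac])
  then show "vec_l2 (A *\<^sub>v v) \<le> K * vec_l2 v"
    by (rule LIMSEQ_le_const2) (use bndD[OF b v] in auto)
qed

lemma nc_bounded_limit:
  assumes d: "1 \<le> d" and F: "\<And>k. nc_bounded d K (F k)"
    and conv: "\<And>m X i j. 1 \<le> m \<Longrightarrow> X \<in> row_ball_level d m \<Longrightarrow> i < m \<Longrightarrow> j < m \<Longrightarrow>
      convergent (\<lambda>k. F k X $$ (i, j))"
  obtains f where "nc_bounded d K f"
    "\<And>m X. 1 \<le> m \<Longrightarrow> X \<in> row_ball_level d m \<Longrightarrow> mat_tendsto m (\<lambda>k. F k X) (f X)"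
proof -
  define f where "f X = mat (dim_row (X ! 0)) (dim_row (X ! 0)) (\<lambda>(i, j). lim (\<lambda>k. F k X $$ (i, j)))" for X
  have Fc: "F k X \<in> carrier_mat m m" if "1 \<le> m" "X \<in> row_ball_level d m" for k m X
    using bnd_carrier[OF nc_boundedD[OF F that]] .
  have f: "mat_tendsto m (\<lambda>k. F k X) (f X)" if "1 \<le> m" "X \<in> row_ball_level d m" for m X
    using that Fc[OF that] conv[OF that] row_ball_level_nth[OF that(2), of 0] d
    by (auto simp: mat_tendsto_def f_def convergent_LIMSEQ_iff)
  have "nc_function d f"
  proof (rule nc_functionI)
    fix m X assume "1 \<le> m" "X \<in> row_ball_level d m"
    then show "f X \<in> carrier_mat m m" using f mat_tendsto_def by blast
  next
    fix m n X Y assume *: "1 \<le> m" "1 \<le> n" "X \<in> row_ball_level d m" "Y \<in> row_ball_level d n"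
    \<comment> \<open>Convergence at the direct sum is inherited from the two summands, through the
      nc property of each approximant.\<close>
    have L: "mat_tendsto (m + n) (\<lambda>k. F k (tuple_dsum X Y)) (mat_dsum (f X) (f Y))"
      unfolding nc_function_dsum[OF nc_bounded_nc[OF F] *] using * by (intro mat_tendsto_dsum f)
    have "tuple_dsum X Y ! 0 = mat_dsum (X ! 0) (Y ! 0)"
      using * d by (auto simp: tuple_dsum_def row_ball_level_def)
    then have "dim_row (tuple_dsum X Y ! 0) = m + n"
      using mat_dsum_carrier[OF row_ball_level_nth[OF *(3), of 0] row_ball_level_nth[OF *(4), of 0]] d by auto
    then have "mat_tendsto (m + n) (\<lambda>k. F k (tuple_dsum X Y)) (f (tuple_dsum X Y))"
      using L by (auto simp: mat_tendsto_def f_def intro!: convergent_LIMSEQ_iff[THEN iffD1] convergentI)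
    then show "f (tuple_dsum X Y) = mat_dsum (f X) (f Y)" using L by (rule mat_tendsto_unique)
  next
    fix m X S T assume *: "1 \<le> m" "X \<in> row_ball_level d m" "S \<in> carrier_mat m m" "T \<in> carrier_mat m m"
      "S * T = 1\<^sub>m m" "T * S = 1\<^sub>m m" "map (\<lambda>A. T * A * S) X \<in> row_ball_level d m"
    have "mat_tendsto m (\<lambda>k. F k (map (\<lambda>A. T * A * S) X)) (T * f X * S)"
      unfolding nc_function_similar[OF nc_bounded_nc[OF F] *] using *
      by (intro mat_tendsto_mult mat_tendsto_const f)
    then show "f (map (\<lambda>A. T * A * S) X) = T * f X * S"
      using mat_tendsto_unique[OF f[OF *(1,7)]] by blast
  qed
  moreover have "bnd m K (f X)" if "1 \<le> m" "X \<in> row_ball_level d m" for m X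
    using nc_boundedD[OF F that] by (rule mat_tendsto_bnd[OF f[OF that]])
  ultimately have "nc_bounded d K f" by (simp add: nc_bounded_def)
  then show thesis using that f by blast
qed

lemma convergent_geometric_increments:
  fixes e :: "nat \<Rightarrow> complex"
  assumes "0 \<le> r" "r < 1" "\<And>k. cmod (e (Suc k) - e k) \<le> C * r ^ k"
  shows "convergent e"
proof -
  have "summable (\<lambda>k. C * r ^ k)" using assms by (intro summable_mult summable_geometric) auto
  then have "summable (\<lambda>k. e (Suc k) - e k)"
    by (rule summable_comparison_test'[where N = 0]) (rule assms(3))
  then have "(\<lambda>n. \<Sum>k<n. e (Suc k) - e k) \<longlonglongrightarrow> (\<Sum>k. e (Suc k) - e k)" by (rule summable_LIMSEQ)
  then have "(\<lambda>n. e n - e 0) \<longlonglongrightarrow> (\<Sum>k. e (Suc k) - e k)" by (simp only: sum_lessThan_telescope)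
  then have "(\<lambda>n. (e n - e 0) + e 0) \<longlonglongrightarrow> (\<Sum>k. e (Suc k) - e k) + e 0"
    by (intro tendsto_add tendsto_const)
  then show ?thesis by (auto simp: convergent_def)
qed

text \<open>The norm budget: each term is the midpoint between 1 and the larger of the previous term
  and the next \<open>\<rho>\<close>. The strict growth pays for the gluing steps, and the lower
  bound 1/2 serves \<open>exists_mob_parameter\<close>.\<close>

lemma exists_increasing_majorant:
  assumes "\<And>i::nat. 0 \<le> \<rho> i \<and> \<rho> i < (1 :: real)"
  obtains \<mu> where "\<And>k. \<rho> k < \<mu> k" "\<And>k. \<mu> k < 1" "\<And>k. \<mu> k < \<mu> (Suc k)" "\<And>k. 1 / 2 \<le> \<mu> k"
proof -
  define \<mu> where "\<mu> = rec_nat ((1 + \<rho> 0) / 2) (\<lambda>k x. (1 + max x (\<rho> (Suc k))) / 2)"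
  have s: "\<mu> 0 = (1 + \<rho> 0) / 2" "\<mu> (Suc k) = (1 + max (\<mu> k) (\<rho> (Suc k))) / 2" for k
    by (simp_all add: \<mu>_def)
  have 1: "\<mu> k < 1" for k by (induction k) (use assms in \<open>auto simp: s\<close>)
  have 2: "\<rho> k < \<mu> k" for k
  proof (cases k)
    case 0
    then show ?thesis using assms[of 0] by (simp add: s)
  next
    case (Suc j)
    have "\<rho> k \<le> max (\<mu> j) (\<rho> k)" by simp
    with assms[of k] have "2 * \<rho> k < 1 + max (\<mu> j) (\<rho> k)" by linarith
    then show ?thesis unfolding Suc s by simp
  qed
  have 3: "1 / 2 \<le> \<mu> k" for k
    by (cases k) (use assms in \<open>auto simp: s le_max_iff_disj\<close>)
  have 4: "\<mu> k < \<mu> (Suc k)" for k using 1[of k] by (simp add: s)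
  show thesis by (rule that[of \<mu>, OF 2 1 4 3])
qed

text \<open>Everything up to \<open>\<psi>\<close> is built from \<open>\<rho>\<close> and
  \<open>n\<close> alone, so the nodes are fixed before any targets are considered.\<close>

lemma interpolating_sequence:
  fixes \<rho> :: "nat \<Rightarrow> real" and n :: "nat \<Rightarrow> nat"
  assumes d: "1 \<le> d" and \<rho>: "\<And>i. 0 \<le> \<rho> i \<and> \<rho> i < 1" and n: "\<And>i. 1 \<le> n i"
    and triv: "d = 1 \<Longrightarrow> \<forall>i. n i = 1 \<or> \<rho> i = 0"
  obtains X where "\<And>i. X i \<in> row_ball_level d (n i)"
    "\<And>Y. (\<And>i. bnd (n i) (\<rho> i) (Y i)) \<Longrightarrow> \<exists>f. nc_bounded d 1 f \<and> (\<forall>i. f (X i) = Y i)"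
proof -
  obtain \<mu> where \<mu>: "\<And>k. \<rho> k < \<mu> k" "\<And>k. \<mu> k < 1" "\<And>k. \<mu> k < \<mu> (Suc k)" "\<And>k. 1 / 2 \<le> \<mu> k"
    using exists_increasing_majorant[of \<rho>] \<rho> by blast
  obtain \<alpha> where \<alpha>: "\<And>k. 1 / 2 \<le> \<alpha> k" "\<And>k. \<alpha> k < 1"
      "\<And>k. \<mu> k * ((1 + (1 / \<alpha> k)\<^sup>2) / 2) = \<mu> (Suc k)"
    using exists_mob_parameter[OF \<mu>(4,3,2)] by metis
  have \<alpha>0: "0 < \<alpha> k" for k using \<alpha>(1)[of k] by linarith
  \<comment> \<open>The scalar at which the peak equals 1. It is strictly below 1 because (1 -
    \<alpha>)^2 > 0, so a Blaschke product can reach it in modulus.\<close>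
  define b where "b k = 2 * \<alpha> k / (1 + (\<alpha> k)\<^sup>2)" for k
  have b: "0 < b k" "b k < 1" for k
  proof -
    have p: "0 < 1 + (\<alpha> k)\<^sup>2" by (simp add: add_pos_nonneg)
    have "0 < (1 - \<alpha> k)\<^sup>2" using \<alpha>(2)[of k] by simp
    then show "0 < b k" "b k < 1" using \<alpha>0[of k] p by (simp_all add: b_def power2_eq_square algebra_simps)
  qed
  \<comment> \<open>The \<open>L k\<close>-th power of the first coordinate is scalar at the nodes \<open>0, \<dots>, k\<close>, and
    \<open>L k > k\<close> makes the increments summable at every point of the row ball.\<close>
  define L where "L k = Suc k * (\<Prod>i\<le>k. n i)" for k
  have np: "0 < (\<Prod>i\<le>k. n i)" for k using n by (intro prod_pos) (auto simp: Suc_le_eq)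
  have Lk: "Suc k \<le> L k" for k
  proof -
    have "1 \<le> (\<Prod>i\<le>k. n i)" using np[of k] by linarith
    then have "Suc k * 1 \<le> Suc k * (\<Prod>i\<le>k. n i)" by (rule mult_le_mono2)
    then show ?thesis by (simp only: L_def mult_1_right)
  qed
  have L: "1 \<le> L k" for k using Lk[of k] by simp
  have nL: "n i dvd L k" if "i \<le> k" for i k
    unfolding L_def using that by (intro dvd_mult) (auto intro: dvd_prodI)
  have pw: "x ^ L k \<in> {0<..<1}" if "x \<in> {0<..<1}" for x :: real and k
    using that L[of k] power_less_one_iff[of x "L k"] by auto
  \<comment> \<open>The length of the list serves as the index of the new node. The first condition
    makes one-point interpolation fit the budget; the second allows the Blaschke product to be
    rescaled to the value \<open>b\<close> without leaving the unit ball.\<close>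
  have choice: "\<exists>x. x \<in> {0<..<1} \<and> \<rho> (length ts) / x ^ (4 * n (length ts)) \<le> \<mu> (length ts) \<and>
      b (length ts) \<le> \<bar>blaschke_value (map (\<lambda>s. s ^ L (length ts)) ts) (x ^ L (length ts))\<bar>"
    if "set ts \<subseteq> {0<..<1}" for ts
  proof -
    have "set (map (\<lambda>s. s ^ L (length ts)) ts) \<subseteq> {0<..<1}"
      using that pw by (force simp del: greaterThanLessThan_iff)
    then show ?thesis
      using exists_node_parameter[OF L[of "length ts"], of "\<rho> (length ts)" "\<mu> (length ts)" "b (length ts)"
        "map (\<lambda>s. s ^ L (length ts)) ts" "n (length ts)"] \<rho> \<mu>(1) b(2) by simp
  qed
  obtain t where t01: "\<And>k. t k \<in> {0<..<1::real}"
    and tP: "\<And>k. \<rho> (length (map t [0..<k])) / t k ^ (4 * n (length (map t [0..<k]))) \<le> \<mu> (length (map t [0..<k])) \<and>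
      b (length (map t [0..<k])) \<le> \<bar>blaschke_value (map (\<lambda>s. s ^ L (length (map t [0..<k]))) (map t [0..<k]))
        (t k ^ L (length (map t [0..<k])))\<bar>"
    by (rule dependent_list_choice[OF choice]) blast+
  define ts where "ts k = map (\<lambda>i. t i ^ L k) [0..<k]" for k
  define \<beta> where "\<beta> k = blaschke_value (ts k) (t k ^ L k)" for k
  have t: "0 < t k" "t k < 1" for k using t01[of k] by auto
  have t\<mu>: "\<rho> k / t k ^ (4 * n k) \<le> \<mu> k" and \<beta>: "b k \<le> \<bar>\<beta> k\<bar>" for k
    using tP[of k] by (simp_all add: \<beta>_def ts_def comp_def)
  have ts: "set (ts k) \<subseteq> {0<..<1}" for k using pw[OF t01] by (auto simp: ts_def)
  define X where "X i = node d (n i) (t i)" for i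
  have X: "X i \<in> row_ball_level d (n i)" for i
    unfolding X_def using node_in_row_ball[OF d t] .
  \<comment> \<open>\<open>\<beta> k\<close> is the Blaschke value at the new node. Its modulus is
    at least \<open>b k\<close>, so the factor has modulus at most 1 and moves this value to
    \<open>b k\<close> exactly.\<close>
  define \<psi> where "\<psi> k Z = of_real (b k / \<beta> k) \<cdot>\<^sub>m blaschke (ts k) ((Z ! 0) ^\<^sub>m L k)" for k Z
  have q: "cmod (of_real (b k / \<beta> k)) \<le> 1" for k
    using b[of k] \<beta>[of k] by (simp add: norm_divide divide_le_eq_1)
  have \<beta>0: "\<beta> k \<noteq> 0" for k using b(1)[of k] \<beta>[of k] by auto
  have \<psi>1: "nc_bounded d 1 (\<psi> k)" for k
  proof -
    have "nc_bounded d (cmod (of_real (b k / \<beta> k)) * 1) (\<psi> k)"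
      unfolding \<psi>_def by (intro nc_bounded_smult nc_bounded_blaschke nc_bounded_pow d ts)
    then show ?thesis using q[of k] by (auto simp: nc_bounded_def intro: bnd_mono)
  qed
  have X0: "(X i ! 0) ^\<^sub>m L k = of_real (t i ^ L k) \<cdot>\<^sub>m 1\<^sub>m (n i)" if "i \<le> k" for i k
    unfolding X_def node_0 using scaled_clock_pow_scalar[OF n nL[OF that]] by simp
  have bl: "blaschke (ts k) ((X i ! 0) ^\<^sub>m L k) =
      of_real (blaschke_value (ts k) (t i ^ L k)) \<cdot>\<^sub>m 1\<^sub>m (n i)" if "i \<le> k" for i k
    unfolding X0[OF that] using pw[OF t01, of i k] ts by (intro blaschke_scalar) auto
  have \<psi>_old: "\<psi> k (X i) = 0 \<cdot>\<^sub>m 1\<^sub>m (n i)" if "i < k" for i k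
  proof -
    have "blaschke_value (ts k) (t i ^ L k) = 0" using that by (intro blaschke_value_zero) (auto simp: ts_def)
    then show ?thesis unfolding \<psi>_def bl[OF less_imp_le[OF that]] by (auto intro!: eq_matI)
  qed
  have \<psi>_new: "\<psi> k (X k) = of_real (b k) \<cdot>\<^sub>m 1\<^sub>m (n k)" for k
    unfolding \<psi>_def bl[OF order_refl] \<beta>_def[symmetric] using \<beta>0[of k] by (auto intro!: eq_matI)
  have "\<exists>f. nc_bounded d 1 f \<and> (\<forall>i. f (X i) = Y i)" if Y: "\<And>i. bnd (n i) (\<rho> i) (Y i)" for Y
  proof -
    have "\<exists>h. nc_bounded d (\<mu> i) h \<and> h (X i) = Y i" for i
    proof -
      have "d = 1 \<Longrightarrow> n i = 1 \<or> Y i = 0\<^sub>m (n i) (n i)"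
      proof -
        assume "d = 1"
        then have "n i = 1 \<or> \<rho> i = 0" using triv by blast
        moreover have "Y i = 0\<^sub>m (n i) (n i)" if "\<rho> i = 0"
          using bnd_entry[OF Y[of i]] bnd_carrier[OF Y[of i]] that by (auto intro!: eq_matI)
        ultimately show ?thesis by blast
      qed
      then show ?thesis
        using single_node_interpolation[OF d n t Y _ t\<mu>, of i] unfolding X_def by metis
    qed
    then obtain h where h: "\<And>i. nc_bounded d (\<mu> i) (h i)" "\<And>i. h i (X i) = Y i" by metis
    \<comment> \<open>\<open>F k\<close> is responsible for the nodes with index below
      \<open>k\<close> only, so the zero function can start the recursion.\<close>
    define F where "F = rec_nat (\<lambda>Z. aff 0 0 (Z ! 0)) (\<lambda>k G Z. glue (\<alpha> k) (\<psi> k Z) (G Z) (h k Z))"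
    have F: "F 0 Z = aff 0 0 (Z ! 0)" "F (Suc k) Z = glue (\<alpha> k) (\<psi> k Z) (F k Z) (h k Z)" for k Z
      by (simp_all add: F_def)
    have F\<mu>: "nc_bounded d (\<mu> k) (F k)" for k
    proof (induction k)
      case 0
      have "0 \<le> \<mu> 0" using \<mu>(4)[of 0] by linarith
      then show ?case using nc_bounded_const[OF d, of 0] F(1)
        by (auto simp: nc_bounded_def F_def intro: bnd_mono)
    next
      case (Suc k)
      have "F (Suc k) = (\<lambda>Z. glue (\<alpha> k) (\<psi> k Z) (F k Z) (h k Z))" using F(2) by blast
      then show ?case using nc_bounded_glue[OF \<psi>1 Suc h(1) \<alpha>0 \<alpha>(2,3)] by simp
    qed
    have weak: "nc_bounded d 1 (F k)" "nc_bounded d 1 (h k)" for k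
      using nc_bounded_mono F\<mu>[of k] h(1)[of k] \<mu>(2)[of k] by (blast intro: less_imp_le)+
    have conv: "convergent (\<lambda>k. F k Z $$ (i, j))"
      if m: "1 \<le> m" and Z: "Z \<in> row_ball_level d m" and ij: "i < m" "j < m" for m Z i j
    proof -
      obtain r where r: "r < 1" "bnd m r (Z ! 0)" using row_ball_level_first[OF Z d] .
      have r0: "0 \<le> r" using bnd_nonneg[OF r(2)] .
      let ?C = "2 * (1 / (1 - r)) * (1 + 1 / (1 - r))"
      show ?thesis
      proof (rule convergent_geometric_increments[OF r0 r(1)])
        fix k
        \<comment> \<open>The exponent \<open>L k\<close> plays two roles: being at least 1 it keeps
          the denominators above 1 - r for all \<open>k\<close>, and being larger than
          \<open>k\<close> it yields the decay \<open>r ^ k\<close>.\<close>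
        have Lr: "r ^ L k \<le> r ^ Suc k" using Lk r0 r(1) by (intro power_decreasing) auto
        also have "\<dots> \<le> r" using r0 r(1) power_decreasing[of 1 "Suc k" r] by simp
        finally have s: "r ^ L k \<le> r" "r ^ L k < 1" using r(1) by auto
        have s0: "0 \<le> r ^ L k" using r0 by simp
        have "bnd m (cmod (of_real (b k / \<beta> k)) * r ^ L k) (\<psi> k Z)"
          unfolding \<psi>_def by (intro bnd_smult bnd_blaschke bnd_pow r(2) ts) (use s in simp)
        then have "bnd m (r ^ L k) (\<psi> k Z)"
          by (rule bnd_mono) (use q[of k] s0 in \<open>intro mult_left_le_one_le; simp\<close>)
        then have "cmod (F (Suc k) Z $$ (i, j) - F k Z $$ (i, j)) \<le>
            2 * (r ^ L k / (1 - r ^ L k)) * (1 + r ^ L k / (1 - r ^ L k))"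
          unfolding F(2) using s(2) weak[of k] m Z \<alpha> ij by (intro glue_close) (auto intro: nc_boundedD)
        also have "\<dots> \<le> 2 * (r ^ k / (1 - r)) * (1 + 1 / (1 - r))"
        proof -
          have "r ^ L k \<le> r ^ k" using Lk[of k] r0 r(1) by (intro power_decreasing) auto
          then have 1: "r ^ L k / (1 - r ^ L k) \<le> r ^ k / (1 - r)" using s s0 r by (intro frac_le) auto
          have 2: "r ^ L k / (1 - r ^ L k) \<le> 1 / (1 - r)" using s s0 r by (intro frac_le) auto
          show ?thesis using 1 2 s s0 r r0 by (intro mult_mono add_mono) auto
        qed
        finally show "cmod (F (Suc k) Z $$ (i, j) - F k Z $$ (i, j)) \<le> ?C * r ^ k"
          by (simp only: divide_inverse mult_1_left mult_ac)
      qed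
    qed
    obtain f where f: "nc_bounded d 1 f"
      "\<And>m Z. 1 \<le> m \<Longrightarrow> Z \<in> row_ball_level d m \<Longrightarrow> mat_tendsto m (\<lambda>k. F k Z) (f Z)"
    proof (rule nc_bounded_limit[OF d weak(1)])
      fix m Z i j assume "1 \<le> m" "Z \<in> row_ball_level d m" "i < m" "j < m"
      then show "convergent (\<lambda>k. F k Z $$ (i, j))" by (rule conv)
    qed blast
    have carr: "F k (X i) \<in> carrier_mat (n i) (n i)" "h k (X i) \<in> carrier_mat (n i) (n i)" for i k
      using bnd_carrier[OF nc_boundedD[OF weak(1) n X]] bnd_carrier[OF nc_boundedD[OF weak(2) n X]]
      by auto
    \<comment> \<open>Node \<open>i\<close> receives its target in the step from \<open>i\<close> to
      \<open>i + 1\<close>, where \<open>\<psi> i\<close> equals \<open>b i\<close>. In all later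
      steps \<open>\<psi>\<close> vanishes there and gluing changes nothing, so the values are
      eventually constant.\<close>
    have FX: "F k (X i) = Y i" if "i < k" for i k
      using that
    proof (induction k)
      case (Suc k)
      show ?case
      proof (cases "i = k")
        case True
        show ?thesis
          unfolding F(2) True \<psi>_new glue_one[OF carr \<alpha>0 \<alpha>(2) b_def] by (rule h(2))
      next
        case False
        then have "i < k" using Suc.prems by simp
        then show ?thesis
          unfolding F(2) \<psi>_old[OF \<open>i < k\<close>] glue_zero[OF carr \<alpha>0 \<alpha>(2)] by (rule Suc.IH)
      qed
    qed simp
    have "f (X i) = Y i" for i
    proof (rule mat_tendsto_unique[OF f(2)[OF n X]])
      have "(\<lambda>k. F k (X i) $$ (a, c)) \<longlonglongrightarrow> Y i $$ (a, c)" for a c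
        using FX[of i] by (intro tendsto_eventually eventually_sequentiallyI[of "Suc i"]) auto
      then show "mat_tendsto (n i) (\<lambda>k. F k (X i)) (Y i)"
        using carr bnd_carrier[OF Y] by (simp add: mat_tendsto_def)
    qed
    then show ?thesis using f(1) by blast
  qed
  then show thesis using that[of X] X by blast
qed

section \<open>Norm equal to one\<close>

theorem theorem8p6:
  fixes d :: nat and \<rho> :: "nat \<Rightarrow> real" and n :: "nat \<Rightarrow> nat"
  assumes "1 \<le> d"
    and "\<And>i. 0 \<le> \<rho> i \<and> \<rho> i < 1"
    and "\<And>i. 1 \<le> n i"
    and "d = 1 \<Longrightarrow> \<forall>i. n i = 1 \<or> \<rho> i = 0"
  shows "\<exists>X :: nat \<Rightarrow> complex mat list.
    (\<forall>i. X i \<in> row_ball_level d (n i)) \<and>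
    (\<forall>Y :: nat \<Rightarrow> complex mat.
       (\<forall>i. Y i \<in> carrier_mat (n i) (n i) \<and> op_norm (Y i) \<le> \<rho> i) \<longrightarrow>
       (\<exists>f \<in> H_inf d. H_inf_norm d f = 1 \<and> (\<forall>i. f (X i) = Y i)))"
proof -
  \<comment> \<open>The norm is forced to be \<open>1\<close> by interleaving points of size \<open>1\<close> with targets tending to \<open>1\<close>.\<close>
  define s :: "nat \<Rightarrow> real" where "s i = 1 - 1 / real (Suc i)" for i
  have s: "0 \<le> s i" "s i < 1" for i by (simp_all add: s_def)
  define \<rho>' where "\<rho>' k = (if even k then \<rho> (k div 2) else s (k div 2))" for k
  define n' where "n' k = (if even k then n (k div 2) else 1)" for k
  have \<rho>': "0 \<le> \<rho>' i \<and> \<rho>' i < 1" and n': "1 \<le> n' i" for i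
    using assms(2,3) s by (simp_all add: \<rho>'_def n'_def)
  \<comment> \<open>The added points have size 1, so the restriction for \<open>d = 1\<close>
    carries over to the interleaved data.\<close>
  have triv: "\<forall>i. n' i = 1 \<or> \<rho>' i = 0" if "d = 1"
    using assms(4)[OF that] by (simp add: \<rho>'_def n'_def)
  obtain X where X: "\<And>i. X i \<in> row_ball_level d (n' i)"
    "\<And>Y. (\<And>i. bnd (n' i) (\<rho>' i) (Y i)) \<Longrightarrow> \<exists>f. nc_bounded d 1 f \<and> (\<forall>i. f (X i) = Y i)"
    using interpolating_sequence[OF assms(1) \<rho>' n' triv] by blast
  have "\<exists>f \<in> H_inf d. H_inf_norm d f = 1 \<and> (\<forall>i. f (X (2 * i)) = Y i)"
    if Y: "\<And>i. Y i \<in> carrier_mat (n i) (n i) \<and> op_norm (Y i) \<le> \<rho> i" for Y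
  proof -
    define Y' where "Y' k = (if even k then Y (k div 2) else of_real (s (k div 2)) \<cdot>\<^sub>m 1\<^sub>m 1)" for k
    have "bnd (n' k) (\<rho>' k) (Y' k)" for k
    proof (cases "even k")
      case True
      have "bnd (n i) (\<rho> i) (Y i)" for i
        using Y[of i] assms(2)[of i] op_norm_le_iff_bnd[of "Y i" "n i" "\<rho> i"] by simp
      then show ?thesis using True by (simp add: Y'_def n'_def \<rho>'_def)
    next
      case False
      then show ?thesis
        using bnd_smult[OF bnd_one[of 1], where z = "of_real (s (k div 2))"] s by (simp add: Y'_def n'_def \<rho>'_def)
    qed
    then obtain f where f: "nc_bounded d 1 f" "\<And>k. f (X k) = Y' k" using X(2) by blast
    have le: "op_norm (f Z) \<le> 1" if Z: "Z \<in> row_ball d" for Z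
    proof -
      obtain m where "1 \<le> m" "Z \<in> row_ball_level d m" using Z by (auto simp: row_ball_def)
      then have "bnd m 1 (f Z)" by (rule nc_boundedD[OF f(1)])
      then show ?thesis using op_norm_le_iff_bnd[OF bnd_carrier, of m 1 "f Z" 1] by simp
    qed
    then have bdd: "bdd_above ((\<lambda>Z. op_norm (f Z)) ` row_ball d)" by (intro bdd_aboveI2)
    have Xb: "X k \<in> row_ball d" for k
    proof -
      have "1 \<le> n' k" using assms(3) by (simp add: n'_def)
      then show ?thesis using X(1)[of k] by (auto simp: row_ball_def)
    qed
    have "s i \<le> H_inf_norm d f" for i
    proof -
      have c: "f (X (2 * i + 1)) \<in> carrier_mat 1 1" by (simp add: f Y'_def)
      \<comment> \<open>At an added point the value is the 1 by 1 matrix with entry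
        \<open>s i\<close>, which bounds the supremum from below; \<open>s\<close> tends to
        1.\<close>
      have "s i = cmod (f (X (2 * i + 1)) $$ (0, 0))" using s(1)[of i] by (simp add: f Y'_def)
      also have "\<dots> \<le> op_norm (f (X (2 * i + 1)))" using bnd_op_norm[OF c] by (rule bnd_entry) auto
      also have "\<dots> \<le> H_inf_norm d f" unfolding H_inf_norm_def by (rule cSUP_upper[OF Xb bdd])
      finally show ?thesis .
    qed
    moreover have "s \<longlonglongrightarrow> 1 - 0"
      unfolding s_def[abs_def] using LIMSEQ_inverse_real_of_nat
      by (intro tendsto_diff tendsto_const) (simp add: inverse_eq_divide)
    ultimately have "1 \<le> H_inf_norm d f" by (intro LIMSEQ_le_const2[of s]) auto
    moreover have "H_inf_norm d f \<le> 1"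
      unfolding H_inf_norm_def using Xb le by (intro cSUP_least) auto
    moreover have "f \<in> H_inf d" using bdd nc_bounded_nc[OF f(1)] by (simp add: H_inf_def)
    moreover have "f (X (2 * i)) = Y i" for i by (simp add: f Y'_def)
    ultimately show ?thesis by (intro bexI[of _ f]) auto
  qed
  moreover have "X (2 * i) \<in> row_ball_level d (n i)" for i using X(1)[of "2 * i"] by (simp add: n'_def)
  ultimately show ?thesis by (intro exI[of _ "\<lambda>i. X (2 * i)"]) blast
qed

end
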